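(* Let $X,r,\rho$, the cycle $C=\{x_0,\dots,x_{p-1}\}$, the complex numbers $\alpha_0,\dots,\alpha_{p-1}$ of absolute value $1$, the space $X_\infty$, the measure $\lambda_C$ and the operators $U$ and $\pi(f)$ on $L^2(X_\infty,\lambda_C)$ be as described in the context. Assume that the cycle $C$ is repelling and that the functions $r$ and $x\mapsto\#r^{-1}(x)$ are continuous at the points in $C$. Let $m_0\in L^\infty(X,\rho)$ be a function which is $\beta$-Lipschitz at the points in $C$ and which satisfies $$\frac{1}{\#r^{-1}(x)}\sum_{y\in r^{-1}(x)}|m_0(y)|^2=1\quad(x\in X),\qquad m_0(x_i)=\alpha_i\sqrt{\#r^{-1}(r(x_i))}\quad(i\in\{0,\dots,p-1\}).$$ Define the function $\hat\varphi$ by $$\hat\varphi(x,(z_k)_{k\ge1}):=\prod_{k=1}^\infty\frac{\alpha_{i(\omega)+k}^{-1}\,m_0(z_k)}{\sqrt{\#r^{-1}(r(z_k))}},\qquad x\in X,\ \omega=(z_k)_{k\ge1}\in\mathbf N_C(x)$$ (indices of $\alpha$ modulo $p$). Then: (1) $\hat\varphi\in L^2(X_\infty,\lambda_C)$ and $U\hat\varphi=\pi(m_0)\hat\varphi$. (2) If $W(x):=|m_0(x)|^2/\#r^{-1}(r(x))$, then $C$ is a $W$-cycle (i.e. $W=1$ on $C$), and if $h_C$ is the harmonic function associated to this $W$-cycle, then $$\langle\pi(f)\hat\varphi\,|\,\hat\varphi\rangle=\int_X f\,h_C\,d\rho\qquad(f\in L^\infty(X,\rho)).$$ (3) Let $V_0$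 be the closure in $L^2(X_\infty,\lambda_C)$ of $\{\pi(f)\hat\varphi\,|\,f\in L^\infty(X,\rho)\}$ and $V_n:=U^{-n}V_0$ for $n\in\mathbb Z$. Then $V_n\subset V_{n+1}$, $$\overline{\bigcup_{n\in\mathbb Z}V_n}=L^2(X_\infty,\lambda_C),\qquad\bigcap_{n\in\mathbb Z}V_n=\{0\}.$$
   Context: $X$ is a compact metric space with metric $d$; $r:X\to X$ is a non-invertible endomorphism which is measurable, onto and finite-to-one, i.e. $0<\#r^{-1}(x)<\infty$ for all $x\in X$. $\rho$ is a strongly invariant probability measure on $X$: $\int_X f\,d\rho=\int_X\frac{1}{\#r^{-1}(x)}\sum_{y\in r^{-1}(x)}f(y)\,d\rho(x)$ for $f\in L^\infty(\rho)$. Paths: a path starting at $x$ is a sequence $(z_1,z_2,\dots)$ in $X$ with $r(z_1)=x$, $r(z_{n+1})=z_n$ for $n\ge1$; $\Omega_x$ is the set of such paths and $X_\infty=\bigcup_{x}\Omega_x$. A path $\omega=(z_1,z_2,\dots)\in\Omega_x$ (also written $(x,\omega)$) is identified with the doubly infinite sequence $(z_n)_{n\in\mathbb Z}$, $z_0=x$, $z_{-n}=r^n(x)$ for $n\ge0$; $X_\infty\subset X^{\mathbb Z}$ has the topology inherited from the product topology. $\hat r:X_\infty\to X_\infty$ is $\hat r((z_n)_{n})=(z_{n-1})_{n}$, i.e. $\hat r(x,(z_1,z_2,\dots))=(r(x),(x,z_1,z_2,\dots))$. Cycle: $C=\{x_0,\dots,x_{p-1}\}\subset X$ consists of $p$ distinct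 points with $r(x_{i+1})=x_i$ and $r(x_0)=x_{p-1}$. A fixed point $x_0$ of a map $s$ is repelling if there are $0<c<1$ and $\delta>0$ such that $d(s(x),x_0)>c^{-1}d(x,x_0)$ whenever $0<d(x,x_0)<\delta$; the cycle $C$ is repelling if each $x_i$ is repelling for $r^p$. $\mathbf N_C(x):=\{\omega=(z_1,z_2,\dots)\in\Omega_x\,|\,\lim_{n\to\infty}z_{pn}\in C\}$, and for $\omega\in\mathbf N_C(x)$, $i(\omega)\in\{0,\dots,p-1\}$ is defined by $\lim_{k}z_{kp}=x_{i(\omega)}$. The measure $\lambda_C$ on $X_\infty$ is given by $\int_{X_\infty}f\,d\lambda_C=\int_X\sum_{\omega\in\mathbf N_C(x)}f(\omega)\,d\rho(x)$. Operators on $L^2(X_\infty,\lambda_C)$: $U\xi(x,\omega)=\alpha_{i(\omega)}\sqrt{\#r^{-1}(r(x))}\;\xi(\hat r(x,\omega))$ and $\pi(f)\xi(x,\omega)=f(x)\xi(x,\omega)$ for $f\in L^\infty(X,\rho)$. $\beta$-Lipschitz: a complex-valued function $f$ on $X$ is $\beta$-Lipschitz at $x_0$ if there is a non-decreasing $\beta:[0,\infty)\to[0,\infty)$ such that $\sum_{k\ge1}\beta(Ac^k)<\infty$ for all $A>0$ and $0<c<1$, and $|f(x)-f(x_0)|\le\beta(d(x,x_0))$ for all $x$ in some neighborhood of $x_0$. Harmonic function: with $W$ as in the claim, $P_x$ is the measure on $\Omega_x$ determined on cylinder sets by $P_x(\{(z_k)\in\Omega_x\,|\,z_1=a_1,\dots,z_n=a_n\})=\prod_{k=1}^nW(a_k)$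 for $(a_1,a_2,\dots)\in\Omega_x$. The harmonic function associated to $C$ is $h_C(x):=P_x(\mathbf N_C(x))$.
   Formalization: The claim that the intersection of the V_n is {0} is stated under the added condition ρ(C)=0; without it the claim is false (e.g. X={-1}∪[0,1], r fixing -1 and the tent map on [0,1], ρ=δ_{-1}, C={-1}, m_0=1), and it fails whenever ρ(C)>0. *)

theory Defs
  imports "HOL-Probability.Probability"
begin

section \<open>Square-integrable and essentially bounded functions\<close>

text \<open>
  Elements of \<open>L\<^sup>2\<close> and \<open>L\<^sup>\<infinity>\<close> are represented by functions; equality of
  elements of \<open>L\<^sup>2\<close> is equality almost everywhere. The inner product is linear in its first argument.
\<close>

definition Linf :: "'b measure \<Rightarrow> ('b \<Rightarrow> complex) set" where
  "Linf M = {f \<in> borel_measurable M. \<exists>B. AE x in M. cmod (f x) \<le> B}"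

definition L2 :: "'b measure \<Rightarrow> ('b \<Rightarrow> complex) set" where
  "L2 M = {f \<in> borel_measurable M. integrable M (\<lambda>x. (cmod (f x))\<^sup>2)}"

definition L2_inner :: "'b measure \<Rightarrow> ('b \<Rightarrow> complex) \<Rightarrow> ('b \<Rightarrow> complex) \<Rightarrow> complex" where
  "L2_inner M f g = (\<integral>x. f x * cnj (g x) \<partial>M)"

definition L2_norm :: "'b measure \<Rightarrow> ('b \<Rightarrow> complex) \<Rightarrow> real" where
  "L2_norm M f = sqrt (\<integral>x. (cmod (f x))\<^sup>2 \<partial>M)"

definition L2_closure :: "'b measure \<Rightarrow> ('b \<Rightarrow> complex) set \<Rightarrow> ('b \<Rightarrow> complex) set" where
  "L2_closure M S = {f \<in> L2 M. \<forall>e>0. \<exists>g \<in> S \<inter> L2 M. L2_norm M (\<lambda>x. f x - g x) < e}"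

text \<open>
  For an invertible operator \<open>T\<close> on \<open>L\<^sup>2\<close> and a subspace \<open>V\<close> that is closed under almost
  everywhere equality, the subspace \<open>T\<^bsup>-n\<^esup> V\<close>, \<open>n \<in> \<int>\<close>: the preimage of \<open>V\<close> under
  \<open>T\<^sup>n\<close> if \<open>n \<ge> 0\<close>, and the image of \<open>V\<close> under \<open>T\<^bsup>-n\<^esup>\<close> if \<open>n < 0\<close>.
\<close>

definition inverse_translate ::
  "'b measure \<Rightarrow> (('b \<Rightarrow> complex) \<Rightarrow> ('b \<Rightarrow> complex)) \<Rightarrow> ('b \<Rightarrow> complex) set \<Rightarrow> int \<Rightarrow> ('b \<Rightarrow> complex) set"
  where
  "inverse_translate M T V n =
    (if n \<ge> 0 then {f \<in> L2 M. (T ^^ nat n) f \<in> V}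
     else {f \<in> L2 M. \<exists>g\<in>V. AE x in M. f x = (T ^^ nat (- n)) g x})"

section \<open>The endomorphism, its cycle, and the function \<open>m\<^sub>0\<close>\<close>

definition preim_card :: "('a \<Rightarrow> 'a) \<Rightarrow> 'a \<Rightarrow> real" where
  "preim_card r x = real (card (r -` {x}))"

text \<open>
  The integrability clause only says that the right-hand integral is meaningful (the library's
  integral of a non-integrable function is \<open>0\<close>).
\<close>

definition strongly_invariant :: "('a \<Rightarrow> 'a) \<Rightarrow> 'a measure \<Rightarrow> bool" where
  "strongly_invariant r \<rho> \<longleftrightarrow>
    (\<forall>f \<in> Linf \<rho>.
       integrable \<rho> (\<lambda>x. (\<Sum>y \<in> r -` {x}. f y) / of_real (preim_card r x)) \<and>
       (\<integral>x. f x \<partial>\<rho>) = (\<integral>x. (\<Sum>y \<in> r -` {x}. f y) / of_real (preim_card r x) \<partial>\<rho>))"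

definition is_cycle :: "('a \<Rightarrow> 'a) \<Rightarrow> nat \<Rightarrow> (nat \<Rightarrow> 'a) \<Rightarrow> bool" where
  "is_cycle r p xs \<longleftrightarrow>
    p \<ge> 1 \<and> inj_on xs {..<p} \<and> (\<forall>i. Suc i < p \<longrightarrow> r (xs (Suc i)) = xs i) \<and> r (xs 0) = xs (p - 1)"

definition cycle_set :: "nat \<Rightarrow> (nat \<Rightarrow> 'a) \<Rightarrow> 'a set" where
  "cycle_set p xs = xs ` {..<p}"

definition repelling_fixpoint :: "('a::metric_space \<Rightarrow> 'a) \<Rightarrow> 'a \<Rightarrow> bool" where
  "repelling_fixpoint s x0 \<longleftrightarrow>
    s x0 = x0 \<and>
    (\<exists>c \<delta>. 0 < c \<and> c < 1 \<and> 0 < \<delta> \<and>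
       (\<forall>x. 0 < dist x x0 \<and> dist x x0 < \<delta> \<longrightarrow> dist (s x) x0 > inverse c * dist x x0))"

definition repelling_cycle :: "('a::metric_space \<Rightarrow> 'a) \<Rightarrow> nat \<Rightarrow> (nat \<Rightarrow> 'a) \<Rightarrow> bool" where
  "repelling_cycle r p xs \<longleftrightarrow> (\<forall>i<p. repelling_fixpoint (r ^^ p) (xs i))"

definition beta_Lipschitz_at :: "('a::metric_space \<Rightarrow> complex) \<Rightarrow> 'a \<Rightarrow> bool" where
  "beta_Lipschitz_at f x0 \<longleftrightarrow>
    (\<exists>\<beta>::real \<Rightarrow> real.
       (\<forall>t\<ge>0. \<beta> t \<ge> 0) \<and> mono_on {0..} \<beta> \<and>
       (\<forall>A c. 0 < A \<and> 0 < c \<and> c < 1 \<longrightarrow> summable (\<lambda>k. \<beta> (A * c ^ Suc k))) \<and>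
       (\<forall>\<^sub>F x in nhds x0. cmod (f x - f x0) \<le> \<beta> (dist x x0)))"

section \<open>Paths\<close>

text \<open>
  A path \<open>(x, (z\<^sub>1, z\<^sub>2, \<dots>))\<close> is represented by the doubly infinite sequence \<open>z\<close> with
  \<open>z 0 = x\<close> and \<open>z (-n) = (r ^^ n) x\<close> for \<open>n \<ge> 0\<close>; both this and \<open>r (z\<^sub>1) = x\<close>, \<open>r (z\<^sub>n\<^sub>+\<^sub>1) = z\<^sub>n\<close>
  are contained in the single recursion \<open>r (z (n + 1)) = z n\<close>, \<open>n \<in> \<int>\<close>. The type \<open>int \<Rightarrow> 'a\<close> carries
  the product topology.
\<close>

definition paths :: "('a \<Rightarrow> 'a) \<Rightarrow> 'a \<Rightarrow> (int \<Rightarrow> 'a) set" where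
  "paths r x = {z. z 0 = x \<and> (\<forall>n. r (z (n + 1)) = z n)}"

definition path_space :: "('a \<Rightarrow> 'a) \<Rightarrow> (int \<Rightarrow> 'a) set" where
  "path_space r = (\<Union>x. paths r x)"

definition path_shift :: "(int \<Rightarrow> 'a) \<Rightarrow> (int \<Rightarrow> 'a)" where
  "path_shift z = (\<lambda>n. z (n - 1))"

definition cycle_paths ::
  "('a::topological_space \<Rightarrow> 'a) \<Rightarrow> nat \<Rightarrow> (nat \<Rightarrow> 'a) \<Rightarrow> 'a \<Rightarrow> (int \<Rightarrow> 'a) set" where
  "cycle_paths r p xs x =
    {z \<in> paths r x. \<exists>c \<in> cycle_set p xs. (\<lambda>n. z (int (p * n))) \<longlonglongrightarrow> c}"

definition cycle_index :: "nat \<Rightarrow> (nat \<Rightarrow> 'a::topological_space) \<Rightarrow> (int \<Rightarrow> 'a) \<Rightarrow> nat" where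
  "cycle_index p xs z = (THE i. i < p \<and> (\<lambda>k. z (int (k * p))) \<longlonglongrightarrow> xs i)"

text \<open>
  The measure \<open>\<lambda>\<^sub>C\<close>, on the Borel sets of the path space. The sum over \<open>\<omega> \<in> N\<^sub>C(x)\<close> is written
  as the integral over counting measure.

  If \<open>\<rho>(C) > 0\<close>, strong invariance forces \<open>r\<close> to be one-to-one over \<open>C\<close>, and the \<open>p\<close> periodic paths
  through \<open>C\<close> are atoms of \<open>\<lambda>\<^sub>C\<close> which \<open>U\<close> permutes (up to phases). Their indicators then belong to
  every \<open>V\<^sub>n\<close>, which is why triviality of the intersection of the \<open>V\<^sub>n\<close> needs \<open>\<rho>(C) = 0\<close>.
\<close>

definition cycle_measure ::
  "('a::topological_space \<Rightarrow> 'a) \<Rightarrow> 'a measure \<Rightarrow> nat \<Rightarrow> (nat \<Rightarrow> 'a) \<Rightarrow> (int \<Rightarrow> 'a) measure" where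
  "cycle_measure r \<rho> p xs =
    measure_of (path_space r) (sets (restrict_space borel (path_space r)))
      (\<lambda>A. \<integral>\<^sup>+x. (\<integral>\<^sup>+\<omega>. indicator A \<omega> \<partial>count_space (cycle_paths r p xs x)) \<partial>\<rho>)"

section \<open>The operators and the scaling function\<close>

definition U_op ::
  "('a::topological_space \<Rightarrow> 'a) \<Rightarrow> nat \<Rightarrow> (nat \<Rightarrow> 'a) \<Rightarrow> (nat \<Rightarrow> complex) \<Rightarrow>
    ((int \<Rightarrow> 'a) \<Rightarrow> complex) \<Rightarrow> (int \<Rightarrow> 'a) \<Rightarrow> complex" where
  "U_op r p xs \<alpha> \<xi> =
    (\<lambda>z. \<alpha> (cycle_index p xs z) * of_real (sqrt (preim_card r (r (z 0)))) * \<xi> (path_shift z))"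

definition pi_op :: "('a \<Rightarrow> complex) \<Rightarrow> ((int \<Rightarrow> 'a) \<Rightarrow> complex) \<Rightarrow> (int \<Rightarrow> 'a) \<Rightarrow> complex" where
  "pi_op f \<xi> = (\<lambda>z. f (z 0) * \<xi> z)"

text \<open>
  The function \<open>\<phi>\<close> is only specified on paths in \<open>N\<^sub>C(x)\<close>; it is extended by \<open>0\<close> to the
  remaining paths, which form a null set of \<open>\<lambda>\<^sub>C\<close>. The factor for \<open>k \<ge> 1\<close> has index \<open>k - 1\<close> below.
\<close>

definition phi_hat ::
  "('a::topological_space \<Rightarrow> 'a) \<Rightarrow> nat \<Rightarrow> (nat \<Rightarrow> 'a) \<Rightarrow> (nat \<Rightarrow> complex) \<Rightarrow> ('a \<Rightarrow> complex) \<Rightarrow>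
    (int \<Rightarrow> 'a) \<Rightarrow> complex" where
  "phi_hat r p xs \<alpha> m0 z =
    (if z \<in> cycle_paths r p xs (z 0)
     then (\<Prod>k. inverse (\<alpha> ((cycle_index p xs z + Suc k) mod p)) * m0 (z (int (Suc k)))
                / of_real (sqrt (preim_card r (r (z (int (Suc k)))))))
     else 0)"

section \<open>The harmonic function of a cycle\<close>

definition weight :: "('a \<Rightarrow> 'a) \<Rightarrow> ('a \<Rightarrow> complex) \<Rightarrow> 'a \<Rightarrow> real" where
  "weight r m0 x = (cmod (m0 x))\<^sup>2 / preim_card r (r x)"

text \<open>
  The measure \<open>P\<^sub>x\<close> determined by its values on cylinders; the cylinder of length \<open>n\<close> around the path
  \<open>a\<close> is indexed by \<open>(a, n)\<close>.
\<close>

definition path_measure :: "('a \<Rightarrow> 'a) \<Rightarrow> ('a \<Rightarrow> real) \<Rightarrow> 'a \<Rightarrow> (int \<Rightarrow> 'a) measure" where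
  "path_measure r W x =
    extend_measure (paths r x) (paths r x \<times> {1..})
      (\<lambda>(a, n). {z \<in> paths r x. \<forall>k\<in>{1..n}. z (int k) = a (int k)})
      (\<lambda>(a, n). ennreal (\<Prod>k\<in>{1..n}. W (a (int k))))"

definition harmonic_of_cycle ::
  "('a::topological_space \<Rightarrow> 'a) \<Rightarrow> nat \<Rightarrow> (nat \<Rightarrow> 'a) \<Rightarrow> ('a \<Rightarrow> real) \<Rightarrow> 'a \<Rightarrow> real" where
  "harmonic_of_cycle r p xs W x = measure (path_measure r W x) (cycle_paths r p xs x)"

end

theory Submission
  imports Defs
begin

text \<open>
  Strong invariance says in particular that fibre averages of Borel functions are Borel; then so is
  \<open>#r\<^sup>-\<^sup>1\<close>, and this takes the place of a measurable selection theorem for \<open>r\<close>. The weight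
  \<open>W\<close> sums to one over every fibre, so \<open>|\<phi>(\<omega>)|\<^sup>2\<close> is the \<open>P\<^sub>x\<close>-probability of the single
  path \<open>\<omega>\<close>, and at most one path from \<open>x\<close> has probability above one half. Repulsion and the
  \<open>\<beta>\<close>-Lipschitz condition make the tail products along a path of \<open>N\<^sub>C\<close> converge to one. Hence
  every path of \<open>N\<^sub>C\<close> is eventually the heavy path from its current point, which gives countability
  of \<open>N\<^sub>C(x)\<close> and the measurability that \<open>\<lambda>\<^sub>C\<close> needs.

  By strong invariance \<open>U\<close> is unitary, and \<open>U \<pi>(f) \<phi> = \<pi>((f \<circ> r) m\<^sub>0) \<phi>\<close> makes the \<open>V\<^sub>n\<close>
  increase. For density, all but little of \<open>U\<^sup>n \<xi>\<close> lives on paths of probability close to one, and there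
  it is nearly of the form \<open>\<pi>(g) \<phi>\<close>. For the intersection, let \<open>\<xi> = U\<^sup>n \<eta>\<close> with \<open>\<eta> \<in> V\<^sub>0\<close>. The
  part of \<open>\<xi>\<close> whose starting point is away from \<open>C\<close> is the integral of \<open>|\<xi>|\<^sup>2\<close> against
  \<open>q\<^sub>n(r\<^sup>n(x))\<close>, where \<open>q\<^sub>n(y)\<close> is the conditional probability, given \<open>N\<^sub>C\<close>, that a path from
  \<open>y\<close> is away from \<open>C\<close> at time \<open>n\<close>. Since \<open>q\<^sub>n \<rightarrow> 0\<close> pointwise and \<open>\<rho>\<close> is
  \<open>r\<close>-invariant, this tends to \<open>0\<close>.
\<close>

section \<open>Fibre sums\<close>

text \<open>The cycle acts on the proof through a few abstract facts, which the locales isolate: a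
  Borel, shift-invariant set \<open>N\<close> of paths whose tail weights tend to one, a function
  \<open>\<phi>\<close> whose squared modulus is the path weight, and its scaling equation. Phases
  and the product formula enter when these are verified. The obstacle is that sums over
  \<open>N\<close> run over a set that varies with the starting point and may be infinite, so
  neither measurability in the point nor countable additivity on the path space is free. Summing
  only over paths heavy from time \<open>n\<close> reduces, by \<open>n\<close> fibre sums, to one
  term evaluated at a Borel function of the point. For the intersection, the decisive fact is that
  the squared modulus of \<open>\<pi>(f) \<phi>\<close> spreads its mass over the paths from
  \<open>y\<close> in proportions independent of \<open>f\<close>. These proportions define
  \<open>escape\<close>, and they survive in the closure up to a constant. The argument shows that
  an element of the intersection vanishes off the paths that start in \<open>C\<close>;
  \<open>\<rho>(C) = 0\<close> removes those.\<close>

definition fibre_sum :: "('a \<Rightarrow> 'b) \<Rightarrow> ('a \<Rightarrow> ennreal) \<Rightarrow> 'b \<Rightarrow> ennreal" where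
  "fibre_sum r f x = (\<Sum>y\<in>r -` {x}. f y)"

locale invariant_system =
  fixes r :: "'a::{metric_space, second_countable_topology} \<Rightarrow> 'a"
    and \<rho> :: "'a measure"
  assumes r_measurable [measurable]: "r \<in> borel_measurable borel"
    and r_onto: "surj r"
    and r_finite_to_one: "finite (r -` {x})"
    and rho_prob: "prob_space \<rho>"
    and rho_borel [measurable_cong]: "sets \<rho> = sets borel"
    and rho_invariant: "strongly_invariant r \<rho>"
begin

lemma space_rho [simp]: "space \<rho> = UNIV"
  using sets_eq_imp_space_eq[OF rho_borel] by simp

lemma preim_card_pos: "0 < preim_card r x"
proof -
  obtain y where "x = r y" using r_onto by (rule surjE)
  then have "r -` {x} \<noteq> {}" by auto
  then show ?thesis
    using r_finite_to_one[of x] by (simp add: preim_card_def card_gt_0_iff)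
qed

text \<open>Strong invariance enters the development here, for indicators. Its integrability clause
  matters as much as the value: an integrable function is measurable, and that is the source of all
  measurability of fibre sums.\<close>

lemma fibre_average_indicator:
  assumes A [measurable]: "A \<in> sets borel"
  shows "integrable \<rho> (\<lambda>x. real (card (r -` {x} \<inter> A)) / preim_card r x)"
    and "(\<integral>x. real (card (r -` {x} \<inter> A)) / preim_card r x \<partial>\<rho>) = measure \<rho> A"
proof -
  interpret prob_space \<rho> by (rule rho_prob)
  let ?a = "\<lambda>x. real (card (r -` {x} \<inter> A)) / preim_card r x"
  have "(indicator A :: 'a \<Rightarrow> complex) \<in> Linf \<rho>"
    using A rho_borel by (auto simp: Linf_def intro!: exI[of _ 1] split: split_indicator)
  then have inv:
    "integrable \<rho> (\<lambda>x. (\<Sum>y\<in>r -` {x}. indicator A y) / of_real (preim_card r x) :: complex)"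
    "(\<integral>x. indicator A x \<partial>\<rho>) =
      (\<integral>x. (\<Sum>y\<in>r -` {x}. indicator A y) / of_real (preim_card r x) \<partial>\<rho> :: complex)"
    using rho_invariant by (simp_all add: strongly_invariant_def)
  have avg: "(\<Sum>y\<in>r -` {x}. indicator A y) / of_real (preim_card r x) = complex_of_real (?a x)"
    for x
    using r_finite_to_one[of x] by (simp add: indicator_def sum.If_cases)
  have "integrable \<rho> (\<lambda>x. Re (complex_of_real (?a x)))"
    using inv(1) unfolding avg by (rule integrable_Re)
  then show "integrable \<rho> ?a"
    unfolding Re_complex_of_real .
  have "complex_of_real (measure \<rho> A) = complex_of_real (\<integral>x. ?a x \<partial>\<rho>)"
  proof -
    have "complex_of_real (measure \<rho> A) = (\<integral>x. complex_of_real (indicator A x) \<partial>\<rho>)"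
      using rho_borel by (simp only: integral_complex_of_real) (simp add: A)
    also have "\<dots> = (\<integral>x. indicator A x \<partial>\<rho>)"
      by (intro Bochner_Integration.integral_cong) (auto split: split_indicator)
    finally show ?thesis
      using inv(2) unfolding avg integral_complex_of_real by simp
  qed
  then show "(\<integral>x. ?a x \<partial>\<rho>) = measure \<rho> A"
    by (simp only: of_real_eq_iff)
qed

lemma fibre_average_measurable:
  "A \<in> sets borel \<Longrightarrow>
    (\<lambda>x. real (card (r -` {x} \<inter> A)) / preim_card r x) \<in> borel_measurable borel"
  using borel_measurable_integrable[OF fibre_average_indicator(1)]
  by (simp add: measurable_cong_sets[OF rho_borel refl])

text \<open>So far only the averages \<open>u b\<close> are known to be Borel, and in them the
  cardinality is a denominator. A set from a countable basis can cut a finite fibre down to one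
  point, so the cardinality is a countable supremum of reciprocals.\<close>

lemma preim_card_measurable [measurable]: "preim_card r \<in> borel_measurable borel"
proof -
  obtain B :: "'a set set" where B: "countable B" "topological_basis B"
    using ex_countable_basis by blast
  have B_open: "b \<in> B \<Longrightarrow> open b" for b
    using B(2) by (rule topological_basis_open)
  define u where "u b x = real (card (r -` {x} \<inter> b)) / preim_card r x" for b x
  \<comment> \<open>A basis set isolating one point of the fibre has the least positive average, \<open>1 / #r\<^sup>-\<^sup>1(x)\<close>.\<close>
  have eq: "preim_card r x = enn2real (SUP b\<in>B. ennreal (inverse (u b x)))" for x
  proof -
    have fin: "finite (r -` {x})" by (rule r_finite_to_one)
    obtain y where y: "r y = x" using r_onto by (metis surjD)
    have "open (- (r -` {x} - {y}))"
      using fin by (intro open_Compl finite_imp_closed) auto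
    then obtain b where b: "b \<in> B" "y \<in> b" "b \<subseteq> - (r -` {x} - {y})"
      using topological_basisE[OF B(2), of "- (r -` {x} - {y})" y] by auto
    then have "r -` {x} \<inter> b = {y}" using y by auto
    then have u_b: "inverse (u b x) = preim_card r x" by (simp add: u_def)
    \<comment> \<open>A basis set that misses the fibre gives \<open>u b' x = 0\<close>, and
      \<open>inverse 0 = 0\<close> keeps it harmless in the supremum.\<close>
    have le: "inverse (u b' x) \<le> preim_card r x" for b'
      using preim_card_pos[of x]
      by (cases "card (r -` {x} \<inter> b') = 0") (auto simp: u_def field_simps)
    have "(SUP b\<in>B. ennreal (inverse (u b x))) = ennreal (preim_card r x)"
      using b(1) u_b le by (intro antisym SUP_least SUP_upper2[of b]) (auto intro!: ennreal_leI)
    then show ?thesis using preim_card_pos[of x] by simp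
  qed
  have "u b \<in> borel_measurable borel" if "b \<in> B" for b
    unfolding u_def using B_open[OF that] by (intro fibre_average_measurable) auto
  then have "(\<lambda>x. enn2real (SUP b\<in>B. ennreal (inverse (u b x)))) \<in> borel_measurable borel"
    using B(1) by measurable
  then show ?thesis by (simp add: eq[symmetric, abs_def])
qed

lemma fibre_sum_indicator: "fibre_sum r (indicator A) x = of_nat (card (r -` {x} \<inter> A))"
  using r_finite_to_one[of x]
  by (simp add: fibre_sum_def indicator_def sum.If_cases)

lemma fibre_sum_cmult: "fibre_sum r (\<lambda>y. c * f y) x = c * fibre_sum r f x"
  by (simp add: fibre_sum_def sum_distrib_left)

lemma fibre_sum_add: "fibre_sum r (\<lambda>y. f y + g y) x = fibre_sum r f x + fibre_sum r g x"
  by (simp add: fibre_sum_def sum.distrib)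

lemma fibre_sum_SUP:
  assumes "incseq f"
  shows "fibre_sum r (SUP i. f i) x = (SUP i. fibre_sum r (f i) x)"
proof -
  have "incseq (\<lambda>i. f i y)" for y
    using assms by (auto simp: incseq_def le_fun_def)
  then show ?thesis
    unfolding fibre_sum_def SUP_apply by (intro ennreal_SUP_sum[symmetric])
qed

text \<open>For an indicator the fibre count is average times cardinality, both known to be Borel;
  the rest is monotone approximation.\<close>

lemma fibre_sum_measurable [measurable]:
  assumes "f \<in> borel_measurable borel"
  shows "fibre_sum r f \<in> borel_measurable borel"
  using assms
proof (induction rule: borel_measurable_induct)
  case (cong f g)
  then show ?case by (simp add: fun_eq_iff[symmetric])
next
  case (set A)
  have "fibre_sum r (indicator A) =
      (\<lambda>x. ennreal (real (card (r -` {x} \<inter> A)) / preim_card r x * preim_card r x))"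
    using preim_card_pos less_imp_neq[OF preim_card_pos]
    by (auto simp: fun_eq_iff fibre_sum_indicator ennreal_of_nat_eq_real_of_nat)
  also have "\<dots> \<in> borel_measurable borel"
    using fibre_average_measurable[OF set]
    by (intro measurable_compose[OF _ measurable_ennreal] borel_measurable_times) simp_all
  finally show ?case .
next
  case (mult u c)
  then show ?case by (simp add: fibre_sum_cmult[abs_def])
next
  case (add u v)
  then show ?case by (simp add: fibre_sum_add[abs_def])
next
  case (seq U)
  have "fibre_sum r (SUP i. U i) = (\<lambda>x. SUP i. fibre_sum r (U i) x)"
    using fibre_sum_SUP[OF \<open>incseq U\<close>] by (rule ext)
  then show ?case using seq by (simp del: Sup_apply SUP_apply)
qed

text \<open>Extends strong invariance from bounded to nonnegative functions, since the path sums
  integrated later may be unbounded or infinite.\<close>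

lemma nn_integral_fibre_average:
  assumes "f \<in> borel_measurable borel"
  shows "(\<integral>\<^sup>+x. fibre_sum r f x / ennreal (preim_card r x) \<partial>\<rho>) = (\<integral>\<^sup>+x. f x \<partial>\<rho>)"
  using assms
proof (induction rule: borel_measurable_induct)
  case (cong f g)
  then have "f = g" by auto
  with cong show ?case by simp
next
  case (set A)
  interpret prob_space \<rho> by (rule rho_prob)
  let ?a = "\<lambda>x. real (card (r -` {x} \<inter> A)) / preim_card r x"
  have "(\<integral>\<^sup>+x. ennreal (?a x) \<partial>\<rho>) = ennreal (measure \<rho> A)"
    using fibre_average_indicator[OF set] preim_card_pos
    by (subst nn_integral_eq_integral) (auto intro!: AE_I2 divide_nonneg_pos)
  moreover have "fibre_sum r (indicator A) x / ennreal (preim_card r x) = ennreal (?a x)" for x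
    using preim_card_pos[of x]
    by (simp add: fibre_sum_indicator divide_ennreal[symmetric] ennreal_of_nat_eq_real_of_nat)
  ultimately show ?case
    using set by (simp add: emeasure_eq_measure rho_borel)
next
  case (mult u c)
  then show ?case
    by (simp add: fibre_sum_cmult ennreal_times_divide[symmetric] nn_integral_cmult)
next
  case (add u v)
  then show ?case
    by (simp add: fibre_sum_add divide_ennreal_def distrib_right nn_integral_add)
next
  case (seq U)
  have inc: "incseq (\<lambda>i x. fibre_sum r (U i) x / ennreal (preim_card r x))"
    using \<open>incseq U\<close>
    by (auto simp: incseq_def le_fun_def fibre_sum_def intro!: divide_right_mono_ennreal sum_mono)
  have "(\<integral>\<^sup>+x. fibre_sum r (SUP i. U i) x / ennreal (preim_card r x) \<partial>\<rho>)
      = (\<integral>\<^sup>+x. (SUP i. fibre_sum r (U i) x / ennreal (preim_card r x)) \<partial>\<rho>)"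
    using \<open>incseq U\<close> by (simp add: fibre_sum_SUP divide_ennreal_def SUP_mult_right_ennreal)
  also have "\<dots> = (SUP i. \<integral>\<^sup>+x. fibre_sum r (U i) x / ennreal (preim_card r x) \<partial>\<rho>)"
    using inc seq(1) by (intro nn_integral_monotone_convergence_SUP) auto
  also have "\<dots> = (SUP i. \<integral>\<^sup>+x. U i x \<partial>\<rho>)"
    using seq by simp
  also have "\<dots> = (\<integral>\<^sup>+x. (SUP i. U i) x \<partial>\<rho>)"
    unfolding SUP_apply using seq by (intro nn_integral_monotone_convergence_SUP[symmetric]) auto
  finally show ?case .
qed

text \<open>The factor \<open>preim_card r (r y)\<close> is constant on fibres and cancels the
  denominator of the average. Its square root is the factor in \<open>U_op\<close>.\<close>

lemma nn_integral_fibre_sum: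
  assumes [measurable]: "f \<in> borel_measurable borel"
  shows "(\<integral>\<^sup>+x. fibre_sum r f x \<partial>\<rho>) = (\<integral>\<^sup>+x. ennreal (preim_card r (r x)) * f x \<partial>\<rho>)"
proof -
  have "fibre_sum r (\<lambda>y. ennreal (preim_card r (r y)) * f y) x / ennreal (preim_card r x)
      = fibre_sum r f x" for x
  proof -
    have "fibre_sum r (\<lambda>y. ennreal (preim_card r (r y)) * f y) x
        = ennreal (preim_card r x) * fibre_sum r f x"
      by (simp add: fibre_sum_def sum_distrib_left)
    then show ?thesis
      using preim_card_pos[of x]
      by (simp add: ennreal_mult_divide_eq mult.commute[of "ennreal (preim_card r x)"])
  qed
  then show ?thesis
    by (subst nn_integral_fibre_average[symmetric]) simp_all
qed

text \<open>\<open>f \<circ> r\<close> is constant on the fibre over \<open>x\<close>, so its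
  average there is \<open>f x\<close>: strong invariance contains ordinary invariance.\<close>

lemma nn_integral_compose_r:
  assumes [measurable]: "f \<in> borel_measurable borel"
  shows "(\<integral>\<^sup>+x. f (r x) \<partial>\<rho>) = (\<integral>\<^sup>+x. f x \<partial>\<rho>)"
proof -
  have "fibre_sum r (\<lambda>y. f (r y)) x / ennreal (preim_card r x) = f x" for x
  proof -
    have "fibre_sum r (\<lambda>y. f (r y)) x = f x * ennreal (preim_card r x)"
      by (simp add: fibre_sum_def preim_card_def ennreal_of_nat_eq_real_of_nat mult.commute)
    then show ?thesis
      using preim_card_pos[of x] by (simp add: ennreal_mult_divide_eq)
  qed
  then show ?thesis
    by (subst nn_integral_fibre_average[symmetric]) simp_all
qed

lemma nn_integral_compose_r_pow:
  assumes [measurable]: "f \<in> borel_measurable borel"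
  shows "(\<integral>\<^sup>+x. f ((r ^^ n) x) \<partial>\<rho>) = (\<integral>\<^sup>+x. f x \<partial>\<rho>)"
proof (induction n)
  case (Suc n)
  have [measurable]: "r ^^ n \<in> borel_measurable borel" by (rule measurable_compose_n) simp
  have "(\<integral>\<^sup>+x. f ((r ^^ Suc n) x) \<partial>\<rho>) = (\<integral>\<^sup>+x. f ((r ^^ n) (r x)) \<partial>\<rho>)"
    by (simp add: funpow_swap1)
  also have "\<dots> = (\<integral>\<^sup>+x. f ((r ^^ n) x) \<partial>\<rho>)"
    by (rule nn_integral_compose_r) measurable
  finally show ?case using Suc by simp
qed simp

end

section \<open>Paths\<close>

text \<open>The inverse of \<open>path_shift\<close>. It moves forward along the path: after
  \<open>n\<close> iterations \<open>z n\<close> is the starting point.\<close>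

definition path_unshift :: "(int \<Rightarrow> 'a) \<Rightarrow> (int \<Rightarrow> 'a)" where
  "path_unshift z = (\<lambda>n. z (n + 1))"

lemma path_shift_unshift [simp]: "path_shift (path_unshift z) = z"
  by (simp add: path_shift_def path_unshift_def)

lemma path_unshift_shift [simp]: "path_unshift (path_shift z) = z"
  by (simp add: path_shift_def path_unshift_def)

lemma path_unshift_pow: "(path_unshift ^^ n) z = (\<lambda>k. z (k + int n))"
  by (induction n arbitrary: z) (auto simp: path_unshift_def algebra_simps)

lemma path_recursion: "z \<in> paths r x \<Longrightarrow> r (z (n + 1)) = z n"
  by (simp add: paths_def)

lemma path_recursion_nat: "z \<in> paths r x \<Longrightarrow> r (z (int (Suc n))) = z (int n)"
  using path_recursion[of z r x "int n"] by (simp add: add.commute)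

lemma path_start: "z \<in> paths r x \<Longrightarrow> z 0 = x"
  by (simp add: paths_def)

lemma path_space_iff: "z \<in> path_space r \<longleftrightarrow> z \<in> paths r (z 0)"
  by (auto simp: path_space_def paths_def)

lemma paths_subset_path_space: "z \<in> paths r x \<Longrightarrow> z \<in> path_space r"
  by (auto simp: path_space_def)

lemma path_pow: "z \<in> path_space r \<Longrightarrow> (r ^^ n) (z k) = z (k - int n)"
proof (induction n arbitrary: k)
  case (Suc n)
  have "r (z (k - int n)) = z (k - int n - 1)"
    using path_recursion[of z r "z 0" "k - int n - 1"] Suc(2) by (simp add: path_space_iff)
  with Suc show ?case by (simp add: algebra_simps)
qed simp

lemma path_unshift_paths: "z \<in> paths r x \<Longrightarrow> path_unshift z \<in> paths r (z 1)"
proof -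
  assume "z \<in> paths r x"
  then have "r (z (n + 1 + 1)) = z (n + 1)" for n by (rule path_recursion)
  then show ?thesis by (simp add: paths_def path_unshift_def)
qed

lemma path_shift_paths: "z \<in> paths r x \<Longrightarrow> path_shift z \<in> paths r (r x)"
proof -
  assume z: "z \<in> paths r x"
  have "r (z n) = z (n - 1)" for n
    using path_recursion[OF z, of "n - 1"] by simp
  then show ?thesis
    using path_start[OF z] by (auto simp: paths_def path_shift_def)
qed

lemma path_shift_path_space_iff [simp]: "path_shift z \<in> path_space r \<longleftrightarrow> z \<in> path_space r"
proof
  assume "path_shift z \<in> path_space r"
  then have "path_unshift (path_shift z) \<in> path_space r"
    by (metis path_space_iff path_unshift_paths paths_subset_path_space)
  then show "z \<in> path_space r" by simp
qed (metis path_space_iff path_shift_paths paths_subset_path_space)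

lemma path_unshift_path_space_iff [simp]: "path_unshift z \<in> path_space r \<longleftrightarrow> z \<in> path_space r"
  using path_shift_path_space_iff[of "path_unshift z" r] by simp

text \<open>Coordinates at nonpositive times are forced by the starting point through powers of
  \<open>r\<close>.\<close>

lemma path_eqI:
  assumes "z \<in> paths r x" "z' \<in> paths r x" "\<And>n. z (int (Suc n)) = z' (int (Suc n))"
  shows "z = z'"
proof
  fix k
  show "z k = z' k"
  proof (cases "k > 0")
    case True
    then have "k = int (Suc (nat (k - 1)))" by simp
    then show ?thesis using assms(3)[of "nat (k - 1)"] by simp
  next
    case False
    then show ?thesis
      using path_pow[of z r "nat (- k)" 0] path_pow[of z' r "nat (- k)" 0] assms(1,2)
      by (simp add: path_start paths_subset_path_space)
  qed
qed

text \<open>The sequence \<open>\<omega>\<close> counts from 0, so \<open>\<omega> n\<close> becomes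
  coordinate \<open>n + 1\<close>; this fits the index set of the product measure below.\<close>

definition extend_path :: "('a \<Rightarrow> 'a) \<Rightarrow> 'a \<Rightarrow> (nat \<Rightarrow> 'a) \<Rightarrow> int \<Rightarrow> 'a" where
  "extend_path r x \<omega> k = (if k > 0 then \<omega> (nat (k - 1)) else (r ^^ nat (- k)) x)"

lemma extend_path_paths:
  assumes "r (\<omega> 0) = x" "\<And>n. r (\<omega> (Suc n)) = \<omega> n"
  shows "extend_path r x \<omega> \<in> paths r x"
  unfolding paths_def
proof safe
  show "extend_path r x \<omega> 0 = x" by (simp add: extend_path_def)
  fix n :: int
  show "r (extend_path r x \<omega> (n + 1)) = extend_path r x \<omega> n"
  proof -
    consider "n > 0" | "n = 0" | "n < 0" by linarith
    then show ?thesis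
    proof cases
      case 1
      then have "nat n = Suc (nat (n - 1))" by simp
      then show ?thesis using 1 assms(2)[of "nat (n - 1)"] by (simp add: extend_path_def)
    next
      case 2
      then show ?thesis using assms(1) by (simp add: extend_path_def)
    next
      case 3
      then have "nat (- n) = Suc (nat (- (n + 1)))" by simp
      then show ?thesis using 3 by (simp add: extend_path_def)
    qed
  qed
qed

lemma extend_path_Suc [simp]: "extend_path r x \<omega> (int (Suc n)) = \<omega> n"
  by (simp add: extend_path_def)

text \<open>Iterate an arbitrary right inverse of \<open>r\<close>; no measurability is claimed for
  this choice.\<close>

lemma paths_nonempty:
  assumes "surj r"
  obtains z where "z \<in> paths r x"
proof -
  have s: "r (inv r y) = y" for y
    using assms by (rule surj_f_inv_f)
  have "extend_path r x (\<lambda>n. (inv r ^^ Suc n) x) \<in> paths r x"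
    by (rule extend_path_paths) (simp_all add: s)
  then show thesis by (rule that)
qed

section \<open>The backward random walk with transition weights \<open>W\<close>\<close>

definition fibre_kernel :: "('a::topological_space \<Rightarrow> 'a) \<Rightarrow> ('a \<Rightarrow> real) \<Rightarrow> 'a \<Rightarrow> 'a measure" where
  "fibre_kernel r W y = distr (point_measure (r -` {y}) (\<lambda>w. ennreal (W w))) borel (\<lambda>w. w)"

locale weighted_system = invariant_system r \<rho>
  for r :: "'a::{metric_space, second_countable_topology} \<Rightarrow> 'a" and \<rho> +
  fixes W :: "'a \<Rightarrow> real"
  assumes W_measurable [measurable]: "W \<in> borel_measurable borel"
    and W_nonneg: "0 \<le> W y"
    and W_sum: "(\<Sum>y\<in>r -` {x}. W y) = 1"
begin

lemma nn_integral_fibre_kernel: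
  assumes [measurable]: "f \<in> borel_measurable borel"
  shows "(\<integral>\<^sup>+w. f w \<partial>fibre_kernel r W y) = fibre_sum r (\<lambda>w. ennreal (W w) * f w) y"
  unfolding fibre_kernel_def
  using r_finite_to_one[of y]
  by (subst nn_integral_distr)
     (auto simp: point_measure_def nn_integral_density nn_integral_count_space_finite fibre_sum_def)

lemma sets_fibre_kernel [simp, measurable_cong]: "sets (fibre_kernel r W y) = sets borel"
  by (simp add: fibre_kernel_def)

lemma space_fibre_kernel [simp]: "space (fibre_kernel r W y) = UNIV"
  by (simp add: fibre_kernel_def)

lemma emeasure_fibre_kernel:
  "A \<in> sets borel \<Longrightarrow>
    emeasure (fibre_kernel r W y) A = fibre_sum r (\<lambda>w. ennreal (W w) * indicator A w) y"
  using nn_integral_fibre_kernel[of "indicator A" y] by simp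

lemma prob_space_fibre_kernel: "prob_space (fibre_kernel r W y)"
proof
  show "emeasure (fibre_kernel r W y) (space (fibre_kernel r W y)) = 1"
    using W_sum[of y] W_nonneg
    by (simp add: emeasure_fibre_kernel fibre_sum_def sum_ennreal)
qed

lemma fibre_kernel_measurable [measurable]:
  "fibre_kernel r W \<in> measurable borel (subprob_algebra borel)"
proof (rule measurable_subprob_algebra)
  show "subprob_space (fibre_kernel r W y)" for y
    using prob_space_fibre_kernel by (rule prob_space_imp_subprob_space)
  show "(\<lambda>y. emeasure (fibre_kernel r W y) A) \<in> borel_measurable borel" if "A \<in> sets borel" for A
    using that by (simp add: emeasure_fibre_kernel)
qed simp_all

text \<open>The Ionescu-Tulcea theorem gives the law of the walk on all sequences in the space,
  because every kernel lives on the full Borel sigma-algebra. The recursion in \<open>r\<close>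
  therefore holds only almost surely and is recorded as a separate clause.\<close>

lemma random_path_exists:
  obtains \<mu> :: "(nat \<Rightarrow> 'a) measure"
  where "prob_space \<mu>" "sets \<mu> = sets (PiM UNIV (\<lambda>_. borel))"
    "AE \<omega> in \<mu>. r (\<omega> 0) = x \<and> (\<forall>n. r (\<omega> (Suc n)) = \<omega> n)"
    "\<forall>a n. r (a 0) = x \<longrightarrow> (\<forall>k. r (a (Suc k)) = a k) \<longrightarrow>
      emeasure \<mu> {\<omega>. \<forall>k<n. \<omega> k = a k} = ennreal (\<Prod>k<n. W (a k))"
proof -
  \<comment> \<open>The state from which step \<open>i\<close> is drawn: \<open>x\<close> at first,
    afterwards the preceding coordinate.\<close>
  define prev where "prev i \<omega> = (if i = 0 then x else \<omega> (i - 1))" for i and \<omega> :: "nat \<Rightarrow> 'a"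
  let ?M = "\<lambda>_::nat. borel :: 'a measure"
  have prev_measurable [measurable]: "prev i \<in> measurable (PiM {0..<i} ?M) borel" for i
  proof (cases "i = 0")
    case False
    then have "(\<lambda>\<omega>. \<omega> (i - 1)) \<in> measurable (PiM {0..<i} ?M) borel"
      by (intro measurable_component_singleton) auto
    then show ?thesis using False by (simp add: prev_def[abs_def])
  qed (simp add: prev_def[abs_def])
  interpret IT: Ionescu_Tulcea "\<lambda>i \<omega>. fibre_kernel r W (prev i \<omega>)" ?M
    by (intro Ionescu_Tulcea.intro measurable_compose[OF prev_measurable fibre_kernel_measurable]
        prob_space_fibre_kernel)
  let ?u = "\<lambda>_::nat. undefined :: 'a"
  have u [simp]: "?u \<in> space (PiM {0..<0} ?M)" by (simp add: space_PiM)
  let ?\<mu> = IT.PF.lim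
  have lim_C: "emeasure ?\<mu> (IT.PF.emb UNIV {0..<n} X) = emeasure (IT.C 0 n ?u) X"
    if "X \<in> sets (PiM {0..<n} ?M)" for n X
    using that sets.sets_into_space[OF that]
    by (simp add: IT.lim IT.emeasure_CI[of _ n] prod_emb_id space_PiM)
  have space_emb: "IT.PF.emb UNIV {0..<n} X = {\<omega>. restrict \<omega> {0..<n} \<in> X}" for n X
    by (auto simp only: prod_emb_def space_PiM vimage_def Int_def mem_Collect_eq PiE_UNIV_domain
        space_borel UNIV_I Pi_UNIV)
  \<comment> \<open>The law of \<open>n + 1\<close> coordinates is the law of \<open>n\<close>
    coordinates followed by the kernel, so the mass of \<open>X\<close> is the integrated kernel
    mass of its sections in the last coordinate.\<close>
  have step: "emeasure (IT.C 0 (Suc n) ?u) X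
      = (\<integral>\<^sup>+\<omega>. emeasure (fibre_kernel r W (prev n \<omega>)) (fun_upd \<omega> n -` X) \<partial>IT.C 0 n ?u)"
    if X [measurable]: "X \<in> sets (PiM {0..<Suc n} ?M)" for n X
  proof -
    have "emeasure (IT.C 0 (Suc n) ?u) X = (\<integral>\<^sup>+\<omega>. emeasure (IT.eP n \<omega>) X \<partial>IT.C 0 n ?u)"
      using IT.measurable_eP[of n] IT.prob_space_C[OF u, THEN prob_space.not_empty]
      by (simp add: emeasure_bind[where N = "PiM {0..<Suc n} ?M"]
          measurable_cong_sets[OF IT.sets_C[OF u] refl])
    also have "\<dots> = (\<integral>\<^sup>+\<omega>. emeasure (fibre_kernel r W (prev n \<omega>)) (fun_upd \<omega> n -` X)
        \<partial>IT.C 0 n ?u)"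
      by (intro nn_integral_cong) (simp add: IT.emeasure_eP IT.space_C)
    finally show ?thesis .
  qed
  show thesis
  proof (rule that[of ?\<mu>])
    show "prob_space ?\<mu>"
    proof
      have "emeasure ?\<mu> (IT.PF.emb UNIV {0..<0} (space (PiM {0..<0} ?M))) = 1"
        by (subst lim_C) simp_all
      moreover have "IT.PF.emb UNIV {0..<0} (space (PiM {0..<0} ?M)) = space ?\<mu>"
        unfolding space_emb by (auto simp: space_PiM)
      ultimately show "emeasure ?\<mu> (space ?\<mu>) = 1" by simp
    qed
    show "sets ?\<mu> = sets (PiM UNIV ?M)" by simp
    show "\<forall>a n. r (a 0) = x \<longrightarrow> (\<forall>k. r (a (Suc k)) = a k) \<longrightarrow>
      emeasure ?\<mu> {\<omega>. \<forall>k<n. \<omega> k = a k} = ennreal (\<Prod>k<n. W (a k))"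
    proof (intro allI impI)
      fix a :: "nat \<Rightarrow> 'a" and n
      assume a: "r (a 0) = x" "\<forall>k. r (a (Suc k)) = a k"
      let ?B = "\<lambda>n. PiE {0..<n} (\<lambda>k. {a k})"
      have B [measurable]: "?B n \<in> sets (PiM {0..<n} ?M)" for n
        by (intro sets_PiM_I_finite) auto
      have "emeasure (IT.C 0 n ?u) (?B n) = ennreal (\<Prod>k<n. W (a k))"
      proof (induction n)
        case 0
        show ?case using B[of 0] by (simp add: emeasure_return)
      next
        case (Suc n)
        have r_a: "r (a n) = prev n a"
          using a by (cases n) (auto simp: prev_def)
        have "emeasure (fibre_kernel r W (prev n \<omega>)) (fun_upd \<omega> n -` ?B (Suc n))
            = ennreal (W (a n)) * indicator (?B n) \<omega>"
          if "\<omega> \<in> space (IT.C 0 n ?u)" for \<omega>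
        proof (cases "\<omega> \<in> ?B n")
          case True
          then have "fun_upd \<omega> n -` ?B (Suc n) = {a n}"
            by (auto simp: PiE_iff extensional_def split: if_splits)
          moreover have "prev n \<omega> = prev n a"
            using True by (cases n) (auto simp: prev_def PiE_iff)
          moreover have "fibre_sum r (\<lambda>w. ennreal (W w) * indicator {a n} w) (prev n a)
              = ennreal (W (a n))"
            using r_a r_finite_to_one
            by (simp add: fibre_sum_def indicator_def sum.If_cases if_distrib cong: if_cong)
          ultimately show ?thesis
            using True by (simp add: emeasure_fibre_kernel)
        next
          case False
          have "\<omega> \<in> extensional {0..<n}"
            using that by (simp add: IT.space_C space_PiM PiE_def)
          moreover have "\<omega> k = a k" if "fun_upd \<omega> n w \<in> ?B (Suc n)" "k < n" for w k
            using PiE_mem[OF that(1), of k] that(2) by simp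
          ultimately have "fun_upd \<omega> n -` ?B (Suc n) = {}"
            using False by (auto simp: PiE_iff)
          then show ?thesis using False by simp
        qed
        then have "emeasure (IT.C 0 (Suc n) ?u) (?B (Suc n))
            = (\<integral>\<^sup>+\<omega>. ennreal (W (a n)) * indicator (?B n) \<omega> \<partial>IT.C 0 n ?u)"
          by (subst step) (auto intro!: nn_integral_cong)
        also have "\<dots> = ennreal (W (a n)) * emeasure (IT.C 0 n ?u) (?B n)"
          by (rule nn_integral_cmult_indicator) (simp add: IT.sets_C)
        finally show ?case
          using W_nonneg by (simp add: Suc ennreal_mult[symmetric] prod_nonneg mult.commute)
      qed
      moreover have "{\<omega>. \<forall>k<n. \<omega> k = a k} = IT.PF.emb UNIV {0..<n} (?B n)"
        unfolding space_emb by (auto simp: PiE_iff)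
      ultimately show "emeasure ?\<mu> {\<omega>. \<forall>k<n. \<omega> k = a k} = ennreal (\<Prod>k<n. W (a k))"
        by (simp add: lim_C)
    qed
    \<comment> \<open>A violation at step \<open>n\<close> is an event in the first
      \<open>n + 1\<close> coordinates. Its section over any history is the complement of a fibre,
      which the kernel does not charge.\<close>
    have "AE \<omega> in ?\<mu>. r (\<omega> n) = prev n \<omega>" for n
    proof (rule AE_I)
      let ?X = "{\<omega> \<in> space (PiM {0..<Suc n} ?M). r (\<omega> n) \<noteq> prev n (restrict \<omega> {0..<n})}"
      have "(\<lambda>\<omega>. \<omega> n) \<in> measurable (PiM {0..<Suc n} ?M) borel"
        by (intro measurable_component_singleton) auto
      then have "(\<lambda>\<omega>. r (\<omega> n)) \<in> measurable (PiM {0..<Suc n} ?M) borel"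
        by (rule measurable_compose[OF _ r_measurable])
      moreover have "(\<lambda>\<omega>. restrict \<omega> {0..<n})
          \<in> measurable (PiM {0..<Suc n} ?M) (PiM {0..<n} ?M)"
        by (intro measurable_restrict_subset) auto
      then have "(\<lambda>\<omega>. prev n (restrict \<omega> {0..<n})) \<in> measurable (PiM {0..<Suc n} ?M) borel"
        by (rule measurable_compose[OF _ prev_measurable])
      ultimately have X: "?X \<in> sets (PiM {0..<Suc n} ?M)"
        by (intro sets.sets_Collect_neg measurable_equality_set)
      have null: "emeasure (fibre_kernel r W (prev n \<omega>)) (fun_upd \<omega> n -` ?X) = 0"
        if "\<omega> \<in> space (IT.C 0 n ?u)" for \<omega>
      proof -
        have \<omega>: "\<omega> \<in> extensional {0..<n}" using that by (simp add: IT.space_C space_PiM PiE_def)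
        then have res: "restrict (fun_upd \<omega> n w) {0..<n} = \<omega>" for w
          by (auto simp: restrict_def extensional_def)
        have ext: "fun_upd \<omega> n w \<in> extensional {0..<Suc n}" for w
          using \<omega> by (auto simp: extensional_def)
        have "fun_upd \<omega> n -` ?X = - (r -` {prev n \<omega>})"
          using res ext by (auto simp: space_PiM PiE_def)
        moreover have "- (r -` {prev n \<omega>}) \<in> sets borel"
          using r_finite_to_one by (intro borel_comp borel_closed finite_imp_closed)
        ultimately show ?thesis
          by (simp add: emeasure_fibre_kernel fibre_sum_def)
      qed
      have "emeasure (IT.C 0 (Suc n) ?u) ?X = (\<integral>\<^sup>+\<omega>. 0 \<partial>IT.C 0 n ?u)"
        unfolding step[OF X] by (intro nn_integral_cong null)
      then show "emeasure ?\<mu> (IT.PF.emb UNIV {0..<Suc n} ?X) = 0"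
        using X by (simp add: lim_C)
      show "IT.PF.emb UNIV {0..<Suc n} ?X \<in> sets ?\<mu>"
        using X by simp
      show "{\<omega> \<in> space ?\<mu>. \<not> r (\<omega> n) = prev n \<omega>} \<subseteq> IT.PF.emb UNIV {0..<Suc n} ?X"
        unfolding space_emb by (auto simp: space_PiM PiE_def prev_def split: if_splits)
    qed
    then have "AE \<omega> in ?\<mu>. \<forall>n. r (\<omega> n) = prev n \<omega>" by (simp add: AE_all_countable)
    then show "AE \<omega> in ?\<mu>. r (\<omega> 0) = x \<and> (\<forall>n. r (\<omega> (Suc n)) = \<omega> n)"
    proof eventually_elim
      case (elim \<omega>)
      show ?case
        using elim[THEN spec, of 0] elim[THEN spec, of "Suc _"] by (simp add: prev_def)
    qed
  qed
qed

end

section \<open>The path measure\<close>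

text \<open>A limit of partial products rather than a convergent infinite product: it may be 0
  although no factor vanishes, which the latter notion excludes.\<close>

definition path_weight :: "('a \<Rightarrow> real) \<Rightarrow> (int \<Rightarrow> 'a) \<Rightarrow> real" where
  "path_weight W z = lim (\<lambda>n. \<Prod>k<n. W (z (int (Suc k))))"

context weighted_system
begin

lemma W_le_1: "W y \<le> 1"
  using member_le_sum[of y "r -` {r y}" W] r_finite_to_one[of "r y"] W_nonneg W_sum[of "r y"]
  by simp

lemma decseq_prod_W: "decseq (\<lambda>n. \<Prod>k<n. W (z (int (Suc k))))"
  using W_nonneg W_le_1
  by (auto intro!: decseq_SucI mult_left_le prod_nonneg)

lemma path_weight_LIMSEQ: "(\<lambda>n. \<Prod>k<n. W (z (int (Suc k)))) \<longlonglongrightarrow> path_weight W z"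
proof -
  have "0 \<le> (\<Prod>k<n. W (z (int (Suc k))))" for n
    using W_nonneg by (intro prod_nonneg) simp
  then obtain L where "(\<lambda>n. \<Prod>k<n. W (z (int (Suc k)))) \<longlonglongrightarrow> L"
    using decseq_convergent[OF decseq_prod_W] by metis
  then have "convergent (\<lambda>n. \<Prod>k<n. W (z (int (Suc k))))"
    by (rule convergentI)
  then show ?thesis
    unfolding path_weight_def by (simp add: convergent_LIMSEQ_iff)
qed

lemma path_weight_nonneg: "0 \<le> path_weight W z"
  using W_nonneg by (intro LIMSEQ_le_const[OF path_weight_LIMSEQ]) (auto intro!: prod_nonneg)

lemma path_weight_le_prod: "path_weight W z \<le> (\<Prod>k<n. W (z (int (Suc k))))"
  by (rule decseq_ge[OF decseq_prod_W path_weight_LIMSEQ])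

lemma path_weight_le_1: "path_weight W z \<le> 1"
  using path_weight_le_prod[of z 0] by simp

lemma path_weight_unshift: "path_weight W z = W (z 1) * path_weight W (path_unshift z)"
proof -
  have "(\<lambda>n. \<Prod>k<Suc n. W (z (int (Suc k)))) \<longlonglongrightarrow> path_weight W z"
    using path_weight_LIMSEQ[of z] by (rule LIMSEQ_Suc)
  moreover have "(\<Prod>k<Suc n. W (z (int (Suc k)))) =
      W (z 1) * (\<Prod>k<n. W (path_unshift z (int (Suc k))))" for n
    by (subst prod.lessThan_Suc_shift) (simp add: path_unshift_def add.commute)
  ultimately have "(\<lambda>n. W (z 1) * (\<Prod>k<n. W (path_unshift z (int (Suc k)))))
      \<longlonglongrightarrow> path_weight W z"
    by simp
  moreover have "(\<lambda>n. W (z 1) * (\<Prod>k<n. W (path_unshift z (int (Suc k)))))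
      \<longlonglongrightarrow> W (z 1) * path_weight W (path_unshift z)"
    by (intro tendsto_mult_left path_weight_LIMSEQ)
  ultimately show ?thesis by (rule LIMSEQ_unique)
qed

lemma path_weight_le_unshift: "path_weight W z \<le> path_weight W (path_unshift z)"
  unfolding path_weight_unshift[of z]
  using W_le_1 W_nonneg path_weight_nonneg by (intro mult_left_le_one_le)

lemma path_weight_le_W: "path_weight W z \<le> W (z (int (Suc n)))"
proof -
  have "path_weight W z \<le> (\<Prod>k<n. W (z (int (Suc k)))) * W (z (int (Suc n)))"
    using path_weight_le_prod[of z "Suc n"] by simp
  also have "\<dots> \<le> W (z (int (Suc n)))"
    using W_le_1 W_nonneg by (intro mult_left_le_one_le prod_nonneg prod_le_1) auto
  finally show ?thesis .
qed

definition cylinder :: "'a \<Rightarrow> (int \<Rightarrow> 'a) \<Rightarrow> nat \<Rightarrow> (int \<Rightarrow> 'a) set" where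
  "cylinder x a n = {z \<in> paths r x. \<forall>k\<in>{1..n}. z (int k) = a (int k)}"

lemma path_measure_eq:
  "path_measure r W x = extend_measure (paths r x) (paths r x \<times> {1..})
    (\<lambda>(a, n). cylinder x a n) (\<lambda>(a, n). ennreal (\<Prod>k\<in>{1..n}. W (a (int k))))"
  by (simp add: path_measure_def cylinder_def)

lemma cylinders_subset: "(\<lambda>(a, n). cylinder x a n) ` (paths r x \<times> {1..}) \<subseteq> Pow (paths r x)"
  by (auto simp: cylinder_def)

lemma space_path_measure [simp]: "space (path_measure r W x) = paths r x"
  unfolding path_measure_eq by (rule space_extend_measure[OF cylinders_subset])

lemma sets_path_measure:
  "sets (path_measure r W x) =
    sigma_sets (paths r x) ((\<lambda>(a, n). cylinder x a n) ` (paths r x \<times> {1..}))"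
  unfolding path_measure_eq by (rule sets_extend_measure[OF cylinders_subset])

text \<open>\<open>extend_measure\<close> takes the prescribed values only if some measure attains
  them. The witness is the law of the backward walk, transported to
  \<open>paths r x\<close>.\<close>

lemma emeasure_cylinder:
  assumes a: "a \<in> paths r x" and n: "1 \<le> n"
  shows "emeasure (path_measure r W x) (cylinder x a n) = ennreal (\<Prod>k<n. W (a (int (Suc k))))"
proof -
  obtain \<mu> :: "(nat \<Rightarrow> 'a) measure" where \<mu>: "prob_space \<mu>" "sets \<mu> = sets (PiM UNIV (\<lambda>_. borel))"
    "AE \<omega> in \<mu>. r (\<omega> 0) = x \<and> (\<forall>n. r (\<omega> (Suc n)) = \<omega> n)"
    "\<forall>a n. r (a 0) = x \<longrightarrow> (\<forall>k. r (a (Suc k)) = a k) \<longrightarrow>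
      emeasure \<mu> {\<omega>. \<forall>k<n. \<omega> k = a k} = ennreal (\<Prod>k<n. W (a k))"
    by (rule random_path_exists[of x])
  have space_\<mu>: "space \<mu> = UNIV"
    using sets_eq_imp_space_eq[OF \<mu>(2)] by (simp add: space_PiM)
  define valid where "valid \<omega> \<longleftrightarrow> r (\<omega> 0) = x \<and> (\<forall>n. r (\<omega> (Suc n)) = \<omega> n)" for \<omega>
  \<comment> \<open>Sequences violating the recursion form a null set; sending them all to the fixed
    path \<open>a\<close> makes \<open>T\<close> map into \<open>paths r x\<close>
    everywhere.\<close>
  define T where "T \<omega> = (if valid \<omega> then extend_path r x \<omega> else a)" for \<omega>
  have coord: "(\<lambda>\<omega>. \<omega> k) \<in> borel_measurable \<mu>" for k
    by (subst measurable_cong_sets[OF \<mu>(2) refl]) simp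
  have r_coord: "(\<lambda>\<omega>. r (\<omega> k)) \<in> borel_measurable \<mu>" for k
    by (rule measurable_compose[OF coord r_measurable])
  have agree_sets: "{\<omega>. \<forall>k<n. \<omega> k = b k} \<in> sets \<mu>" for n and b :: "nat \<Rightarrow> 'a"
  proof -
    have "{\<omega> \<in> space \<mu>. \<forall>k\<in>{..<n}. \<omega> k = b k} \<in> sets \<mu>"
      using coord by (intro sets.sets_Collect_finite_All measurable_equality_set) auto
    then show ?thesis by (simp add: space_\<mu> Ball_def)
  qed
  have valid_sets: "{\<omega>. valid \<omega>} \<in> sets \<mu>"
  proof -
    have "{\<omega> \<in> space \<mu>. r (\<omega> 0) = x \<and> (\<forall>n. r (\<omega> (Suc n)) = \<omega> n)} \<in> sets \<mu>"
      using coord r_coord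
      by (intro sets.sets_Collect_conj sets.sets_Collect_countable_All measurable_equality_set) auto
    then show ?thesis by (simp add: space_\<mu> valid_def)
  qed
  have T_paths: "T \<omega> \<in> paths r x" for \<omega>
    using a by (auto simp: T_def valid_def intro!: extend_path_paths)
  have T_cylinder: "T -` cylinder x b n =
      ({\<omega>. valid \<omega>} \<inter> {\<omega>. \<forall>k<n. \<omega> k = b (int (Suc k))})
      \<union> (if a \<in> cylinder x b n then - {\<omega>. valid \<omega>} else {})" for b n
  proof -
    have "T \<omega> \<in> cylinder x b n \<longleftrightarrow> (\<forall>k<n. \<omega> k = b (int (Suc k)))" if "valid \<omega>" for \<omega>
    proof -
      have "T \<omega> \<in> cylinder x b n \<longleftrightarrow> (\<forall>k\<in>Suc ` {..<n}. T \<omega> (int k) = b (int k))"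
        using T_paths by (simp add: cylinder_def image_Suc_lessThan)
      also have "\<dots> \<longleftrightarrow> (\<forall>k<n. \<omega> k = b (int (Suc k)))"
        using that by (auto simp: T_def simp del: of_nat_Suc)
      finally show ?thesis .
    qed
    moreover have "T \<omega> = a" if "\<not> valid \<omega>" for \<omega>
      using that by (simp add: T_def)
    ultimately have "\<omega> \<in> T -` cylinder x b n \<longleftrightarrow>
        valid \<omega> \<and> (\<forall>k<n. \<omega> k = b (int (Suc k))) \<or> \<not> valid \<omega> \<and> a \<in> cylinder x b n" for \<omega>
      by (cases "valid \<omega>") (simp_all del: of_nat_Suc)
    then show ?thesis by auto
  qed
  let ?S = "sigma (paths r x) ((\<lambda>(a, n). cylinder x a n) ` (paths r x \<times> {1..}))"
  have T: "T \<in> measurable \<mu> ?S"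
  proof (rule measurable_measure_of[OF cylinders_subset])
    show "T \<in> space \<mu> \<rightarrow> paths r x" using T_paths by simp
    fix A assume "A \<in> (\<lambda>(a, n). cylinder x a n) ` (paths r x \<times> {1..})"
    then obtain b n where A: "A = cylinder x b n" by auto
    have "- {\<omega>. valid \<omega>} \<in> sets \<mu>"
      using sets.compl_sets[OF valid_sets] by (simp add: space_\<mu> Compl_eq_Diff_UNIV)
    then show "T -` A \<inter> space \<mu> \<in> sets \<mu>"
      unfolding A T_cylinder space_\<mu> using agree_sets valid_sets by auto
  qed
  let ?D = "distr \<mu> ?S T"
  have sets_D: "sets (path_measure r W x) = sets ?D"
    by (simp only: sets_path_measure sets_distr sets_measure_of[OF cylinders_subset])
  have D_cylinder: "emeasure ?D (cylinder x b n) = ennreal (\<Prod>k\<in>{1..n}. W (b (int k)))"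
    if b: "b \<in> paths r x" and n: "1 \<le> n" for b n
  proof -
    have "cylinder x b n \<in> sets ?S"
      unfolding sets_measure_of[OF cylinders_subset] using b n by (auto intro!: sigma_sets.Basic)
    then have "emeasure ?D (cylinder x b n) = emeasure \<mu> (T -` cylinder x b n \<inter> space \<mu>)"
      by (rule emeasure_distr[OF T])
    also have "\<dots> = emeasure \<mu> {\<omega>. \<forall>k<n. \<omega> k = b (int (Suc k))}"
    proof (rule emeasure_eq_AE)
      show "AE \<omega> in \<mu>. (\<omega> \<in> T -` cylinder x b n \<inter> space \<mu>) =
          (\<omega> \<in> {\<omega>. \<forall>k<n. \<omega> k = b (int (Suc k))})"
        using \<mu>(3)
      proof eventually_elim
        case (elim \<omega>)
        then have "valid \<omega>" by (simp add: valid_def)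
        then show ?case unfolding T_cylinder space_\<mu> by auto
      qed
      show "T -` cylinder x b n \<inter> space \<mu> \<in> sets \<mu>"
        using T \<open>cylinder x b n \<in> sets ?S\<close> by (rule measurable_sets)
    qed (rule agree_sets)
    also have "\<dots> = ennreal (\<Prod>k<n. W (b (int (Suc k))))"
      using \<mu>(4) path_recursion_nat[OF b] path_start[OF b] by (simp del: of_nat_Suc)
    also have "(\<Prod>k<n. W (b (int (Suc k)))) = (\<Prod>k\<in>{1..n}. W (b (int k)))"
      using prod.atLeast1_atMost_eq[of "\<lambda>k. W (b (int k))" n] by simp
    finally show ?thesis .
  qed
  have "emeasure (path_measure r W x) ((\<lambda>(a, n). cylinder x a n) (a, n))
      = (\<lambda>(a, n). ennreal (\<Prod>k\<in>{1..n}. W (a (int k)))) (a, n)"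
  proof (rule emeasure_extend_measure[OF path_measure_eq _ cylinders_subset])
    show "emeasure ?D ((\<lambda>(a, n). cylinder x a n) i) = (\<lambda>(a, n). ennreal (\<Prod>k\<in>{1..n}. W (a (int k)))) i"
      if "i \<in> paths r x \<times> {1..}" for i
      using that D_cylinder by auto
    show "positive (sets (path_measure r W x)) (emeasure ?D)"
      "countably_additive (sets (path_measure r W x)) (emeasure ?D)"
      unfolding sets_D by (rule emeasure_positive emeasure_countably_additive)+
    show "(a, n) \<in> paths r x \<times> {1..}" using a n by simp
  qed
  then show ?thesis
    using prod.atLeast1_atMost_eq[of "\<lambda>k. W (a (int k))" n] by simp
qed

lemma cylinder_sets: "a \<in> paths r x \<Longrightarrow> 1 \<le> n \<Longrightarrow> cylinder x a n \<in> sets (path_measure r W x)"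
  by (auto simp: sets_path_measure intro!: sigma_sets.Basic)

lemma singleton_eq_cylinders:
  assumes "z \<in> paths r x"
  shows "{z} = (\<Inter>n. cylinder x z (Suc n))"
proof (intro equalityI subsetI)
  fix w assume w: "w \<in> (\<Inter>n. cylinder x z (Suc n))"
  have "w = z"
  proof (rule path_eqI)
    show "w \<in> paths r x" using w by (auto simp: cylinder_def)
    show "w (int (Suc n)) = z (int (Suc n))" for n
    proof -
      have "w \<in> cylinder x z (Suc n)" using w by blast
      then have "\<forall>k\<in>{1..Suc n}. w (int k) = z (int k)" unfolding cylinder_def by blast
      then show ?thesis by (rule bspec) simp
    qed
  qed fact
  then show "w \<in> {z}" by simp
qed (use assms in \<open>auto simp: cylinder_def\<close>)

lemma singleton_sets: "z \<in> paths r x \<Longrightarrow> {z} \<in> sets (path_measure r W x)"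
  by (subst singleton_eq_cylinders) (auto intro!: sets.countable_INT' cylinder_sets)

text \<open>Continuity from above along the cylinders that shrink to \<open>z\<close>.\<close>

lemma emeasure_path_singleton:
  assumes z: "z \<in> paths r x"
  shows "emeasure (path_measure r W x) {z} = ennreal (path_weight W z)"
proof -
  have "(\<lambda>n. emeasure (path_measure r W x) (cylinder x z (Suc n)))
      \<longlonglongrightarrow> emeasure (path_measure r W x) (\<Inter>n. cylinder x z (Suc n))"
  proof (rule Lim_emeasure_decseq)
    show "range (\<lambda>n. cylinder x z (Suc n)) \<subseteq> sets (path_measure r W x)"
      using cylinder_sets[OF z] by auto
    show "decseq (\<lambda>n. cylinder x z (Suc n))"
      by (auto simp: decseq_def cylinder_def)
  qed (simp add: emeasure_cylinder[OF z])
  then have "(\<lambda>n. ennreal (\<Prod>k<Suc n. W (z (int (Suc k)))))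
      \<longlonglongrightarrow> emeasure (path_measure r W x) {z}"
    using emeasure_cylinder[OF z] singleton_eq_cylinders[OF z] by simp
  moreover have "(\<lambda>n. ennreal (\<Prod>k<Suc n. W (z (int (Suc k))))) \<longlonglongrightarrow> ennreal (path_weight W z)"
    by (intro tendsto_ennrealI LIMSEQ_Suc path_weight_LIMSEQ)
  ultimately show ?thesis by (rule LIMSEQ_unique)
qed

text \<open>The cylinders of length one cover all paths from \<open>x\<close>, and their masses
  \<open>W y\<close> add up to one over the fibre; subadditivity then bounds the whole space, hence
  every set.\<close>

lemma emeasure_path_measure_le_1: "emeasure (path_measure r W x) A \<le> 1"
proof -
  \<comment> \<open>Cylinders are indexed by whole paths, so each first step \<open>y\<close> needs
    some path from \<open>x\<close> through it.\<close>
  define b where "b y = (SOME z. z \<in> paths r x \<and> z 1 = y)" for y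
  have b: "b y \<in> paths r x" "b y 1 = y" if "r y = x" for y
  proof -
    obtain w where w: "w \<in> paths r y" using paths_nonempty[OF r_onto] by blast
    then have "path_shift w \<in> paths r x \<and> path_shift w 1 = y"
      using path_shift_paths[OF w] that by (simp add: path_shift_def path_start)
    then have "b y \<in> paths r x \<and> b y 1 = y"
      unfolding b_def by (rule someI[where P = "\<lambda>z. z \<in> paths r x \<and> z 1 = y"])
    then show "b y \<in> paths r x" "b y 1 = y" by auto
  qed
  have "paths r x \<subseteq> (\<Union>y\<in>r -` {x}. cylinder x (b y) 1)"
  proof
    fix z assume z: "z \<in> paths r x"
    then have "r (z 1) = x" using path_recursion[OF z, of 0] by (simp add: path_start)
    then show "z \<in> (\<Union>y\<in>r -` {x}. cylinder x (b y) 1)"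
      using z b by (auto simp: cylinder_def intro!: bexI[of _ "z 1"])
  qed
  then have "emeasure (path_measure r W x) (space (path_measure r W x))
      \<le> emeasure (path_measure r W x) (\<Union>y\<in>r -` {x}. cylinder x (b y) 1)"
    using b r_finite_to_one
    by (intro emeasure_mono) (auto intro!: sets.finite_UN cylinder_sets)
  also have "\<dots> \<le> (\<Sum>y\<in>r -` {x}. emeasure (path_measure r W x) (cylinder x (b y) 1))"
    using b r_finite_to_one by (intro emeasure_subadditive_finite) (auto intro!: cylinder_sets)
  also have "\<dots> = (\<Sum>y\<in>r -` {x}. ennreal (W y))"
    using b by (intro sum.cong) (auto simp: emeasure_cylinder)
  also have "\<dots> = 1" using W_sum[of x] W_nonneg by (simp add: sum_ennreal)
  finally show ?thesis using emeasure_space[of _ A] by (rule order.trans[rotated])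
qed

lemma emeasure_countable_paths:
  assumes "countable A" "A \<subseteq> paths r x"
  shows "emeasure (path_measure r W x) A = (\<integral>\<^sup>+z. ennreal (path_weight W z) \<partial>count_space A)"
  using assms
  by (subst emeasure_countable_singleton)
     (auto intro!: singleton_sets nn_integral_cong simp: emeasure_path_singleton subset_eq)

text \<open>Two paths from the same point with weights above one half would have total probability above one.\<close>

lemma heavy_path_unique:
  assumes "z \<in> paths r x" "z' \<in> paths r x" "1/2 < path_weight W z" "1/2 < path_weight W z'"
  shows "z = z'"
proof (rule ccontr)
  assume "z \<noteq> z'"
  then have "emeasure (path_measure r W x) {z, z'} = ennreal (path_weight W z + path_weight W z')"
    using assms path_weight_nonneg
    by (subst emeasure_countable_paths) (auto simp: nn_integral_count_space_finite)
  then have "path_weight W z + path_weight W z' \<le> 1"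
    using emeasure_path_measure_le_1[of x "{z, z'}"] path_weight_nonneg[of z] path_weight_nonneg[of z']
    by (simp add: ennreal_le_1 del: ennreal_plus)
  then show False using assms by simp
qed

lemma heavy_preimage_unique:
  assumes "r w = r w'" "1/2 < W w" "1/2 < W w'"
  shows "w = w'"
proof (rule ccontr)
  assume "w \<noteq> w'"
  then have "W w + W w' = sum W {w, w'}" by simp
  also have "\<dots> \<le> (\<Sum>y\<in>r -` {r w}. W y)"
    using assms(1) r_finite_to_one W_nonneg by (intro sum_mono2) auto
  finally show False using assms W_sum[of "r w"] by simp
qed

end

section \<open>Counting paths over a shift-invariant set\<close>

lemma component_measurable:
  "(\<lambda>z. z n) \<in> borel_measurable (borel :: (int \<Rightarrow> 'a::topological_space) measure)"
  by (rule measurable_product_coordinates)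

lemma path_shift_measurable [measurable]:
  "path_shift \<in> borel_measurable
    (borel :: (int \<Rightarrow> 'a::second_countable_topology) measure)"
  by (rule measurable_coordinatewise_then_product)
     (simp add: path_shift_def measurable_product_coordinates)

lemma path_unshift_measurable [measurable]:
  "path_unshift \<in> borel_measurable
    (borel :: (int \<Rightarrow> 'a::second_countable_topology) measure)"
  by (rule measurable_coordinatewise_then_product)
     (simp add: path_unshift_def measurable_product_coordinates)

lemma path_unshift_pow_measurable [measurable]:
  "path_unshift ^^ n \<in> borel_measurable
    (borel :: (int \<Rightarrow> 'a::second_countable_topology) measure)"
  by (rule measurable_compose_n) (rule path_unshift_measurable)

text \<open>\<open>cycle_measure\<close> for a general set \<open>N\<close> of paths, so that its
  measure theory can be derived from shift invariance and the tail condition of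
  \<open>path_system\<close>.\<close>

definition path_counting_measure ::
  "('a::topological_space \<Rightarrow> 'a) \<Rightarrow> 'a measure \<Rightarrow> (int \<Rightarrow> 'a) set \<Rightarrow> (int \<Rightarrow> 'a) measure" where
  "path_counting_measure r \<rho> N =
    measure_of (path_space r) (sets (restrict_space borel (path_space r)))
      (\<lambda>A. \<integral>\<^sup>+x. (\<integral>\<^sup>+\<omega>. indicator A \<omega> \<partial>count_space (N \<inter> paths r x)) \<partial>\<rho>)"

lemma (in invariant_system) paths_measurable [measurable]: "path_space r \<in> sets borel"
proof -
  have "path_space r = (\<Inter>n. {z. r (z (n + 1)) = z n})"
    by (auto simp: path_space_def paths_def)
  also have "\<dots> \<in> sets borel"
    using measurable_equality_set[OF
        measurable_compose[OF component_measurable r_measurable] component_measurable]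
    by (intro sets.countable_INT') auto
  finally show ?thesis .
qed

locale path_system = weighted_system r \<rho> W
  for r :: "'a::{metric_space, second_countable_topology} \<Rightarrow> 'a" and \<rho> W +
  fixes N :: "(int \<Rightarrow> 'a) set"
  assumes N_borel: "N \<in> sets borel"
    and N_paths: "N \<subseteq> path_space r"
    and N_shift: "path_shift z \<in> N \<longleftrightarrow> z \<in> N"
    and N_tail: "z \<in> N \<Longrightarrow> (\<lambda>n. path_weight W ((path_unshift ^^ n) z)) \<longlonglongrightarrow> 1"
begin

lemma N_path: "z \<in> N \<Longrightarrow> z \<in> paths r (z 0)"
  using N_paths path_space_iff[of z r] by auto

definition path_sum :: "((int \<Rightarrow> 'a) \<Rightarrow> ennreal) \<Rightarrow> 'a \<Rightarrow> ennreal" where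
  "path_sum g x = (\<integral>\<^sup>+z. g z \<partial>count_space (N \<inter> paths r x))"

lemma path_sum_cong: "(\<And>z. z \<in> N \<Longrightarrow> z 0 = x \<Longrightarrow> f z = g z) \<Longrightarrow> path_sum f x = path_sum g x"
  unfolding path_sum_def by (rule nn_integral_cong) (simp add: paths_def)

lemma path_sum_mono: "(\<And>z. z \<in> N \<Longrightarrow> z 0 = x \<Longrightarrow> f z \<le> g z) \<Longrightarrow> path_sum f x \<le> path_sum g x"
  unfolding path_sum_def by (rule nn_integral_mono) (simp add: paths_def)

lemma path_sum_cmult: "path_sum (\<lambda>z. c * f z) x = c * path_sum f x"
  unfolding path_sum_def by (rule nn_integral_cmult) simp

lemma path_sum_base: "path_sum (\<lambda>z. f (z 0) * g z) x = f x * path_sum g x"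
  by (subst path_sum_cmult[symmetric]) (rule path_sum_cong, simp)

lemma path_sum_add: "path_sum (\<lambda>z. f z + g z) x = path_sum f x + path_sum g x"
  unfolding path_sum_def by (rule nn_integral_add) simp_all

lemma path_sum_SUP:
  "incseq f \<Longrightarrow> path_sum (\<lambda>z. SUP i. f i z) x = (SUP i. path_sum (f i) x)"
  unfolding path_sum_def by (rule nn_integral_monotone_convergence_SUP) simp_all

lemma N_unshift: "path_unshift z \<in> N \<longleftrightarrow> z \<in> N"
  using N_shift[of "path_unshift z"] by simp

lemma N_unshift_pow: "(path_unshift ^^ n) z \<in> N \<longleftrightarrow> z \<in> N"
  by (induction n) (simp_all add: N_unshift)

text \<open>A path from \<open>x\<close> is a first step \<open>y\<close> in the fibre followed by a
  path from \<open>y\<close>, and \<open>path_shift\<close> is the bijection between the two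
  descriptions. Indicators are used because \<open>path_shift\<close> is a bijection of the entire
  type of two-sided sequences.\<close>

lemma path_sum_shift: "path_sum g x = fibre_sum r (path_sum (\<lambda>w. g (path_shift w))) x"
proof -
  have bij: "bij path_shift"
    by (rule o_bij[of path_unshift]) auto
  have eq: "g (path_shift w) * indicator (N \<inter> paths r x) (path_shift w)
      = (\<Sum>y\<in>r -` {x}. g (path_shift w) * indicator (N \<inter> paths r y) w)" for w
  proof (cases "w \<in> N \<and> r (w 0) = x")
    case True
    then have w: "w \<in> paths r (w 0)" by (simp add: N_path)
    have ind: "indicator (N \<inter> paths r y) w = (if y = w 0 then 1 else 0 :: ennreal)" for y
      using True w by (auto simp: indicator_def paths_def)
    have "path_shift w \<in> paths r x"
      using path_shift_paths[OF w] True by simp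
    moreover have "(\<Sum>y\<in>r -` {x}. g (path_shift w) * indicator (N \<inter> paths r y) w)
        = (\<Sum>y\<in>r -` {x}. if y = w 0 then g (path_shift w) else 0)"
      unfolding ind by (intro sum.cong) auto
    ultimately show ?thesis
      using True r_finite_to_one[of x] by (simp add: N_shift)
  next
    case False
    have "path_shift w \<notin> N \<inter> paths r x"
    proof
      assume *: "path_shift w \<in> N \<inter> paths r x"
      then have "w \<in> N" by (simp add: N_shift)
      moreover have "r (w 0) = x"
        using * path_pow[of w r 1 0] \<open>w \<in> N\<close> N_paths
        by (auto simp: path_shift_def paths_def)
      ultimately show False using False by simp
    qed
    moreover have "w \<notin> N \<inter> paths r y" if "r y = x" for y
      using False that by (auto simp: paths_def)
    ultimately show ?thesis by simp
  qed
  have "path_sum g x = (\<integral>\<^sup>+z. g z * indicator (N \<inter> paths r x) z \<partial>count_space UNIV)"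
    by (simp add: path_sum_def nn_integral_count_space_indicator)
  also have "\<dots> = (\<integral>\<^sup>+w. g (path_shift w) * indicator (N \<inter> paths r x) (path_shift w) \<partial>count_space UNIV)"
    by (rule nn_integral_bij_count_space[OF bij, symmetric])
  also have "\<dots> = (\<Sum>y\<in>r -` {x}. \<integral>\<^sup>+w. g (path_shift w) * indicator (N \<inter> paths r y) w \<partial>count_space UNIV)"
    unfolding eq by (rule nn_integral_sum) simp
  also have "\<dots> = fibre_sum r (path_sum (\<lambda>w. g (path_shift w))) x"
    by (simp add: fibre_sum_def path_sum_def nn_integral_count_space_indicator)
  finally show ?thesis .
qed

text \<open>One half is the threshold for uniqueness. The sets grow with \<open>n\<close> because
  dropping initial factors can only increase the weight, and they exhaust \<open>N\<close> by the
  tail condition.\<close>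

definition heavy_from :: "nat \<Rightarrow> (int \<Rightarrow> 'a) set" where
  "heavy_from n = {z \<in> N. 1/2 < path_weight W ((path_unshift ^^ n) z)}"

lemma heavy_from_Suc_shift: "path_shift z \<in> heavy_from (Suc n) \<longleftrightarrow> z \<in> heavy_from n"
  by (simp add: heavy_from_def N_shift funpow_Suc_right del: funpow.simps)

lemma incseq_heavy_from: "incseq heavy_from"
proof (rule incseq_SucI)
  fix n
  show "heavy_from n \<subseteq> heavy_from (Suc n)"
    using path_weight_le_unshift[of "(path_unshift ^^ n) _"]
    by (auto simp: heavy_from_def intro: less_le_trans)
qed

lemma UN_heavy_from: "(\<Union>n. heavy_from n) = N"
proof
  show "N \<subseteq> (\<Union>n. heavy_from n)"
  proof
    fix z assume z: "z \<in> N"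
    have "\<forall>\<^sub>F n in sequentially. 1/2 < path_weight W ((path_unshift ^^ n) z)"
      using N_tail[OF z] by (rule order_tendstoD) simp
    then obtain n where "1/2 < path_weight W ((path_unshift ^^ n) z)"
      by (auto simp: eventually_sequentially)
    with z show "z \<in> (\<Union>n. heavy_from n)" by (auto simp: heavy_from_def)
  qed
qed (auto simp: heavy_from_def)

text \<open>For \<open>n = 0\<close> there is at most one such path; each increase of
  \<open>n\<close> adds one step with finitely many choices.\<close>

lemma finite_heavy_from: "finite (heavy_from n \<inter> paths r x)"
proof (induction n arbitrary: x)
  case 0
  show ?case
  proof (cases "heavy_from 0 \<inter> paths r x = {}")
    case False
    then obtain z where z: "z \<in> heavy_from 0 \<inter> paths r x" by blast
    then have "heavy_from 0 \<inter> paths r x \<subseteq> {z}"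
      using heavy_path_unique[of z x] by (auto simp: heavy_from_def)
    then show ?thesis by (rule finite_subset) simp
  qed simp
next
  case (Suc n)
  have "heavy_from (Suc n) \<inter> paths r x \<subseteq> (\<Union>y\<in>r -` {x}. path_shift ` (heavy_from n \<inter> paths r y))"
  proof
    fix z assume z: "z \<in> heavy_from (Suc n) \<inter> paths r x"
    then have "path_unshift z \<in> heavy_from n"
      using heavy_from_Suc_shift[of "path_unshift z" n] by simp
    moreover have "path_unshift z \<in> paths r (z 1)" "r (z 1) = x"
      using z path_unshift_paths[of z r x] path_recursion[of z r x 0] by (auto simp: paths_def)
    moreover have "z = path_shift (path_unshift z)" by simp
    ultimately show "z \<in> (\<Union>y\<in>r -` {x}. path_shift ` (heavy_from n \<inter> paths r y))"
      by (metis (no_types, lifting) Int_iff UN_I image_eqI vimage_singleton_eq)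
  qed
  then show ?case
    using Suc r_finite_to_one by (auto intro: finite_subset)
qed

lemma countable_N_paths: "countable (N \<inter> paths r x)"
proof -
  have eq: "N \<inter> paths r x = (\<Union>n. heavy_from n \<inter> paths r x)"
    using UN_heavy_from by blast
  show ?thesis
    unfolding eq using finite_heavy_from by (intro countable_UN) (auto intro: countable_finite)
qed

lemma emeasure_path_measure_N:
  "emeasure (path_measure r W x) (N \<inter> paths r x) = path_sum (\<lambda>z. ennreal (path_weight W z)) x"
  by (simp add: path_sum_def emeasure_countable_paths countable_N_paths)

text \<open>The value \<open>y\<close> in the absence of a heavy preimage is a default that keeps
  the function Borel.\<close>

definition heavy_preimage :: "'a \<Rightarrow> 'a" where
  "heavy_preimage y = (if \<exists>w. r w = y \<and> 1/2 < W w then THE w. r w = y \<and> 1/2 < W w else y)"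

lemma heavy_preimage_eq: "1/2 < W w \<Longrightarrow> heavy_preimage (r w) = w"
  unfolding heavy_preimage_def
  using heavy_preimage_unique by (auto intro!: the_equality)

text \<open>A heavy preimage of \<open>y\<close> lies in \<open>A\<close> exactly when the fibre
  count of heavy points in \<open>A\<close> is at least one, a Borel condition. By uniqueness, a
  heavy preimage in \<open>E\<close> is the selected one.\<close>

lemma heavy_preimage_measurable [measurable]: "heavy_preimage \<in> borel_measurable borel"
proof (rule measurableI)
  fix E :: "'a set" assume E: "E \<in> sets borel"
  let ?H = "\<lambda>A. {y. 1 \<le> fibre_sum r (indicator ({w. 1/2 < W w} \<inter> A)) y}"
  have "{w \<in> space borel. 1/2 < W w} \<in> sets borel" by simp
  then have H_sets: "?H A \<in> sets borel" if "A \<in> sets borel" for A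
    using that measurable_sets[OF fibre_sum_measurable[OF borel_measurable_indicator], of
        "{w. 1/2 < W w} \<inter> A" "{1..}"]
    by (simp add: vimage_def sets.Int)
  have H: "y \<in> ?H A \<longleftrightarrow> (\<exists>w\<in>A. r w = y \<and> 1/2 < W w)" for y A
  proof -
    have "y \<in> ?H A \<longleftrightarrow> 1 \<le> card (r -` {y} \<inter> ({w. 1/2 < W w} \<inter> A))"
      by (simp add: fibre_sum_indicator)
    also have "\<dots> \<longleftrightarrow> r -` {y} \<inter> ({w. 1/2 < W w} \<inter> A) \<noteq> {}"
      using r_finite_to_one[of y] by (simp add: Suc_le_eq card_gt_0_iff)
    finally show ?thesis by auto
  qed
  have "y \<in> heavy_preimage -` E \<longleftrightarrow> y \<in> ?H E \<union> (E - ?H UNIV)" for y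
  proof (cases "\<exists>w. r w = y \<and> 1/2 < W w")
    case True
    then obtain w where w: "r w = y" "1/2 < W w" by blast
    then have "heavy_preimage y = w" using heavy_preimage_eq by auto
    moreover have "w' = w" if "r w' = y" "1/2 < W w'" for w'
      using w that heavy_preimage_unique by auto
    ultimately show ?thesis
      unfolding Un_iff Diff_iff H vimage_eq using w by (metis UNIV_I)
  next
    case False
    then have "heavy_preimage y = y" unfolding heavy_preimage_def by (rule if_not_P)
    then show ?thesis unfolding Un_iff Diff_iff H using False by auto
  qed
  then have "heavy_preimage -` E = ?H E \<union> (E - ?H UNIV)" by blast
  moreover have "?H E \<union> (E - ?H UNIV) \<in> sets borel"
    using E H_sets[of E] H_sets[of UNIV] by (intro sets.Un sets.Diff) auto
  ultimately show "heavy_preimage -` E \<inter> space borel \<in> sets borel" by simp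
qed simp

text \<open>It always starts at \<open>y\<close>, but it need not obey the recursion in
  \<open>r\<close> where the default of \<open>heavy_preimage\<close> intervenes.\<close>

definition heavy_path :: "'a \<Rightarrow> int \<Rightarrow> 'a" where
  "heavy_path y = extend_path r y (\<lambda>n. (heavy_preimage ^^ Suc n) y)"

lemma heavy_path_measurable [measurable]: "heavy_path \<in> borel_measurable borel"
proof (rule measurable_coordinatewise_then_product)
  fix k
  have "heavy_preimage ^^ n \<in> borel_measurable borel" "r ^^ n \<in> borel_measurable borel" for n
    by (rule measurable_compose_n; simp)+
  then show "(\<lambda>y. heavy_path y k) \<in> borel_measurable borel"
    by (cases "k > 0") (simp_all add: heavy_path_def extend_path_def del: funpow.simps)
qed

text \<open>A product of numbers in [0,1] that exceeds one half has every factor above one half, so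
  each step of \<open>z\<close> is the unique heavy preimage of the preceding point.\<close>

lemma heavy_path_eq:
  assumes z: "z \<in> paths r x" and heavy: "1/2 < path_weight W z"
  shows "heavy_path x = z"
proof -
  have W: "1/2 < W (z (int (Suc n)))" for n
    using heavy path_weight_le_W[of z n] by simp
  have step: "heavy_preimage (z (int n)) = z (int (Suc n))" for n
    using heavy_preimage_eq[OF W[of n]] path_recursion_nat[OF z, of n] by simp
  have pow: "(heavy_preimage ^^ n) x = z (int n)" for n
    by (induction n) (simp_all add: path_start[OF z] step del: of_nat_Suc)
  have coord: "heavy_path x (int (Suc n)) = z (int (Suc n))" for n
    unfolding heavy_path_def extend_path_Suc by (rule pow)
  have "heavy_path x \<in> paths r x"
    unfolding heavy_path_def
  proof (rule extend_path_paths)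
    show "r ((heavy_preimage ^^ Suc 0) x) = x"
      using pow[of 1] path_recursion_nat[OF z, of 0] path_start[OF z] by simp
    show "r ((heavy_preimage ^^ Suc (Suc n)) x) = (heavy_preimage ^^ Suc n) x" for n
      unfolding pow by (rule path_recursion_nat[OF z])
  qed
  then show ?thesis using z coord by (rule path_eqI)
qed

lemma path_weight_measurable [measurable]: "path_weight W \<in> borel_measurable borel"
  unfolding path_weight_def
  by (intro borel_measurable_lim_metric borel_measurable_prod
      measurable_compose[OF component_measurable W_measurable])

lemma N_measurable [measurable]: "N \<in> sets borel"
  by (rule N_borel)

lemma heavy_from_measurable [measurable]: "heavy_from n \<in> sets borel"
proof -
  have "(\<lambda>z. path_weight W ((path_unshift ^^ n) z)) \<in> borel_measurable borel"
    by (rule measurable_compose[OF path_unshift_pow_measurable path_weight_measurable])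
  then have "N \<inter> {z \<in> space borel. 1/2 < path_weight W ((path_unshift ^^ n) z)} \<in> sets borel"
    by (intro sets.Int N_measurable) simp
  then show ?thesis by (simp add: heavy_from_def Int_def)
qed

text \<open>For \<open>n = 0\<close> the sum has at most one term, taken at the Borel function
  \<open>heavy_path\<close>. Passing to \<open>Suc n\<close> costs one fibre sum, by
  \<open>path_sum_shift\<close>.\<close>

lemma path_sum_heavy_measurable:
  "g \<in> borel_measurable borel \<Longrightarrow>
    path_sum (\<lambda>z. g z * indicator (heavy_from n) z) \<in> borel_measurable borel"
proof (induction n arbitrary: g)
  case 0
  have "path_sum (\<lambda>z. g z * indicator (heavy_from 0) z) x
      = g (heavy_path x) * indicator (heavy_from 0) (heavy_path x) * indicator {x. heavy_path x 0 = x} x" for x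
  proof (cases "heavy_path x \<in> heavy_from 0 \<and> heavy_path x 0 = x")
    case True
    then have hp: "heavy_path x \<in> N \<inter> paths r x"
      using N_path[of "heavy_path x"] by (auto simp: heavy_from_def)
    have "path_sum (\<lambda>z. g z * indicator (heavy_from 0) z) x
        = (\<Sum>z\<in>{heavy_path x}. g z * indicator (heavy_from 0) z)"
      unfolding path_sum_def
      using hp heavy_path_eq[of _ x] by (intro nn_integral_count_space') (auto simp: heavy_from_def indicator_def)
    then show ?thesis using True by simp
  next
    case False
    have "path_sum (\<lambda>z. g z * indicator (heavy_from 0) z) x = path_sum (\<lambda>z. 0) x"
    proof (rule path_sum_cong)
      fix z assume z: "z \<in> N" "z 0 = x"
      then have zp: "z \<in> paths r x" using N_path by auto
      have "z \<notin> heavy_from 0"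
        using heavy_path_eq[OF zp] z False by (auto simp: heavy_from_def)
      then show "g z * indicator (heavy_from 0) z = 0" by simp
    qed
    also have "\<dots> = 0" by (simp add: path_sum_def)
    finally show ?thesis using False by auto
  qed
  moreover have "(\<lambda>x. g (heavy_path x) * indicator (heavy_from 0) (heavy_path x)
      * indicator {x. heavy_path x 0 = x} x) \<in> borel_measurable borel"
  proof -
    have "{x \<in> space borel. heavy_path x 0 = x} \<in> sets borel"
      by (intro measurable_equality_set measurable_compose[OF heavy_path_measurable component_measurable])
         simp
    then have "{x. heavy_path x 0 = x} \<in> sets borel" by simp
    then show ?thesis
      using 0 heavy_path_measurable
      by (intro borel_measurable_times_ennreal measurable_compose[OF heavy_path_measurable]
          borel_measurable_indicator heavy_from_measurable)
  qed
  ultimately show ?case by (simp add: fun_eq_iff[symmetric])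
next
  case (Suc n)
  have "path_sum (\<lambda>z. g z * indicator (heavy_from (Suc n)) z)
      = fibre_sum r (path_sum (\<lambda>w. g (path_shift w) * indicator (heavy_from n) w))"
    by (rule ext, subst path_sum_shift) (simp add: indicator_def heavy_from_Suc_shift)
  moreover have "(\<lambda>w. g (path_shift w)) \<in> borel_measurable borel"
    by (rule measurable_compose[OF path_shift_measurable Suc(2)])
  ultimately show ?case using Suc(1)[of "\<lambda>w. g (path_shift w)"] by simp
qed

lemma path_sum_measurable_borel:
  assumes "g \<in> borel_measurable borel"
  shows "path_sum g \<in> borel_measurable borel"
proof -
  have "path_sum g = (\<lambda>x. SUP n. path_sum (\<lambda>z. g z * indicator (heavy_from n) z) x)"
  proof
    fix x
    have inc: "incseq (\<lambda>n z. g z * indicator (heavy_from n) z)"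
      using incseq_heavy_from
      by (auto simp: incseq_def le_fun_def indicator_def intro!: mult_left_mono)
    have "path_sum g x = path_sum (\<lambda>z. SUP n. g z * indicator (heavy_from n) z) x"
    proof (rule path_sum_cong)
      fix z assume "z \<in> N"
      then obtain n where "z \<in> heavy_from n" using UN_heavy_from by blast
      then show "g z = (SUP n. g z * indicator (heavy_from n) z)"
        by (intro antisym SUP_upper2[of n] SUP_least) (auto simp: indicator_def)
    qed
    also have "\<dots> = (SUP n. path_sum (\<lambda>z. g z * indicator (heavy_from n) z) x)"
      by (rule path_sum_SUP[OF inc])
    finally show "path_sum g x = (SUP n. path_sum (\<lambda>z. g z * indicator (heavy_from n) z) x)" .
  qed
  moreover have "(\<lambda>x. SUP n. path_sum (\<lambda>z. g z * indicator (heavy_from n) z) x)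
      \<in> borel_measurable borel"
    using path_sum_heavy_measurable[OF assms] by (intro borel_measurable_SUP) auto
  ultimately show ?thesis by simp
qed

abbreviation lam :: "(int \<Rightarrow> 'a) measure" where
  "lam \<equiv> path_counting_measure r \<rho> N"

lemma space_lam [simp]: "space lam = path_space r"
  unfolding path_counting_measure_def
  using sets.space_closed[of "restrict_space borel (path_space r)"]
  by (subst space_measure_of) (simp_all add: space_restrict_space)

lemma sets_lam: "sets lam = sets (restrict_space borel (path_space r))"
  unfolding path_counting_measure_def
  using sets.sigma_sets_eq[of "restrict_space borel (path_space r)"]
    sets.space_closed[of "restrict_space borel (path_space r)"]
  by (subst sets_measure_of) (simp_all add: space_restrict_space)

lemma sets_lam_iff: "A \<in> sets lam \<longleftrightarrow> A \<subseteq> path_space r \<and> A \<in> sets borel"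
  unfolding sets_lam by (subst sets_restrict_space_iff) simp_all

lemma borel_measurable_lam:
  "f \<in> measurable borel M \<Longrightarrow> f \<in> measurable lam M"
  unfolding measurable_cong_sets[OF sets_lam refl] by (rule measurable_restrict_space1)

lemma path_sum_measurable [measurable]:
  assumes "g \<in> borel_measurable lam"
  shows "path_sum g \<in> borel_measurable borel"
proof -
  have "(\<lambda>z. g z * indicator (path_space r) z) \<in> borel_measurable borel"
    using assms paths_measurable unfolding measurable_cong_sets[OF sets_lam refl]
    by (subst (asm) borel_measurable_restrict_space_iff_ennreal) simp_all
  then have "path_sum (\<lambda>z. g z * indicator (path_space r) z) \<in> borel_measurable borel"
    by (rule path_sum_measurable_borel)
  moreover have "path_sum (\<lambda>z. g z * indicator (path_space r) z) = path_sum g"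
    using N_paths by (intro ext path_sum_cong) auto
  ultimately show ?thesis by simp
qed

text \<open>\<open>measure_of\<close> realises the given set function only if it is countably
  additive. Exchanging series and integral for this requires Borel path sums, which is what the
  heavy paths were introduced for.\<close>

lemma emeasure_lam:
  assumes "A \<in> sets lam"
  shows "emeasure lam A = (\<integral>\<^sup>+x. path_sum (indicator A) x \<partial>\<rho>)"
proof (rule emeasure_measure_of)
  show "lam = measure_of (path_space r) (sets (restrict_space borel (path_space r)))
      (\<lambda>A. \<integral>\<^sup>+x. path_sum (indicator A) x \<partial>\<rho>)"
    by (simp add: path_counting_measure_def path_sum_def)
  show "sets (restrict_space borel (path_space r)) \<subseteq> Pow (path_space r)"
    using sets.space_closed[of "restrict_space borel (path_space r)"]
    by (simp add: space_restrict_space)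
  show "positive (sets lam) (\<lambda>A. \<integral>\<^sup>+x. path_sum (indicator A) x \<partial>\<rho>)"
    by (simp add: positive_def path_sum_def)
  show "countably_additive (sets lam) (\<lambda>A. \<integral>\<^sup>+x. path_sum (indicator A) x \<partial>\<rho>)"
  proof (rule countably_additiveI)
    fix A :: "nat \<Rightarrow> (int \<Rightarrow> 'a) set"
    assume A: "range A \<subseteq> sets lam" "disjoint_family A"
    have "(\<Sum>i. \<integral>\<^sup>+x. path_sum (indicator (A i)) x \<partial>\<rho>)
        = (\<integral>\<^sup>+x. (\<Sum>i. path_sum (indicator (A i)) x) \<partial>\<rho>)"
      using A(1) by (intro nn_integral_suminf[symmetric]) (auto simp: measurable_cong_sets[OF rho_borel refl])
    also have "\<dots> = (\<integral>\<^sup>+x. path_sum (indicator (\<Union>i. A i)) x \<partial>\<rho>)"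
      unfolding path_sum_def using A(2)
      by (intro nn_integral_cong) (simp add: nn_integral_suminf[symmetric] suminf_indicator)
    finally show "(\<Sum>i. \<integral>\<^sup>+x. path_sum (indicator (A i)) x \<partial>\<rho>)
        = (\<integral>\<^sup>+x. path_sum (indicator (\<Union>i. A i)) x \<partial>\<rho>)" .
  qed
qed fact

lemma nn_integral_lam:
  assumes "g \<in> borel_measurable lam"
  shows "(\<integral>\<^sup>+z. g z \<partial>lam) = (\<integral>\<^sup>+x. path_sum g x \<partial>\<rho>)"
  using assms
proof (induction rule: borel_measurable_induct)
  case (cong f g)
  have "path_sum f = path_sum g"
    using N_paths cong(3) by (intro ext path_sum_cong) auto
  moreover have "(\<integral>\<^sup>+z. f z \<partial>lam) = (\<integral>\<^sup>+z. g z \<partial>lam)"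
    using cong(3) by (intro nn_integral_cong) simp
  ultimately show ?case using cong(4) by simp
next
  case (set A)
  then show ?case by (simp add: emeasure_lam)
next
  case (mult u c)
  then show ?case
    by (simp add: path_sum_cmult nn_integral_cmult measurable_cong_sets[OF rho_borel refl])
next
  case (add u v)
  then show ?case
    by (simp add: path_sum_add nn_integral_add measurable_cong_sets[OF rho_borel refl])
next
  case (seq U)
  have "(\<integral>\<^sup>+z. (SUP i. U i) z \<partial>lam) = (SUP i. \<integral>\<^sup>+z. U i z \<partial>lam)"
    unfolding SUP_apply using seq by (intro nn_integral_monotone_convergence_SUP)
  also have "\<dots> = (SUP i. \<integral>\<^sup>+x. path_sum (U i) x \<partial>\<rho>)"
    using seq by simp
  also have "\<dots> = (\<integral>\<^sup>+x. (SUP i. path_sum (U i) x) \<partial>\<rho>)"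
  proof (rule nn_integral_monotone_convergence_SUP[symmetric])
    show "incseq (\<lambda>i. path_sum (U i))"
      using \<open>incseq U\<close> by (auto simp: incseq_def le_fun_def intro!: path_sum_mono)
    show "path_sum (U i) \<in> borel_measurable \<rho>" for i
      using path_sum_measurable[OF seq(1)] by (simp add: measurable_cong_sets[OF rho_borel refl])
  qed
  also have "\<dots> = (\<integral>\<^sup>+x. path_sum (SUP i. U i) x \<partial>\<rho>)"
  proof (rule nn_integral_cong)
    show "(SUP i. path_sum (U i) x) = path_sum (SUP i. U i) x" for x
      unfolding path_sum_SUP[OF \<open>incseq U\<close>, symmetric] by (rule path_sum_cong) (simp only: SUP_apply)
  qed
  finally show ?case .
qed

lemma AE_lam_N: "AE z in lam. z \<in> N"
proof (rule AE_I)
  show "path_space r - N \<in> sets lam"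
    unfolding sets_lam_iff using sets.Diff[OF paths_measurable N_borel] by blast
  then have "emeasure lam (path_space r - N) = (\<integral>\<^sup>+x. path_sum (indicator (path_space r - N)) x \<partial>\<rho>)"
    by (rule emeasure_lam)
  also have "\<dots> = (\<integral>\<^sup>+x. path_sum (\<lambda>_. 0) x \<partial>\<rho>)"
    by (intro nn_integral_cong path_sum_cong) simp
  finally show "emeasure lam (path_space r - N) = 0" by (simp add: path_sum_def)
qed auto

lemma path_shift_measurable_lam [measurable]: "path_shift \<in> measurable lam lam"
proof (rule measurableI)
  fix A assume "A \<in> sets lam"
  then have "path_shift -` A \<in> sets borel"
    using measurable_sets[OF path_shift_measurable, of A] by (simp add: sets_lam_iff)
  then show "path_shift -` A \<inter> space lam \<in> sets lam"
    unfolding sets_lam_iff space_lam by (intro conjI sets.Int paths_measurable) auto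
qed simp

lemma path_unshift_measurable_lam [measurable]: "path_unshift \<in> measurable lam lam"
proof (rule measurableI)
  fix A assume "A \<in> sets lam"
  then have "path_unshift -` A \<in> sets borel"
    using measurable_sets[OF path_unshift_measurable, of A] by (simp add: sets_lam_iff)
  then show "path_unshift -` A \<inter> space lam \<in> sets lam"
    unfolding sets_lam_iff space_lam by (intro conjI sets.Int paths_measurable) auto
qed simp

lemma component_measurable_lam [measurable]: "(\<lambda>z. z n) \<in> borel_measurable lam"
  by (rule borel_measurable_lam[OF component_measurable])

text \<open>The change of variables under \<open>path_shift\<close>: the fibre sum in
  \<open>path_sum_shift\<close> meets strong invariance, which produces the Jacobian. This is why
  \<open>U\<close>, with its square root, is isometric.\<close>

lemma nn_integral_lam_shift:
  assumes [measurable]: "g \<in> borel_measurable lam"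
  shows "(\<integral>\<^sup>+z. ennreal (preim_card r (r (z 0))) * g (path_shift z) \<partial>lam) = (\<integral>\<^sup>+z. g z \<partial>lam)"
proof -
  have "path_sum (\<lambda>z. ennreal (preim_card r (r (z 0))) * g (path_shift z)) x
      = ennreal (preim_card r (r x)) * path_sum (\<lambda>z. g (path_shift z)) x" for x
    by (rule path_sum_base)
  then have "(\<integral>\<^sup>+z. ennreal (preim_card r (r (z 0))) * g (path_shift z) \<partial>lam)
      = (\<integral>\<^sup>+x. ennreal (preim_card r (r x)) * path_sum (\<lambda>z. g (path_shift z)) x \<partial>\<rho>)"
    by (subst nn_integral_lam) (auto intro!: nn_integral_cong)
  also have "\<dots> = (\<integral>\<^sup>+x. fibre_sum r (path_sum (\<lambda>z. g (path_shift z))) x \<partial>\<rho>)"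
    by (rule nn_integral_fibre_sum[symmetric]) simp
  also have "\<dots> = (\<integral>\<^sup>+z. g z \<partial>lam)"
    by (simp add: nn_integral_lam path_sum_shift[symmetric])
  finally show ?thesis .
qed

end

section \<open>Square-integrable functions\<close>

text \<open>Dominated convergence for cut-offs \<open>k n\<close> against a fixed \<open>g\<close>.
  Finiteness of \<open>g\<close> almost everywhere is what lets the product tend to 0 in the
  extended reals.\<close>

lemma nn_integral_vanish:
  fixes g :: "'b \<Rightarrow> ennreal"
  assumes [measurable]: "g \<in> borel_measurable M" "\<And>n. k n \<in> borel_measurable M"
    and g: "(\<integral>\<^sup>+x. g x \<partial>M) < \<infinity>"
    and k_le: "\<And>n x. k n x \<le> 1"
    and k_lim: "AE x in M. (\<lambda>n. k n x) \<longlonglongrightarrow> 0"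
  shows "(\<lambda>n. \<integral>\<^sup>+x. k n x * g x \<partial>M) \<longlonglongrightarrow> (0::ennreal)"
proof -
  have "AE x in M. g x \<noteq> \<infinity>"
    using g by (intro nn_integral_PInf_AE) auto
  then have lim: "AE x in M. (\<lambda>n. k n x * g x) \<longlonglongrightarrow> 0"
    using k_lim
  proof eventually_elim
    case (elim x)
    then have "(\<lambda>n. g x * k n x) \<longlonglongrightarrow> g x * 0"
      by (intro ennreal_tendsto_cmult) (auto simp: less_top)
    then show ?case by (simp add: mult.commute)
  qed
  have "(\<lambda>n. \<integral>\<^sup>+x. k n x * g x \<partial>M) \<longlonglongrightarrow> (\<integral>\<^sup>+x. 0 \<partial>M)"
  proof (rule nn_integral_dominated_convergence[where w = g])
    show "AE x in M. k j x * g x \<le> g x" for j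
      using mult_right_mono[OF k_le, of "g _"] by simp
  qed (use lim g in simp_all)
  then show ?thesis by simp
qed

text \<open>The squared norm in the extended reals: it makes sense without integrability, and its
  finiteness expresses membership in \<open>L2\<close>.\<close>

definition L2_sq :: "'b measure \<Rightarrow> ('b \<Rightarrow> complex) \<Rightarrow> ennreal" where
  "L2_sq M f = (\<integral>\<^sup>+x. ennreal ((cmod (f x))\<^sup>2) \<partial>M)"

lemma L2_iff: "f \<in> L2 M \<longleftrightarrow> f \<in> borel_measurable M \<and> L2_sq M f < \<infinity>"
  unfolding L2_def L2_sq_def by (auto simp: integrable_iff_bounded)

lemma L2_norm_eq: "f \<in> borel_measurable M \<Longrightarrow> L2_norm M f = sqrt (enn2real (L2_sq M f))"
  unfolding L2_norm_def L2_sq_def by (subst integral_eq_nn_integral) simp_all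

lemma L2_sq_cong_AE: "AE x in M. f x = g x \<Longrightarrow> L2_sq M f = L2_sq M g"
  unfolding L2_sq_def by (intro nn_integral_cong_AE) auto

lemma L2_sq_commute: "L2_sq M (\<lambda>x. f x - g x) = L2_sq M (\<lambda>x. g x - f x)"
  by (simp add: L2_sq_def norm_minus_commute)

lemma L2_sq_zero_iff:
  "f \<in> borel_measurable M \<Longrightarrow> L2_sq M f = 0 \<longleftrightarrow> (AE x in M. f x = 0)"
  unfolding L2_sq_def by (subst nn_integral_0_iff_AE) (simp_all add: ennreal_eq_0_iff)

lemma cmod_add_sq_le: "(cmod (a + b))\<^sup>2 \<le> 2 * (cmod a)\<^sup>2 + 2 * (cmod b)\<^sup>2"
proof -
  have "(cmod (a + b))\<^sup>2 \<le> (cmod a + cmod b)\<^sup>2"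
    by (intro power_mono norm_triangle_ineq) simp
  also have "\<dots> \<le> 2 * (cmod a)\<^sup>2 + 2 * (cmod b)\<^sup>2"
    using zero_le_power2[of "cmod a - cmod b"] by (simp add: power2_eq_square algebra_simps)
  finally show ?thesis .
qed

text \<open>
  The constant \<open>2\<close> in place of Minkowski's inequality is harmless: the bounds it enters
  serve to show finiteness, or are used in limits where their right-hand side vanishes.
\<close>

lemma nn_integral_weighted_triangle:
  assumes [measurable]: "f \<in> borel_measurable M" "g \<in> borel_measurable M" "k \<in> borel_measurable M"
  shows "(\<integral>\<^sup>+x. k x * ennreal ((cmod (f x))\<^sup>2) \<partial>M)
    \<le> 2 * (\<integral>\<^sup>+x. k x * ennreal ((cmod (g x))\<^sup>2) \<partial>M)
      + 2 * (\<integral>\<^sup>+x. k x * ennreal ((cmod (f x - g x))\<^sup>2) \<partial>M)"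
proof -
  have "ennreal ((cmod (f x))\<^sup>2) \<le> 2 * ennreal ((cmod (g x))\<^sup>2) + 2 * ennreal ((cmod (f x - g x))\<^sup>2)"
    for x
  proof -
    have "ennreal ((cmod (f x))\<^sup>2) \<le> ennreal (2 * (cmod (g x))\<^sup>2 + 2 * (cmod (f x - g x))\<^sup>2)"
      using cmod_add_sq_le[of "g x" "f x - g x"] by (intro ennreal_leI) simp
    then show ?thesis by (simp add: ennreal_mult)
  qed
  then have "(\<integral>\<^sup>+x. k x * ennreal ((cmod (f x))\<^sup>2) \<partial>M) \<le>
      (\<integral>\<^sup>+x. k x * (2 * ennreal ((cmod (g x))\<^sup>2) + 2 * ennreal ((cmod (f x - g x))\<^sup>2)) \<partial>M)"
    by (intro nn_integral_mono mult_left_mono) simp_all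
  also have "\<dots> = (\<integral>\<^sup>+x. 2 * (k x * ennreal ((cmod (g x))\<^sup>2))
      + 2 * (k x * ennreal ((cmod (f x - g x))\<^sup>2)) \<partial>M)"
    by (simp add: distrib_left mult.left_commute)
  also have "\<dots> = 2 * (\<integral>\<^sup>+x. k x * ennreal ((cmod (g x))\<^sup>2) \<partial>M)
      + 2 * (\<integral>\<^sup>+x. k x * ennreal ((cmod (f x - g x))\<^sup>2) \<partial>M)"
    by (simp add: nn_integral_add nn_integral_cmult)
  finally show ?thesis .
qed

lemma L2_sq_triangle:
  "f \<in> borel_measurable M \<Longrightarrow> g \<in> borel_measurable M \<Longrightarrow>
    L2_sq M f \<le> 2 * L2_sq M g + 2 * L2_sq M (\<lambda>x. f x - g x)"
  using nn_integral_weighted_triangle[of f M g "\<lambda>_. 1"] by (simp add: L2_sq_def)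

lemma ennreal_two_mult_less_top: "a < \<infinity> \<Longrightarrow> b < \<infinity> \<Longrightarrow> 2 * a + 2 * b < (\<infinity>::ennreal)"
  by (simp add: ennreal_mult_less_top)

lemma L2_diff:
  assumes "f \<in> L2 M" "g \<in> L2 M"
  shows "(\<lambda>x. f x - g x) \<in> L2 M"
proof -
  have "L2_sq M (\<lambda>x. f x - g x) \<le> 2 * L2_sq M f + 2 * L2_sq M (\<lambda>x. f x - g x - f x)"
    using assms by (intro L2_sq_triangle) (auto simp: L2_iff)
  also have "L2_sq M (\<lambda>x. f x - g x - f x) = L2_sq M g"
    by (simp add: L2_sq_def)
  also have "2 * L2_sq M f + 2 * L2_sq M g < \<infinity>"
    using assms by (intro ennreal_two_mult_less_top) (auto simp: L2_iff)
  finally show ?thesis using assms by (auto simp: L2_iff)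
qed

lemma L2_closure_iff:
  "f \<in> L2_closure M S \<longleftrightarrow>
    f \<in> L2 M \<and> (\<forall>e>0. \<exists>g\<in>S \<inter> L2 M. L2_sq M (\<lambda>x. f x - g x) < ennreal e)"
proof -
  have less: "L2_norm M (\<lambda>x. f x - g x) < e \<longleftrightarrow> L2_sq M (\<lambda>x. f x - g x) < ennreal (e\<^sup>2)"
    if fg: "f \<in> L2 M" "g \<in> L2 M" and "e > 0" for g e
  proof -
    have d: "(\<lambda>x. f x - g x) \<in> L2 M" using fg by (rule L2_diff)
    then have fin: "L2_sq M (\<lambda>x. f x - g x) < top" by (simp add: L2_iff)
    have "L2_norm M (\<lambda>x. f x - g x) < e \<longleftrightarrow> sqrt (enn2real (L2_sq M (\<lambda>x. f x - g x))) < sqrt (e\<^sup>2)"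
      using d \<open>e > 0\<close> by (simp add: L2_norm_eq L2_iff)
    also have "\<dots> \<longleftrightarrow> enn2real (L2_sq M (\<lambda>x. f x - g x)) < e\<^sup>2"
      by (rule real_sqrt_less_iff)
    also have "\<dots> \<longleftrightarrow> ennreal (enn2real (L2_sq M (\<lambda>x. f x - g x))) < ennreal (e\<^sup>2)"
      by (simp add: ennreal_less_iff)
    finally show ?thesis using fin by simp
  qed
  show ?thesis
  proof
    assume f: "f \<in> L2_closure M S"
    then have "f \<in> L2 M" by (simp add: L2_closure_def)
    moreover have "\<exists>g\<in>S \<inter> L2 M. L2_sq M (\<lambda>x. f x - g x) < ennreal e" if "e > 0" for e :: real
    proof -
      have "sqrt e > 0" using that by simp
      then obtain g where g: "g \<in> S \<inter> L2 M" "L2_norm M (\<lambda>x. f x - g x) < sqrt e"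
        using f unfolding L2_closure_def by blast
      then show ?thesis
        using less[OF \<open>f \<in> L2 M\<close>, of g "sqrt e"] that by (intro bexI[of _ g]) auto
    qed
    ultimately show "f \<in> L2 M \<and> (\<forall>e>0. \<exists>g\<in>S \<inter> L2 M. L2_sq M (\<lambda>x. f x - g x) < ennreal e)"
      by blast
  next
    assume f: "f \<in> L2 M \<and> (\<forall>e>0. \<exists>g\<in>S \<inter> L2 M. L2_sq M (\<lambda>x. f x - g x) < ennreal e)"
    have "\<exists>g\<in>S \<inter> L2 M. L2_norm M (\<lambda>x. f x - g x) < e" if "e > 0" for e
    proof -
      have "e\<^sup>2 > 0" using that by simp
      then obtain g where g: "g \<in> S \<inter> L2 M" "L2_sq M (\<lambda>x. f x - g x) < ennreal (e\<^sup>2)"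
        using f by blast
      then show ?thesis
        using less[of g e] f that by (intro bexI[of _ g]) auto
    qed
    with f show "f \<in> L2_closure M S" by (simp add: L2_closure_def)
  qed
qed

text \<open>For negative \<open>n\<close> the elements of \<open>V n\<close> are given by an almost
  everywhere equation, so the closure has to absorb changes on null sets.\<close>

lemma L2_closure_cong_AE:
  assumes f: "f \<in> L2_closure M S" and g: "g \<in> borel_measurable M" and eq: "AE x in M. f x = g x"
  shows "g \<in> L2_closure M S"
  unfolding L2_closure_iff
proof (intro conjI allI impI)
  show "g \<in> L2 M"
    using f g L2_sq_cong_AE[OF eq] by (simp add: L2_closure_iff L2_iff)
  fix e :: real assume "e > 0"
  then obtain h where "h \<in> S \<inter> L2 M" "L2_sq M (\<lambda>x. f x - h x) < ennreal e"
    using f by (auto simp: L2_closure_iff)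
  moreover have "L2_sq M (\<lambda>x. f x - h x) = L2_sq M (\<lambda>x. g x - h x)"
    using eq by (intro L2_sq_cong_AE) auto
  ultimately show "\<exists>h\<in>S \<inter> L2 M. L2_sq M (\<lambda>x. g x - h x) < ennreal e"
    by (intro bexI[of _ h]) auto
qed

context invariant_system
begin

text \<open>By invariance the preimage of a null set is null; hence composition with
  \<open>r\<close> preserves essential bounds.\<close>

lemma AE_compose_r:
  assumes "AE x in \<rho>. P x"
  shows "AE x in \<rho>. P (r x)"
proof -
  obtain Z where Z: "{x \<in> space \<rho>. \<not> P x} \<subseteq> Z" "emeasure \<rho> Z = 0" "Z \<in> sets \<rho>"
    using assms by (rule AE_E)
  have Z_borel: "Z \<in> sets borel" using Z(3) by (simp add: rho_borel)
  have "r -` Z \<in> sets borel" using measurable_sets[OF r_measurable Z_borel] by simp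
  then have "r -` Z \<in> sets \<rho>" by (simp add: rho_borel)
  moreover have "emeasure \<rho> (r -` Z) = emeasure \<rho> Z"
    using nn_integral_compose_r[of "indicator Z"] Z_borel \<open>r -` Z \<in> sets \<rho>\<close>
    by (simp add: indicator_vimage[symmetric] Z(3))
  ultimately show ?thesis
    using Z(1,2) by (intro AE_I[of _ _ "r -` Z"]) auto
qed

lemma Linf_borel: "f \<in> Linf \<rho> \<Longrightarrow> f \<in> borel_measurable borel"
  by (simp add: Linf_def measurable_cong_sets[OF rho_borel refl])

lemma Linf_compose_r_mult:
  assumes f: "f \<in> Linf \<rho>" and g: "g \<in> Linf \<rho>"
  shows "(\<lambda>x. f (r x) * g x) \<in> Linf \<rho>"
proof -
  obtain A B where A: "AE x in \<rho>. cmod (f x) \<le> A" and B: "AE x in \<rho>. cmod (g x) \<le> B"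
    using f g by (auto simp: Linf_def)
  have "AE x in \<rho>. cmod (f (r x) * g x) \<le> A * B"
    using AE_compose_r[OF A] B
  proof eventually_elim
    case (elim x)
    then have "0 \<le> A" using norm_ge_zero order.trans by blast
    with elim show ?case by (simp add: norm_mult mult_mono)
  qed
  moreover have "(\<lambda>x. f (r x)) \<in> borel_measurable borel"
    by (rule measurable_compose[OF r_measurable Linf_borel[OF f]])
  then have "(\<lambda>x. f (r x) * g x) \<in> borel_measurable \<rho>"
    using Linf_borel[OF g] by (simp add: measurable_cong_sets[OF rho_borel refl])
  ultimately show ?thesis by (auto simp: Linf_def)
qed

end

section \<open>The isometry \<open>U\<close> and the subspaces \<open>V n\<close>\<close>

locale scaling_system = path_system r \<rho> W N
  for r :: "'a::{metric_space, second_countable_topology} \<Rightarrow> 'a" and \<rho> W N +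
  fixes u :: "(int \<Rightarrow> 'a) \<Rightarrow> complex" and m :: "'a \<Rightarrow> complex" and \<phi> :: "(int \<Rightarrow> 'a) \<Rightarrow> complex"
  assumes u_measurable [measurable]: "u \<in> borel_measurable (path_counting_measure r \<rho> N)"
    and u_norm: "z \<in> N \<Longrightarrow> (cmod (u z))\<^sup>2 = preim_card r (r (z 0))"
    and m_Linf: "m \<in> Linf \<rho>"
    and phi_measurable [measurable]: "\<phi> \<in> borel_measurable (path_counting_measure r \<rho> N)"
    and phi_norm: "z \<in> N \<Longrightarrow> (cmod (\<phi> z))\<^sup>2 = path_weight W z"
    and phi_scaling: "z \<in> N \<Longrightarrow> u z * \<phi> (path_shift z) = m (z 0) * \<phi> z"
begin

definition U :: "((int \<Rightarrow> 'a) \<Rightarrow> complex) \<Rightarrow> (int \<Rightarrow> 'a) \<Rightarrow> complex" where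
  "U \<xi> = (\<lambda>z. u z * \<xi> (path_shift z))"

text \<open>\<open>u\<close> does not vanish on \<open>N\<close>, so this inverts \<open>U\<close>
  almost everywhere; division by zero can occur only on a null set.\<close>

definition U_inv :: "((int \<Rightarrow> 'a) \<Rightarrow> complex) \<Rightarrow> (int \<Rightarrow> 'a) \<Rightarrow> complex" where
  "U_inv \<xi> = (\<lambda>z. \<xi> (path_unshift z) / u (path_unshift z))"

lemma U_measurable: "\<xi> \<in> borel_measurable lam \<Longrightarrow> U \<xi> \<in> borel_measurable lam"
  unfolding U_def by (intro borel_measurable_times u_measurable measurable_compose[OF path_shift_measurable_lam])

lemma U_pow_measurable: "\<xi> \<in> borel_measurable lam \<Longrightarrow> (U ^^ n) \<xi> \<in> borel_measurable lam"
  by (induction n) (simp_all add: U_measurable)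

lemma U_inv_measurable: "\<xi> \<in> borel_measurable lam \<Longrightarrow> U_inv \<xi> \<in> borel_measurable lam"
  unfolding U_inv_def
  by (intro borel_measurable_divide measurable_compose[OF path_unshift_measurable_lam] u_measurable)

lemma U_inv_pow_measurable: "\<xi> \<in> borel_measurable lam \<Longrightarrow> (U_inv ^^ n) \<xi> \<in> borel_measurable lam"
  by (induction n) (simp_all add: U_inv_measurable)

text \<open>The isometry with a weight: a cut-off of \<open>U \<xi>\<close> at the current position
  becomes a cut-off of \<open>\<xi>\<close> one step further along the path. The constant weight
  gives the isometry itself.\<close>

lemma nn_integral_U:
  assumes k: "k \<in> borel_measurable lam" and \<xi>: "\<xi> \<in> borel_measurable lam"
  shows "(\<integral>\<^sup>+z. k z * ennreal ((cmod (U \<xi> z))\<^sup>2) \<partial>lam)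
    = (\<integral>\<^sup>+z. k (path_unshift z) * ennreal ((cmod (\<xi> z))\<^sup>2) \<partial>lam)"
proof -
  have "AE z in lam. k z * ennreal ((cmod (U \<xi> z))\<^sup>2) = ennreal (preim_card r (r (z 0))) *
      (k (path_unshift (path_shift z)) * ennreal ((cmod (\<xi> (path_shift z)))\<^sup>2))"
    using AE_lam_N
  proof eventually_elim
    case (elim z)
    have "(cmod (U \<xi> z))\<^sup>2 = preim_card r (r (z 0)) * (cmod (\<xi> (path_shift z)))\<^sup>2"
      by (simp add: U_def norm_mult power_mult_distrib u_norm[OF elim])
    then show ?case
      using preim_card_pos[of "r (z 0)"] by (simp add: ennreal_mult mult.left_commute)
  qed
  then have "(\<integral>\<^sup>+z. k z * ennreal ((cmod (U \<xi> z))\<^sup>2) \<partial>lam)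
      = (\<integral>\<^sup>+z. ennreal (preim_card r (r (z 0))) *
        (k (path_unshift (path_shift z)) * ennreal ((cmod (\<xi> (path_shift z)))\<^sup>2)) \<partial>lam)"
    by (rule nn_integral_cong_AE)
  also have "\<dots> = (\<integral>\<^sup>+z. k (path_unshift z) * ennreal ((cmod (\<xi> z))\<^sup>2) \<partial>lam)"
  proof (rule nn_integral_lam_shift[of "\<lambda>z. k (path_unshift z) * ennreal ((cmod (\<xi> z))\<^sup>2)"])
    have "(\<lambda>z. k (path_unshift z)) \<in> borel_measurable lam"
      by (rule measurable_compose[OF path_unshift_measurable_lam k])
    then show "(\<lambda>z. k (path_unshift z) * ennreal ((cmod (\<xi> z))\<^sup>2)) \<in> borel_measurable lam"
      using \<xi> by simp
  qed
  finally show ?thesis .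
qed

lemma nn_integral_U_pow:
  assumes k: "k \<in> borel_measurable lam" and \<xi>: "\<xi> \<in> borel_measurable lam"
  shows "(\<integral>\<^sup>+z. k z * ennreal ((cmod ((U ^^ n) \<xi> z))\<^sup>2) \<partial>lam)
    = (\<integral>\<^sup>+z. k ((path_unshift ^^ n) z) * ennreal ((cmod (\<xi> z))\<^sup>2) \<partial>lam)"
  using k
proof (induction n arbitrary: k)
  case (Suc n)
  have k': "(\<lambda>z. k (path_unshift z)) \<in> borel_measurable lam"
    by (rule measurable_compose[OF path_unshift_measurable_lam Suc(2)])
  have "(\<integral>\<^sup>+z. k z * ennreal ((cmod ((U ^^ Suc n) \<xi> z))\<^sup>2) \<partial>lam)
      = (\<integral>\<^sup>+z. k (path_unshift z) * ennreal ((cmod ((U ^^ n) \<xi> z))\<^sup>2) \<partial>lam)"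
    using nn_integral_U[OF Suc(2) U_pow_measurable[OF \<xi>]] by simp
  also have "\<dots> = (\<integral>\<^sup>+z. k (path_unshift ((path_unshift ^^ n) z)) * ennreal ((cmod (\<xi> z))\<^sup>2) \<partial>lam)"
    by (rule Suc(1)[OF k'])
  finally show ?case by simp
qed simp

lemma L2_sq_U_pow: "\<xi> \<in> borel_measurable lam \<Longrightarrow> L2_sq lam ((U ^^ n) \<xi>) = L2_sq lam \<xi>"
  using nn_integral_U_pow[of "\<lambda>_. 1" \<xi> n] by (simp add: L2_sq_def)

lemma U_pow_L2: "\<xi> \<in> L2 lam \<Longrightarrow> (U ^^ n) \<xi> \<in> L2 lam"
  by (simp add: L2_iff U_pow_measurable L2_sq_U_pow)

lemma U_pow_diff: "(U ^^ n) (\<lambda>z. \<xi> z - \<eta> z) = (\<lambda>z. (U ^^ n) \<xi> z - (U ^^ n) \<eta> z)"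
  by (induction n) (simp_all add: U_def right_diff_distrib)

text \<open>An isometry maps a difference of norm zero to one of norm zero.\<close>

lemma U_pow_cong_AE:
  assumes "\<xi> \<in> borel_measurable lam" "\<eta> \<in> borel_measurable lam" "AE z in lam. \<xi> z = \<eta> z"
  shows "AE z in lam. (U ^^ n) \<xi> z = (U ^^ n) \<eta> z"
proof -
  have d: "(\<lambda>z. \<xi> z - \<eta> z) \<in> borel_measurable lam" using assms by simp
  have "L2_sq lam (\<lambda>z. \<xi> z - \<eta> z) = 0"
    using assms(3) by (simp add: L2_sq_zero_iff[OF d])
  then have "L2_sq lam (\<lambda>z. (U ^^ n) \<xi> z - (U ^^ n) \<eta> z) = 0"
    using L2_sq_U_pow[OF d, of n] by (simp add: U_pow_diff)
  moreover have "(\<lambda>z. (U ^^ n) \<xi> z - (U ^^ n) \<eta> z) \<in> borel_measurable lam"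
    using assms by (intro borel_measurable_diff U_pow_measurable)
  ultimately show ?thesis by (simp add: L2_sq_zero_iff)
qed

lemma U_U_inv: "AE z in lam. U (U_inv \<xi>) z = \<xi> z"
  using AE_lam_N
proof eventually_elim
  case (elim z)
  have "u z \<noteq> 0" using u_norm[OF elim] preim_card_pos[of "r (z 0)"] by auto
  then show ?case by (simp add: U_def U_inv_def)
qed

lemma U_pow_U_inv_pow:
  "\<xi> \<in> borel_measurable lam \<Longrightarrow> AE z in lam. (U ^^ n) ((U_inv ^^ n) \<xi>) z = \<xi> z"
proof (induction n arbitrary: \<xi>)
  case (Suc n)
  note \<xi>' = U_inv_measurable[OF Suc(2)]
  have "AE z in lam. (U ^^ 1) ((U ^^ n) ((U_inv ^^ n) (U_inv \<xi>))) z = (U ^^ 1) (U_inv \<xi>) z"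
    by (rule U_pow_cong_AE[OF U_pow_measurable[OF U_inv_pow_measurable[OF \<xi>']] \<xi>' Suc(1)[OF \<xi>']])
  then have "AE z in lam. U ((U ^^ n) ((U_inv ^^ n) (U_inv \<xi>))) z = U (U_inv \<xi>) z" by simp
  then show ?case
    using U_U_inv[of \<xi>] by eventually_elim (simp add: funpow_swap1)
qed simp

text \<open>The probability that a path from \<open>x\<close> lies in \<open>N\<close>, summed over
  single paths; for the cycle this is \<open>h_C\<close> with values in the extended reals.\<close>

definition total_weight :: "'a \<Rightarrow> ennreal" where
  "total_weight = path_sum (\<lambda>z. ennreal (path_weight W z))"

lemma total_weight_le_1: "total_weight x \<le> 1"
  unfolding total_weight_def emeasure_path_measure_N[symmetric] by (rule emeasure_path_measure_le_1)

lemma path_weight_measurable_lam [measurable]: "path_weight W \<in> borel_measurable lam"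
  by (rule borel_measurable_lam[OF path_weight_measurable])

lemma base_measurable_lam: "f \<in> measurable borel M \<Longrightarrow> (\<lambda>z. f (z n)) \<in> measurable lam M"
  by (rule measurable_compose[OF component_measurable_lam])

lemma pi_op_measurable:
  "g \<in> borel_measurable borel \<Longrightarrow> pi_op g \<phi> \<in> borel_measurable lam"
  unfolding pi_op_def by (intro borel_measurable_times phi_measurable base_measurable_lam)

lemma nn_integral_pi_op:
  assumes g: "g \<in> borel_measurable borel" and k: "k \<in> borel_measurable lam"
  shows "(\<integral>\<^sup>+z. k z * ennreal ((cmod (pi_op g \<phi> z))\<^sup>2) \<partial>lam)
    = (\<integral>\<^sup>+x. ennreal ((cmod (g x))\<^sup>2) * path_sum (\<lambda>z. k z * ennreal (path_weight W z)) x \<partial>\<rho>)"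
proof -
  have "path_sum (\<lambda>z. k z * ennreal ((cmod (pi_op g \<phi> z))\<^sup>2)) x
      = ennreal ((cmod (g x))\<^sup>2) * path_sum (\<lambda>z. k z * ennreal (path_weight W z)) x" for x
    unfolding path_sum_cmult[symmetric]
    by (rule path_sum_cong)
       (simp add: pi_op_def norm_mult power_mult_distrib phi_norm ennreal_mult mult.left_commute
         path_weight_nonneg)
  then show ?thesis
    using pi_op_measurable[OF g] k by (subst nn_integral_lam) (auto intro!: nn_integral_cong)
qed

lemma L2_sq_pi_op:
  "g \<in> borel_measurable borel \<Longrightarrow>
    L2_sq lam (pi_op g \<phi>) = (\<integral>\<^sup>+x. ennreal ((cmod (g x))\<^sup>2) * total_weight x \<partial>\<rho>)"
  using nn_integral_pi_op[of g "\<lambda>_. 1"] by (simp add: L2_sq_def total_weight_def)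

lemma pi_op_L2:
  assumes f: "f \<in> Linf \<rho>"
  shows "pi_op f \<phi> \<in> L2 lam"
proof -
  obtain B where B: "AE x in \<rho>. cmod (f x) \<le> B" using f by (auto simp: Linf_def)
  have "L2_sq lam (pi_op f \<phi>) \<le> (\<integral>\<^sup>+x. ennreal (B\<^sup>2) \<partial>\<rho>)"
    unfolding L2_sq_pi_op[OF Linf_borel[OF f]]
  proof (rule nn_integral_mono_AE)
    show "AE x in \<rho>. ennreal ((cmod (f x))\<^sup>2) * total_weight x \<le> ennreal (B\<^sup>2)"
      using B
    proof eventually_elim
      case (elim x)
      have "ennreal ((cmod (f x))\<^sup>2) * total_weight x \<le> ennreal (B\<^sup>2) * 1"
        using elim total_weight_le_1[of x] by (intro mult_mono ennreal_leI power_mono) simp_all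
      then show ?case by simp
    qed
  qed
  also have "\<dots> < \<infinity>"
    using prob_space.emeasure_space_1[OF rho_prob] by (simp add: ennreal_mult_less_top)
  finally show ?thesis
    by (simp add: L2_iff pi_op_measurable[OF Linf_borel[OF f]])
qed

lemma phi_L2: "\<phi> \<in> L2 lam"
proof -
  have "(\<lambda>_. 1) \<in> Linf \<rho>" by (auto simp: Linf_def)
  then have "pi_op (\<lambda>_. 1) \<phi> \<in> L2 lam" by (rule pi_op_L2)
  then show ?thesis by (simp add: pi_op_def)
qed

lemma U_pi_op: "AE z in lam. U (pi_op f \<phi>) z = pi_op (\<lambda>x. f (r x) * m x) \<phi> z"
  using AE_lam_N
proof eventually_elim
  case (elim z)
  have "path_shift z 0 = r (z 0)"
    using path_pow[of z r 1 0] elim N_paths by (auto simp: path_shift_def)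
  then show ?case
    using phi_scaling[OF elim] by (simp add: U_def pi_op_def mult.left_commute)
qed

definition V0 :: "((int \<Rightarrow> 'a) \<Rightarrow> complex) set" where
  "V0 = L2_closure lam {pi_op f \<phi> | f. f \<in> Linf \<rho>}"

definition V :: "int \<Rightarrow> ((int \<Rightarrow> 'a) \<Rightarrow> complex) set" where
  "V = inverse_translate lam U V0"

lemma V0_L2: "\<xi> \<in> V0 \<Longrightarrow> \<xi> \<in> L2 lam"
  by (simp add: V0_def L2_closure_def)

lemma V0_measurable: "\<xi> \<in> V0 \<Longrightarrow> \<xi> \<in> borel_measurable lam"
  using V0_L2 by (simp add: L2_iff)

lemma U_V0:
  assumes \<xi>: "\<xi> \<in> V0"
  shows "U \<xi> \<in> V0"
  unfolding V0_def L2_closure_iff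
proof (intro conjI allI impI)
  show "U \<xi> \<in> L2 lam" using U_pow_L2[OF V0_L2[OF \<xi>], of 1] by simp
  fix e :: real assume "e > 0"
  then obtain f where f: "f \<in> Linf \<rho>" "L2_sq lam (\<lambda>z. \<xi> z - pi_op f \<phi> z) < ennreal e"
    using \<xi> unfolding V0_def L2_closure_iff by blast
  let ?g = "\<lambda>x. f (r x) * m x"
  have g: "?g \<in> Linf \<rho>" using f(1) m_Linf by (rule Linf_compose_r_mult)
  have pf: "pi_op f \<phi> \<in> borel_measurable lam" using pi_op_L2[OF f(1)] by (simp add: L2_iff)
  have "L2_sq lam (\<lambda>z. U \<xi> z - pi_op ?g \<phi> z) = L2_sq lam (\<lambda>z. U \<xi> z - U (pi_op f \<phi>) z)"
    using U_pi_op[of f] by (intro L2_sq_cong_AE) auto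
  also have "\<dots> = L2_sq lam (\<lambda>z. \<xi> z - pi_op f \<phi> z)"
    using L2_sq_U_pow[of "\<lambda>z. \<xi> z - pi_op f \<phi> z" 1] U_pow_diff[of 1 \<xi> "pi_op f \<phi>"] pf V0_measurable[OF \<xi>]
    by simp
  finally have "L2_sq lam (\<lambda>z. U \<xi> z - pi_op ?g \<phi> z) < ennreal e" using f(2) by simp
  then show "\<exists>h\<in>{pi_op f \<phi> | f. f \<in> Linf \<rho>} \<inter> L2 lam. L2_sq lam (\<lambda>z. U \<xi> z - h z) < ennreal e"
    using g pi_op_L2[OF g] by blast
qed

text \<open>Everything rests on \<open>U_V0\<close>. The cases arise because \<open>V n\<close> is a
  preimage for \<open>n \<ge> 0\<close> and an image up to null sets for \<open>n < 0\<close>; the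
  step from -1 to 0 joins the two descriptions.\<close>

lemma V_mono: "V n \<subseteq> V (n + 1)"
proof
  fix \<xi> assume \<xi>: "\<xi> \<in> V n"
  then have L2: "\<xi> \<in> L2 lam" by (auto simp: V_def inverse_translate_def split: if_splits)
  consider "n \<ge> 0" | "n = -1" | "n < -1" by linarith
  then show "\<xi> \<in> V (n + 1)"
  proof cases
    case 1
    then have "nat (n + 1) = Suc (nat n)" by simp
    then show ?thesis
      using 1 \<xi> U_V0 by (simp add: V_def inverse_translate_def)
  next
    case 2
    then obtain \<eta> where \<eta>: "\<eta> \<in> V0" "AE z in lam. \<xi> z = U \<eta> z"
      using \<xi> by (auto simp: V_def inverse_translate_def)
    have "AE z in lam. U \<eta> z = \<xi> z" using \<eta>(2) by eventually_elim simp
    then have "\<xi> \<in> V0"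
      using L2_closure_cong_AE[of "U \<eta>"] U_V0[OF \<eta>(1)] L2 by (auto simp: V0_def L2_iff)
    then show ?thesis using 2 L2 by (simp add: V_def inverse_translate_def)
  next
    case 3
    then obtain \<eta> where \<eta>: "\<eta> \<in> V0" "AE z in lam. \<xi> z = (U ^^ nat (- n)) \<eta> z"
      using \<xi> by (auto simp: V_def inverse_translate_def)
    have "nat (- n) = Suc (nat (- (n + 1)))" using 3 by simp
    then have "AE z in lam. \<xi> z = (U ^^ nat (- (n + 1))) (U \<eta>) z"
      using \<eta>(2) by (simp add: funpow_swap1)
    then show ?thesis
      using 3 L2 U_V0[OF \<eta>(1)] unfolding V_def inverse_translate_def by auto
  qed
qed

end

lemma numeral_mult_ennreal: "0 \<le> x \<Longrightarrow> numeral k * ennreal x = ennreal (numeral k * x)"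
  by (subst ennreal_mult) simp_all

section \<open>Density of the union and support of the intersection of the
  \<open>V n\<close>\<close>

context scaling_system
begin

text \<open>\<open>V0\<close> is generated by essentially bounded functions, whereas the
  approximants in the density proof are quotients without a bound. Truncation at level
  \<open>n\<close> leaves an error supported where \<open>g\<close> exceeds \<open>n\<close> in
  modulus, and this vanishes.\<close>

lemma pi_op_V0:
  assumes g: "g \<in> borel_measurable borel" and L2: "pi_op g \<phi> \<in> L2 lam"
  shows "pi_op g \<phi> \<in> V0"
  unfolding V0_def L2_closure_iff
proof (intro conjI allI impI)
  show "pi_op g \<phi> \<in> L2 lam" by fact
  fix e :: real assume e: "e > 0"
  define k :: "nat \<Rightarrow> (int \<Rightarrow> 'a) \<Rightarrow> ennreal"
    where "k n z = indicator {x. real n < cmod (g x)} (z 0)"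
    for n and z :: "int \<Rightarrow> 'a"
  define g_n where "g_n n x = (if cmod (g x) \<le> real n then g x else 0)" for n x
  have "(\<lambda>x. indicator {x. real n < cmod (g x)} x) \<in> borel_measurable borel" for n
  proof -
    have "{x \<in> space borel. real n < cmod (g x)} \<in> sets borel" using g by measurable
    then show ?thesis by (intro borel_measurable_indicator) simp
  qed
  then have k: "k n \<in> borel_measurable lam" for n
    unfolding k_def by (rule base_measurable_lam)
  have "(\<lambda>n. \<integral>\<^sup>+z. k n z * ennreal ((cmod (pi_op g \<phi> z))\<^sup>2) \<partial>lam) \<longlonglongrightarrow> 0"
  proof (rule nn_integral_vanish)
    show "(\<integral>\<^sup>+z. ennreal ((cmod (pi_op g \<phi> z))\<^sup>2) \<partial>lam) < \<infinity>"
      using L2 by (simp add: L2_iff L2_sq_def)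
    show "AE z in lam. (\<lambda>n. k n z) \<longlonglongrightarrow> 0"
    proof (rule AE_I2)
      fix z :: "int \<Rightarrow> 'a"
      obtain n0 where "cmod (g (z 0)) \<le> real n0" using real_arch_simple by blast
      then have "\<forall>n\<ge>n0. k n z = 0" by (auto simp: k_def)
      then show "(\<lambda>n. k n z) \<longlonglongrightarrow> 0"
        by (intro tendsto_eventually) (auto simp: eventually_sequentially)
    qed
    show "k n z \<le> 1" for n z by (simp add: k_def indicator_def)
  qed (use k pi_op_measurable[OF g] in simp_all)
  then have "\<forall>\<^sub>F n in sequentially. (\<integral>\<^sup>+z. k n z * ennreal ((cmod (pi_op g \<phi> z))\<^sup>2) \<partial>lam) < ennreal e"
    by (rule order_tendstoD(2)) (use e in simp)
  then obtain n where n: "(\<integral>\<^sup>+z. k n z * ennreal ((cmod (pi_op g \<phi> z))\<^sup>2) \<partial>lam) < ennreal e"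
    by (auto simp: eventually_sequentially)
  have "g_n n \<in> borel_measurable borel" unfolding g_n_def using g by measurable
  then have "g_n n \<in> Linf \<rho>"
    by (auto simp: Linf_def measurable_cong_sets[OF rho_borel refl] g_n_def intro!: exI[of _ "real n"])
  moreover have "L2_sq lam (\<lambda>z. pi_op g \<phi> z - pi_op (g_n n) \<phi> z) < ennreal e"
  proof -
    have "ennreal ((cmod (pi_op g \<phi> z - pi_op (g_n n) \<phi> z))\<^sup>2)
        = k n z * ennreal ((cmod (pi_op g \<phi> z))\<^sup>2)" for z
      by (auto simp: pi_op_def g_n_def k_def)
    then show ?thesis using n by (simp add: L2_sq_def)
  qed
  ultimately show "\<exists>h\<in>{pi_op f \<phi> | f. f \<in> Linf \<rho>} \<inter> L2 lam.
      L2_sq lam (\<lambda>z. pi_op g \<phi> z - h z) < ennreal e"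
    using pi_op_L2 by blast
qed

lemma path_sum_single:
  assumes "z0 \<in> N"
  shows "path_sum (\<lambda>z. c * indicator {z0} z) (z0 0) = c"
proof -
  have "path_sum (\<lambda>z. c * indicator {z0} z) (z0 0) = (\<Sum>z\<in>{z0}. c * indicator {z0} z)"
    unfolding path_sum_def using assms N_path by (intro nn_integral_count_space') auto
  then show ?thesis by simp
qed

definition dominant :: "real \<Rightarrow> (int \<Rightarrow> 'a) set" where
  "dominant \<epsilon> = {z \<in> N. 1 - \<epsilon> < path_weight W z}"

lemma dominant_borel: "dominant \<epsilon> \<in> sets borel"
proof -
  have "N \<inter> {z \<in> space borel. 1 - \<epsilon> < path_weight W z} \<in> sets borel"
    using path_weight_measurable by (intro sets.Int N_borel) simp
  then show ?thesis by (simp add: dominant_def Int_def)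
qed

text \<open>
  A function living on dominant paths is almost of the form \<open>\<pi>(g) \<phi>\<close>: the dominant path from
  \<open>x\<close>, if any, is unique and determines \<open>g x\<close>, and all other paths from \<open>x\<close> carry weight
  at most \<open>\<epsilon>\<close>.
\<close>

lemma approximate_on_dominant:
  assumes \<zeta>: "\<zeta> \<in> borel_measurable lam" and supp: "\<And>z. z \<notin> dominant \<epsilon> \<Longrightarrow> \<zeta> z = 0"
    and \<epsilon>: "0 < \<epsilon>" "\<epsilon> \<le> 1/2"
  obtains g where "g \<in> borel_measurable borel"
    "L2_sq lam (\<lambda>z. pi_op g \<phi> z - \<zeta> z) \<le> ennreal (2 * \<epsilon>) * L2_sq lam \<zeta>"
proof -
  \<comment> \<open>The value is dictated by the equation \<open>\<pi>(g) \<phi> = \<zeta>\<close>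
    on the heavy path. The indicator guards against \<open>heavy_path x\<close> not being a path,
    since \<open>\<zeta>\<close> is measurable only on the path space.\<close>
  define g where "g x = indicator (path_space r) (heavy_path x) *\<^sub>R (\<zeta> (heavy_path x) / \<phi> (heavy_path x))" for x
  have "(\<lambda>z. \<zeta> z / \<phi> z) \<in> borel_measurable lam" using \<zeta> by simp
  then have "(\<lambda>z. indicator (path_space r) z *\<^sub>R (\<zeta> z / \<phi> z)) \<in> borel_measurable borel"
    using paths_measurable unfolding measurable_cong_sets[OF sets_lam refl]
    by (subst (asm) borel_measurable_restrict_space_iff) simp_all
  then have g: "g \<in> borel_measurable borel"
    unfolding g_def by (rule measurable_compose[OF heavy_path_measurable])
  let ?F = "\<lambda>z. pi_op g \<phi> z - \<zeta> z"
  have F: "?F \<in> borel_measurable lam"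
    using pi_op_measurable[OF g] \<zeta> by simp
  have le: "path_sum (\<lambda>z. ennreal ((cmod (?F z))\<^sup>2)) x
      \<le> ennreal (2 * \<epsilon>) * path_sum (\<lambda>z. ennreal ((cmod (\<zeta> z))\<^sup>2)) x" for x
  proof (cases "\<exists>z0\<in>dominant \<epsilon>. z0 0 = x")
    case True
    then obtain z0 where z0: "z0 \<in> dominant \<epsilon>" "z0 0 = x" by blast
    then have z0N: "z0 \<in> N" and w0: "1 - \<epsilon> < path_weight W z0" by (auto simp: dominant_def)
    have z0_path: "z0 \<in> paths r x" using N_path[OF z0N] z0(2) by simp
    have hp: "heavy_path x = z0"
      using w0 \<epsilon> by (intro heavy_path_eq[OF z0_path]) simp
    have unique: "z = z0" if "z \<in> dominant \<epsilon>" "z 0 = x" for z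
      using that \<epsilon> w0 N_path[of z] z0_path by (intro heavy_path_unique[of z x]) (auto simp: dominant_def)
    have "\<phi> z0 \<noteq> 0"
      using phi_norm[OF z0N] w0 \<epsilon> by auto
    then have g0: "g x * \<phi> z0 = \<zeta> z0"
      using z0N N_paths by (auto simp: g_def hp)
    let ?c = "(cmod (g x))\<^sup>2" and ?w = "path_weight W z0"
    have \<zeta>0: "(cmod (\<zeta> z0))\<^sup>2 = ?c * ?w"
      by (simp add: g0[symmetric] norm_mult power_mult_distrib phi_norm[OF z0N])
    \<comment> \<open>The error vanishes at \<open>z0\<close> and equals
      \<open>\<pi>(g) \<phi>\<close> on the other paths, so adding back the mass at
      \<open>z0\<close> gives exactly \<open>?c\<close> times the total weight.\<close>
    have "path_sum (\<lambda>z. ennreal ((cmod (?F z))\<^sup>2)) x + ennreal (?c * ?w)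
        = path_sum (\<lambda>z. ennreal ((cmod (?F z))\<^sup>2) + ennreal (?c * ?w) * indicator {z0} z) x"
      unfolding path_sum_add using path_sum_single[OF z0N, of "ennreal (?c * ?w)"] z0(2) by simp
    also have "\<dots> = path_sum (\<lambda>z. ennreal ?c * ennreal (path_weight W z)) x"
    proof (rule path_sum_cong)
      fix z assume z: "z \<in> N" "z 0 = x"
      show "ennreal ((cmod (?F z))\<^sup>2) + ennreal (?c * ?w) * indicator {z0} z
          = ennreal ?c * ennreal (path_weight W z)"
      proof (cases "z = z0")
        case True
        then show ?thesis
          using g0 z by (simp add: pi_op_def ennreal_mult path_weight_nonneg)
      next
        case False
        then have "\<zeta> z = 0" using unique z supp by blast
        then show ?thesis
          using False z
          by (simp add: pi_op_def norm_mult power_mult_distrib phi_norm ennreal_mult path_weight_nonneg)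
      qed
    qed
    also have "\<dots> = ennreal ?c * total_weight x"
      unfolding total_weight_def by (rule path_sum_cmult)
    also have "\<dots> \<le> ennreal ?c * 1"
      by (intro mult_left_mono total_weight_le_1) simp
    finally have "path_sum (\<lambda>z. ennreal ((cmod (?F z))\<^sup>2)) x \<le> ennreal ?c - ennreal (?c * ?w)"
      by (simp add: ennreal_le_minus_iff add.commute)
    also have "\<dots> = ennreal (?c * (1 - ?w))"
      using path_weight_nonneg[of z0] by (simp add: ennreal_minus right_diff_distrib)
    \<comment> \<open>From \<open>1 - ?w < \<epsilon>\<close> and
      \<open>?w > 1 - \<epsilon> \<ge> 1/2\<close>, which gives
      \<open>1 \<le> 2 * ?w\<close>.\<close>
    also have "\<dots> \<le> ennreal (2 * \<epsilon> * (?c * ?w))"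
    proof (rule ennreal_leI)
      have "?c * (1 - ?w) \<le> ?c * \<epsilon>" using w0 by (intro mult_left_mono) simp_all
      also have "\<dots> \<le> ?c * (2 * \<epsilon> * ?w)"
        using w0 \<epsilon> by (intro mult_left_mono) simp_all
      finally show "?c * (1 - ?w) \<le> 2 * \<epsilon> * (?c * ?w)" by (simp add: mult.left_commute mult.assoc)
    qed
    also have "\<dots> = ennreal (2 * \<epsilon>) * path_sum (\<lambda>z. ennreal (?c * ?w) * indicator {z0} z) x"
      using path_sum_single[OF z0N, of "ennreal (?c * ?w)"] z0(2) \<epsilon> path_weight_nonneg[of z0]
      by (simp add: ennreal_mult)
    also have "\<dots> \<le> ennreal (2 * \<epsilon>) * path_sum (\<lambda>z. ennreal ((cmod (\<zeta> z))\<^sup>2)) x"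
      using \<zeta>0 by (intro mult_left_mono path_sum_mono) (auto simp: indicator_def)
    finally show ?thesis .
  next
    case False
    \<comment> \<open>Without a dominant path from \<open>x\<close>, both \<open>\<zeta>\<close> and
      \<open>g x\<close> are 0 there.\<close>
    have "path_sum (\<lambda>z. ennreal ((cmod (?F z))\<^sup>2)) x = path_sum (\<lambda>z. 0) x"
    proof (rule path_sum_cong)
      fix z assume z: "z \<in> N" "z 0 = x"
      have "heavy_path x 0 = x" by (simp add: heavy_path_def extend_path_def)
      then have "heavy_path x \<notin> dominant \<epsilon>" using False by blast
      moreover have "z \<notin> dominant \<epsilon>" using False z by blast
      ultimately have "?F z = 0" using supp z by (simp add: pi_op_def g_def)
      then show "ennreal ((cmod (?F z))\<^sup>2) = 0" by simp
    qed
    then show ?thesis by (simp add: path_sum_def)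
  qed
  have "L2_sq lam ?F = (\<integral>\<^sup>+x. path_sum (\<lambda>z. ennreal ((cmod (?F z))\<^sup>2)) x \<partial>\<rho>)"
    unfolding L2_sq_def using F by (intro nn_integral_lam) simp
  also have "\<dots> \<le> (\<integral>\<^sup>+x. ennreal (2 * \<epsilon>) * path_sum (\<lambda>z. ennreal ((cmod (\<zeta> z))\<^sup>2)) x \<partial>\<rho>)"
    by (intro nn_integral_mono le)
  also have "\<dots> = ennreal (2 * \<epsilon>) * (\<integral>\<^sup>+x. path_sum (\<lambda>z. ennreal ((cmod (\<zeta> z))\<^sup>2)) x \<partial>\<rho>)"
    using \<zeta> by (intro nn_integral_cmult) (simp add: measurable_cong_sets[OF rho_borel refl])
  also have "\<dots> = ennreal (2 * \<epsilon>) * L2_sq lam \<zeta>"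
    unfolding L2_sq_def using \<zeta> by (subst nn_integral_lam) simp_all
  finally show thesis by (rule that[OF g])
qed

lemma V_dense: "L2_closure lam (\<Union>n. V n) = L2 lam"
proof
  show "L2 lam \<subseteq> L2_closure lam (\<Union>n. V n)"
  proof
    fix \<xi> assume \<xi>: "\<xi> \<in> L2 lam"
    then have \<xi>m: "\<xi> \<in> borel_measurable lam" and fin: "L2_sq lam \<xi> < \<infinity>" by (auto simp: L2_iff)
    show "\<xi> \<in> L2_closure lam (\<Union>n. V n)"
      unfolding L2_closure_iff
    proof (intro conjI allI impI)
      fix e :: real assume e: "e > 0"
      obtain s where s: "L2_sq lam \<xi> = ennreal s" "0 \<le> s"
        using fin by (cases "L2_sq lam \<xi>") auto
      \<comment> \<open>The final error is at most \<open>2 * (e/4) + 4 * \<epsilon> * s\<close>,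
        and 16 makes it at most three quarters of \<open>e\<close>; the summand 1 covers
        \<open>s = 0\<close>.\<close>
      define \<epsilon> where "\<epsilon> = min (1/2) (e / (16 * (s + 1)))"
      have "0 < e / (16 * (s + 1))" using e s by (intro divide_pos_pos) simp_all
      then have \<epsilon>: "0 < \<epsilon>" "\<epsilon> \<le> 1/2"
        unfolding \<epsilon>_def by (simp, intro min.cobounded1)
      have \<epsilon>s: "4 * (\<epsilon> * s) \<le> e / 4"
      proof -
        have "\<epsilon> * s \<le> e / (16 * (s + 1)) * s" using s by (intro mult_right_mono) (auto simp: \<epsilon>_def)
        also have "\<dots> \<le> e / 16" using s e by (simp add: field_simps)
        finally show ?thesis by simp
      qed
      let ?k = "\<lambda>z. indicator (- dominant \<epsilon>) z :: ennreal"
      have k: "?k \<in> borel_measurable lam"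
        using dominant_borel by (intro borel_measurable_lam borel_measurable_indicator borel_comp)
      have k_n: "(\<lambda>z. ?k ((path_unshift ^^ n) z)) \<in> borel_measurable lam" for n
        using dominant_borel
        by (intro borel_measurable_lam measurable_compose[OF path_unshift_pow_measurable]
            borel_measurable_indicator borel_comp)
      \<comment> \<open>The tails of a path in \<open>N\<close> are eventually dominant. By
        \<open>nn_integral_U_pow\<close> this integral is the mass of \<open>(U ^^ n) \<xi>\<close>
        off the dominant paths.\<close>
      have "(\<lambda>n. \<integral>\<^sup>+z. ?k ((path_unshift ^^ n) z) * ennreal ((cmod (\<xi> z))\<^sup>2) \<partial>lam) \<longlonglongrightarrow> 0"
      proof (rule nn_integral_vanish)
        show "AE z in lam. (\<lambda>n. ?k ((path_unshift ^^ n) z)) \<longlonglongrightarrow> 0"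
          using AE_lam_N
        proof eventually_elim
          case (elim z)
          have "\<forall>\<^sub>F n in sequentially. 1 - \<epsilon> < path_weight W ((path_unshift ^^ n) z)"
            by (rule order_tendstoD(1)[OF N_tail[OF elim]]) (use \<epsilon> in linarith)
          then have "\<forall>\<^sub>F n in sequentially. ?k ((path_unshift ^^ n) z) = 0"
            by eventually_elim (simp add: dominant_def N_unshift_pow elim)
          then show ?case by (rule tendsto_eventually)
        qed
        show "?k ((path_unshift ^^ n) z) \<le> 1" for n z by (simp add: indicator_def)
      qed (use \<xi>m k_n fin in \<open>simp_all add: L2_sq_def\<close>)
      then have "\<forall>\<^sub>F n in sequentially.
          (\<integral>\<^sup>+z. ?k ((path_unshift ^^ n) z) * ennreal ((cmod (\<xi> z))\<^sup>2) \<partial>lam) < ennreal (e / 4)"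
        by (rule order_tendstoD(2)) (use e in simp)
      then obtain n where
        n: "(\<integral>\<^sup>+z. ?k ((path_unshift ^^ n) z) * ennreal ((cmod (\<xi> z))\<^sup>2) \<partial>lam) < ennreal (e / 4)"
        by (auto simp: eventually_sequentially)
      define \<zeta> where "\<zeta> z = indicator (dominant \<epsilon>) z *\<^sub>R (U ^^ n) \<xi> z" for z
      have U\<xi>: "(U ^^ n) \<xi> \<in> borel_measurable lam" by (rule U_pow_measurable[OF \<xi>m])
      have \<zeta>m: "\<zeta> \<in> borel_measurable lam"
        unfolding \<zeta>_def using dominant_borel
        by (intro borel_measurable_scaleR U\<xi> borel_measurable_lam borel_measurable_indicator)
      have "L2_sq lam \<zeta> \<le> L2_sq lam ((U ^^ n) \<xi>)"
        unfolding L2_sq_def \<zeta>_def by (intro nn_integral_mono) (auto simp: indicator_def)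
      then have \<zeta>s: "L2_sq lam \<zeta> \<le> ennreal s"
        using L2_sq_U_pow[OF \<xi>m, of n] s by simp
      have cut: "L2_sq lam (\<lambda>z. (U ^^ n) \<xi> z - \<zeta> z) < ennreal (e / 4)"
      proof -
        have "L2_sq lam (\<lambda>z. (U ^^ n) \<xi> z - \<zeta> z) = (\<integral>\<^sup>+z. ?k z * ennreal ((cmod ((U ^^ n) \<xi> z))\<^sup>2) \<partial>lam)"
          unfolding L2_sq_def \<zeta>_def by (intro nn_integral_cong) (auto simp: indicator_def)
        also have "\<dots> < ennreal (e / 4)"
          unfolding nn_integral_U_pow[OF k \<xi>m] by (rule n)
        finally show ?thesis .
      qed
      have supp: "\<zeta> z = 0" if "z \<notin> dominant \<epsilon>" for z
        using that by (simp add: \<zeta>_def)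
      obtain g where g: "g \<in> borel_measurable borel"
        "L2_sq lam (\<lambda>z. pi_op g \<phi> z - \<zeta> z) \<le> ennreal (2 * \<epsilon>) * L2_sq lam \<zeta>"
        using approximate_on_dominant[OF \<zeta>m supp \<epsilon>] by metis
      have gm: "pi_op g \<phi> \<in> borel_measurable lam" by (rule pi_op_measurable[OF g(1)])
      have "ennreal (2 * \<epsilon>) * L2_sq lam \<zeta> \<le> ennreal (2 * \<epsilon>) * ennreal s"
        by (intro mult_left_mono \<zeta>s) simp
      also have "\<dots> = ennreal (2 * (\<epsilon> * s))"
        using \<epsilon> s by (simp add: ennreal_mult[symmetric])
      finally have err: "L2_sq lam (\<lambda>z. pi_op g \<phi> z - \<zeta> z) \<le> ennreal (2 * (\<epsilon> * s))"
        using g(2) by simp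
      have "L2_sq lam (pi_op g \<phi>) \<le> 2 * L2_sq lam \<zeta> + 2 * L2_sq lam (\<lambda>z. pi_op g \<phi> z - \<zeta> z)"
        by (rule L2_sq_triangle[OF gm \<zeta>m])
      also have "\<dots> < \<infinity>"
        using \<zeta>s err by (intro ennreal_two_mult_less_top) (auto intro: le_less_trans)
      finally have gL2: "pi_op g \<phi> \<in> L2 lam" using gm by (simp add: L2_iff)
      \<comment> \<open>Pulling the approximant back by the inverse isometry puts it into
        \<open>V n\<close> and leaves the error unchanged.\<close>
      define \<eta> where "\<eta> = (U_inv ^^ n) (pi_op g \<phi>)"
      have \<eta>m: "\<eta> \<in> borel_measurable lam" unfolding \<eta>_def by (rule U_inv_pow_measurable[OF gm])
      have U\<eta>: "AE z in lam. (U ^^ n) \<eta> z = pi_op g \<phi> z"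
        unfolding \<eta>_def by (rule U_pow_U_inv_pow[OF gm])
      have \<eta>L2: "\<eta> \<in> L2 lam"
        using L2_sq_U_pow[OF \<eta>m, of n] L2_sq_cong_AE[OF U\<eta>] gL2 \<eta>m by (simp add: L2_iff)
      have "AE z in lam. pi_op g \<phi> z = (U ^^ n) \<eta> z" using U\<eta> by eventually_elim simp
      then have "(U ^^ n) \<eta> \<in> V0"
        using L2_closure_cong_AE[of "pi_op g \<phi>"] pi_op_V0[OF g(1) gL2] U_pow_measurable[OF \<eta>m, of n]
        unfolding V0_def by blast
      then have \<eta>V: "\<eta> \<in> V (int n)"
        using \<eta>L2 by (simp add: V_def inverse_translate_def)
      have "L2_sq lam (\<lambda>z. \<xi> z - \<eta> z) = L2_sq lam (\<lambda>z. (U ^^ n) \<xi> z - (U ^^ n) \<eta> z)"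
        using L2_sq_U_pow[of "\<lambda>z. \<xi> z - \<eta> z" n] \<xi>m \<eta>m by (simp add: U_pow_diff)
      also have "\<dots> = L2_sq lam (\<lambda>z. (U ^^ n) \<xi> z - pi_op g \<phi> z)"
        using U\<eta> by (intro L2_sq_cong_AE) auto
      also have "\<dots> \<le> 2 * L2_sq lam (\<lambda>z. (U ^^ n) \<xi> z - \<zeta> z)
          + 2 * L2_sq lam (\<lambda>z. pi_op g \<phi> z - \<zeta> z)"
      proof -
        have "L2_sq lam (\<lambda>z. (U ^^ n) \<xi> z - pi_op g \<phi> z) \<le> 2 * L2_sq lam (\<lambda>z. (U ^^ n) \<xi> z - \<zeta> z)
          + 2 * L2_sq lam (\<lambda>z. (U ^^ n) \<xi> z - pi_op g \<phi> z - ((U ^^ n) \<xi> z - \<zeta> z))"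
          using U\<xi> \<zeta>m gm by (intro L2_sq_triangle) simp_all
        also have "(\<lambda>z. (U ^^ n) \<xi> z - pi_op g \<phi> z - ((U ^^ n) \<xi> z - \<zeta> z)) = (\<lambda>z. \<zeta> z - pi_op g \<phi> z)"
          by simp
        finally show ?thesis using L2_sq_commute[of lam \<zeta>] by simp
      qed
      also have "\<dots> \<le> 2 * ennreal (e / 4) + 2 * ennreal (2 * (\<epsilon> * s))"
        by (intro add_mono mult_left_mono less_imp_le[OF cut] err) simp_all
      also have "\<dots> = ennreal (2 * (e / 4)) + ennreal (2 * (2 * (\<epsilon> * s)))"
        using e \<epsilon> s by (simp only: numeral_mult_ennreal) (simp add: numeral_mult_ennreal)
      also have "\<dots> = ennreal (2 * (e / 4) + 2 * (2 * (\<epsilon> * s)))"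
        using e \<epsilon> s by (intro ennreal_plus[symmetric]) simp_all
      also have "\<dots> < ennreal e" using \<epsilon>s e by (intro ennreal_lessI) simp_all
      finally show "\<exists>h\<in>(\<Union>n. V n) \<inter> L2 lam. L2_sq lam (\<lambda>z. \<xi> z - h z) < ennreal e"
        using \<eta>V \<eta>L2 by blast
    qed fact
  qed
qed (auto simp: L2_closure_def)

lemma null_V0:
  assumes "\<xi> \<in> borel_measurable lam" "AE z in lam. \<xi> z = 0"
  shows "\<xi> \<in> V0"
proof -
  have "pi_op (\<lambda>_. 0) \<phi> \<in> L2 lam" by (rule pi_op_L2) (auto simp: Linf_def)
  then have "pi_op (\<lambda>_. 0) \<phi> \<in> V0" by (intro pi_op_V0) simp_all
  moreover have "AE z in lam. pi_op (\<lambda>_. 0) \<phi> z = \<xi> z"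
    using assms(2) by eventually_elim (simp add: pi_op_def)
  ultimately show ?thesis
    using assms(1) L2_closure_cong_AE unfolding V0_def by blast
qed

lemma null_V:
  assumes \<xi>: "\<xi> \<in> L2 lam" "AE z in lam. \<xi> z = 0"
  shows "\<xi> \<in> V n"
proof -
  have \<xi>m: "\<xi> \<in> borel_measurable lam" using \<xi>(1) by (simp add: L2_iff)
  have U0: "(U ^^ k) (\<lambda>_. 0) = (\<lambda>_. 0)" for k
    by (induction k) (simp_all add: U_def)
  have 0: "(\<lambda>_. 0) \<in> V0" by (rule null_V0) simp_all
  have "AE z in lam. (U ^^ k) \<xi> z = 0" for k
    using U_pow_cong_AE[OF \<xi>m, of "\<lambda>_. 0" k] \<xi>(2) by (simp add: U0)
  then have "(U ^^ k) \<xi> \<in> V0" for k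
    by (intro null_V0 U_pow_measurable[OF \<xi>m])
  moreover have "\<exists>\<eta>\<in>V0. AE z in lam. \<xi> z = (U ^^ k) \<eta> z" for k
    using 0 \<xi>(2) by (intro bexI[of _ "\<lambda>_. 0"]) (simp_all add: U0)
  ultimately show ?thesis
    using \<xi>(1) by (simp add: V_def inverse_translate_def)
qed

text \<open>The conditional probability, given \<open>N\<close>, that the path from \<open>y\<close> lies outside \<open>B\<close> at time \<open>n\<close>.\<close>

definition escape :: "'a set \<Rightarrow> nat \<Rightarrow> 'a \<Rightarrow> ennreal" where
  "escape B n y =
    path_sum (\<lambda>z. indicator (- B) (z (int n)) * ennreal (path_weight W z)) y / total_weight y"

lemma escape_numerator_le:
  "path_sum (\<lambda>z. indicator (- B) (z (int n)) * ennreal (path_weight W z)) y \<le> total_weight y"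
  unfolding total_weight_def by (rule path_sum_mono) (simp add: indicator_def)

lemma escape_le_1: "escape B n y \<le> 1"
proof (cases "total_weight y = 0")
  case False
  then show ?thesis
    using escape_numerator_le[of B n y] total_weight_le_1[of y]
    unfolding escape_def
    by (metis divide_le_posI_ennreal mult.right_neutral zero_less_iff_neq_zero)
qed (use escape_numerator_le[of B n y] in \<open>simp add: escape_def\<close>)

text \<open>Where the total weight is 0 the numerator is 0 too, so the convention for division by
  zero does no harm.\<close>

lemma escape_mult_total_weight:
  "escape B n y * total_weight y
    = path_sum (\<lambda>z. indicator (- B) (z (int n)) * ennreal (path_weight W z)) y"
proof (cases "total_weight y = 0")
  case False
  moreover have "total_weight y \<noteq> top"
    using total_weight_le_1[of y] by (auto simp: top_unique)
  ultimately show ?thesis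
    unfolding escape_def by (simp add: ennreal_divide_times ennreal_divide_self less_top)
qed (use escape_numerator_le[of B n y] in simp)

lemma escape_measurable:
  assumes "B \<in> sets borel"
  shows "escape B n \<in> borel_measurable borel"
proof -
  have "(\<lambda>z. indicator (- B) (z (int n)) :: ennreal) \<in> borel_measurable lam"
    using assms by (intro base_measurable_lam borel_measurable_indicator borel_comp)
  then show ?thesis
    unfolding escape_def total_weight_def by simp
qed

text \<open>Dominated convergence for counting measure on the paths of \<open>N\<close> from the
  fixed point \<open>y\<close>: their weights sum to at most one. No uniformity in \<open>y\<close>
  is obtained.\<close>

lemma escape_tendsto_0:
  assumes "\<And>z. z \<in> N \<Longrightarrow> \<forall>\<^sub>F n in sequentially. z (int n) \<in> B"
  shows "(\<lambda>n. escape B n y) \<longlonglongrightarrow> 0"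
proof (cases "total_weight y = 0")
  case True
  have "escape B n y = 0" for n
    using escape_numerator_le[of B n y] True by (simp add: escape_def)
  then show ?thesis by simp
next
  case False
  have "(\<lambda>n. path_sum (\<lambda>z. indicator (- B) (z (int n)) * ennreal (path_weight W z)) y) \<longlonglongrightarrow> 0"
    unfolding path_sum_def
  proof (rule nn_integral_vanish)
    show "(\<integral>\<^sup>+z. ennreal (path_weight W z) \<partial>count_space (N \<inter> paths r y)) < \<infinity>"
      using total_weight_le_1[of y] unfolding total_weight_def path_sum_def
      by (rule le_less_trans) simp
    show "AE z in count_space (N \<inter> paths r y). (\<lambda>n. indicator (- B) (z (int n)) :: ennreal) \<longlonglongrightarrow> 0"
    proof (rule AE_I2)
      fix z assume "z \<in> space (count_space (N \<inter> paths r y))"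
      then have "\<forall>\<^sub>F n in sequentially. z (int n) \<in> B" using assms by simp
      then have "\<forall>\<^sub>F n in sequentially. indicator (- B) (z (int n)) = (0 :: ennreal)"
        by eventually_elim simp
      then show "(\<lambda>n. indicator (- B) (z (int n)) :: ennreal) \<longlonglongrightarrow> 0"
        by (rule tendsto_eventually)
    qed
  qed (simp_all add: indicator_def)
  then have "(\<lambda>n. inverse (total_weight y) *
      path_sum (\<lambda>z. indicator (- B) (z (int n)) * ennreal (path_weight W z)) y)
      \<longlonglongrightarrow> inverse (total_weight y) * 0"
    using False by (intro ennreal_tendsto_cmult) (simp_all add: less_top[symmetric])
  then show ?thesis by (simp add: escape_def divide_ennreal_def mult.commute)
qed

text \<open>For \<open>pi_op f \<phi>\<close> the two integrals agree, because the squared modulus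
  of \<open>f\<close> at the starting point factors out of both. Passing to the closure uses the
  triangle bound twice, each time with the constant 2, hence the 4.\<close>

lemma V0_escape:
  assumes \<eta>: "\<eta> \<in> V0" and B: "B \<in> sets borel"
  shows "(\<integral>\<^sup>+z. indicator (- B) (z (int n)) * ennreal ((cmod (\<eta> z))\<^sup>2) \<partial>lam)
    \<le> 4 * (\<integral>\<^sup>+z. escape B n (z 0) * ennreal ((cmod (\<eta> z))\<^sup>2) \<partial>lam)"
proof (rule ennreal_le_epsilon)
  fix e :: real assume e: "e > 0"
  let ?k = "\<lambda>z. indicator (- B) (z (int n)) :: ennreal" and ?q = "\<lambda>z. escape B n (z 0)"
  let ?I = "\<lambda>k f. \<integral>\<^sup>+z. k z * ennreal ((cmod (f z))\<^sup>2) \<partial>lam"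
  have k: "?k \<in> borel_measurable lam"
    using B by (intro base_measurable_lam borel_measurable_indicator borel_comp)
  have q: "?q \<in> borel_measurable lam"
    by (rule base_measurable_lam[OF escape_measurable[OF B]])
  \<comment> \<open>The distance from \<open>\<eta>\<close> to its approximant enters with total
    coefficient 2 * 2 + 2 = 6.\<close>
  have "0 < e / 6" using e by simp
  then obtain f where f: "f \<in> Linf \<rho>" "L2_sq lam (\<lambda>z. \<eta> z - pi_op f \<phi> z) < ennreal (e / 6)"
    using \<eta> unfolding V0_def L2_closure_iff by blast
  let ?f = "pi_op f \<phi>" and ?d = "L2_sq lam (\<lambda>z. \<eta> z - pi_op f \<phi> z)"
  have \<eta>m: "\<eta> \<in> borel_measurable lam" by (rule V0_measurable[OF \<eta>])
  have fm: "?f \<in> borel_measurable lam" by (rule pi_op_measurable[OF Linf_borel[OF f(1)]])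
  have eq: "?I ?k ?f = ?I ?q ?f"
  proof -
    have "path_sum (\<lambda>z. ?q z * ennreal (path_weight W z)) x = escape B n x * total_weight x" for x
      unfolding total_weight_def by (rule path_sum_base)
    then show ?thesis
      unfolding nn_integral_pi_op[OF Linf_borel[OF f(1)] k] nn_integral_pi_op[OF Linf_borel[OF f(1)] q]
      by (simp add: escape_mult_total_weight)
  qed
  have bound: "?I k (\<lambda>z. \<eta> z - ?f z) \<le> ?d" "?I k (\<lambda>z. ?f z - \<eta> z) \<le> ?d"
    if "\<And>z. k z \<le> 1" for k
    unfolding L2_sq_def using that
    by (auto intro!: nn_integral_mono mult_left_le_one_le simp: norm_minus_commute
        intro: order.trans[OF mult_right_mono[OF that]])
  have "?I ?k \<eta> \<le> 2 * ?I ?k ?f + 2 * ?I ?k (\<lambda>z. \<eta> z - ?f z)"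
    by (rule nn_integral_weighted_triangle[OF \<eta>m fm k])
  also have "\<dots> \<le> 2 * ?I ?q ?f + 2 * ?d"
    unfolding eq using bound(1)[of ?k] by (intro add_mono mult_left_mono) (auto simp: indicator_def)
  also have "\<dots> \<le> 2 * (2 * ?I ?q \<eta> + 2 * ?d) + 2 * ?d"
  proof -
    have "?I ?q ?f \<le> 2 * ?I ?q \<eta> + 2 * ?I ?q (\<lambda>z. ?f z - \<eta> z)"
      by (rule nn_integral_weighted_triangle[OF fm \<eta>m q])
    also have "\<dots> \<le> 2 * ?I ?q \<eta> + 2 * ?d"
      using bound(2)[of ?q] escape_le_1 by (intro add_mono mult_left_mono) auto
    finally show ?thesis by (intro add_mono mult_left_mono) auto
  qed
  also have "\<dots> = 4 * ?I ?q \<eta> + 6 * ?d"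
  proof -
    have "2 * (2 * a + 2 * b) + 2 * b = 4 * a + 6 * b" for a b :: ennreal
    proof -
      have "2 * (2 * a + 2 * b) + 2 * b = (2 * 2) * a + (2 * 2 + 2) * b"
        by (simp only: distrib_left distrib_right mult.assoc add.assoc)
      then show ?thesis by simp
    qed
    then show ?thesis .
  qed
  also have "\<dots> \<le> 4 * ?I ?q \<eta> + ennreal e"
  proof -
    have "6 * ?d \<le> 6 * ennreal (e / 6)" using f(2) by (intro mult_left_mono) auto
    also have "\<dots> = ennreal e" using e by (simp add: numeral_mult_ennreal)
    finally show ?thesis by (rule add_left_mono)
  qed
  finally show "?I ?k \<eta> \<le> 4 * ?I ?q \<eta> + ennreal e" .
qed

text \<open>
  For \<open>\<xi> = U\<^sup>n \<eta>\<close> with \<open>\<eta> \<in> V\<^sub>0\<close> the mass of \<open>\<xi>\<close> outside \<open>B\<close> at time \<open>0\<close> is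
  controlled by the average of \<open>escape B n \<circ> r\<^sup>n\<close>, which tends to \<open>0\<close> because \<open>\<rho>\<close> is
  \<open>r\<close>-invariant and \<open>escape B n \<rightarrow> 0\<close> pointwise.
\<close>

lemma V_Inter_support:
  assumes \<xi>: "\<xi> \<in> (\<Inter>n. V n)" and B: "B \<in> sets borel"
    and absorb: "\<And>z. z \<in> N \<Longrightarrow> \<forall>\<^sub>F n in sequentially. z (int n) \<in> B"
  shows "AE z in lam. z 0 \<in> B \<or> \<xi> z = 0"
proof -
  have "\<xi> \<in> V 0" using \<xi> by blast
  then have \<xi>L2: "\<xi> \<in> L2 lam" by (simp add: V_def inverse_translate_def)
  then have \<xi>m: "\<xi> \<in> borel_measurable lam" by (simp add: L2_iff)
  define H where "H = path_sum (\<lambda>z. ennreal ((cmod (\<xi> z))\<^sup>2))"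
  have H: "H \<in> borel_measurable borel" unfolding H_def using \<xi>m by simp
  have H\<rho>: "H \<in> borel_measurable \<rho>" using H by (simp add: measurable_cong_sets[OF rho_borel refl])
  have H_fin: "(\<integral>\<^sup>+x. H x \<partial>\<rho>) < \<infinity>"
    using \<xi>L2 \<xi>m unfolding H_def by (subst nn_integral_lam[symmetric]) (simp_all add: L2_iff L2_sq_def)
  have r_pow: "r ^^ n \<in> borel_measurable borel" for n by (rule measurable_compose_n) simp
  let ?k = "\<lambda>z. indicator (- B) (z 0) :: ennreal"
  let ?I = "\<integral>\<^sup>+z. ?k z * ennreal ((cmod (\<xi> z))\<^sup>2) \<partial>lam"
  have k: "?k \<in> borel_measurable lam"
    using B by (intro base_measurable_lam borel_measurable_indicator borel_comp)
  \<comment> \<open>\<open>Suc n\<close> makes the index of \<open>V\<close> negative, so that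
    membership yields a representation of \<open>\<xi>\<close> as an image under a power of
    \<open>U\<close>.\<close>
  have I_le: "?I \<le> 4 * (\<integral>\<^sup>+x. escape B (Suc n) ((r ^^ Suc n) x) * H x \<partial>\<rho>)" for n
  proof -
    let ?n = "Suc n"
    have "\<xi> \<in> V (- int ?n)" using \<xi> by blast
    then obtain \<eta> where \<eta>: "\<eta> \<in> V0" "AE z in lam. \<xi> z = (U ^^ ?n) \<eta> z"
      by (auto simp: V_def inverse_translate_def simp del: of_nat_Suc funpow.simps)
    have \<eta>m: "\<eta> \<in> borel_measurable lam" by (rule V0_measurable[OF \<eta>(1)])
    have cong: "(\<integral>\<^sup>+z. k z * ennreal ((cmod (\<xi> z))\<^sup>2) \<partial>lam)
        = (\<integral>\<^sup>+z. k ((path_unshift ^^ ?n) z) * ennreal ((cmod (\<eta> z))\<^sup>2) \<partial>lam)"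
      if "k \<in> borel_measurable lam" for k
    proof -
      have "(\<integral>\<^sup>+z. k z * ennreal ((cmod (\<xi> z))\<^sup>2) \<partial>lam)
          = (\<integral>\<^sup>+z. k z * ennreal ((cmod ((U ^^ ?n) \<eta> z))\<^sup>2) \<partial>lam)"
        using \<eta>(2) by (intro nn_integral_cong_AE) auto
      also have "\<dots> = (\<integral>\<^sup>+z. k ((path_unshift ^^ ?n) z) * ennreal ((cmod (\<eta> z))\<^sup>2) \<partial>lam)"
        by (rule nn_integral_U_pow[OF that \<eta>m])
      finally show ?thesis .
    qed
    have "?I = (\<integral>\<^sup>+z. indicator (- B) (z (int ?n)) * ennreal ((cmod (\<eta> z))\<^sup>2) \<partial>lam)"
      using cong[OF k] by (simp add: path_unshift_pow del: funpow.simps)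
    also have "\<dots> \<le> 4 * (\<integral>\<^sup>+z. escape B ?n (z 0) * ennreal ((cmod (\<eta> z))\<^sup>2) \<partial>lam)"
      by (rule V0_escape[OF \<eta>(1) B])
    \<comment> \<open>Return from \<open>\<eta>\<close> to \<open>\<xi>\<close>: the starting point
      for \<open>\<eta>\<close> is the coordinate at time minus \<open>?n\<close> for
      \<open>\<xi>\<close>, that is, \<open>r ^^ ?n\<close> of the starting point. The weight now
      depends on the starting point alone.\<close>
    also have "(\<integral>\<^sup>+z. escape B ?n (z 0) * ennreal ((cmod (\<eta> z))\<^sup>2) \<partial>lam)
        = (\<integral>\<^sup>+z. escape B ?n (z (- int ?n)) * ennreal ((cmod (\<xi> z))\<^sup>2) \<partial>lam)"
      using cong[OF base_measurable_lam[OF escape_measurable[OF B]], of ?n "- int ?n"]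
      by (simp add: path_unshift_pow del: funpow.simps)
    also have "\<dots> = (\<integral>\<^sup>+x. path_sum (\<lambda>z. escape B ?n (z (- int ?n)) * ennreal ((cmod (\<xi> z))\<^sup>2)) x \<partial>\<rho>)"
      using \<xi>m base_measurable_lam[OF escape_measurable[OF B]] by (intro nn_integral_lam) simp
    also have "\<dots> = (\<integral>\<^sup>+x. escape B ?n ((r ^^ ?n) x) * H x \<partial>\<rho>)"
    proof (rule nn_integral_cong)
      fix x
      have "path_sum (\<lambda>z. escape B ?n (z (- int ?n)) * ennreal ((cmod (\<xi> z))\<^sup>2)) x
          = path_sum (\<lambda>z. escape B ?n ((r ^^ ?n) (z 0)) * ennreal ((cmod (\<xi> z))\<^sup>2)) x"
        using path_pow[of _ r ?n 0] N_paths by (intro path_sum_cong) (auto simp del: funpow.simps)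
      also have "\<dots> = escape B ?n ((r ^^ ?n) x) * H x"
        unfolding H_def by (rule path_sum_base)
      finally show "path_sum (\<lambda>z. escape B ?n (z (- int ?n)) * ennreal ((cmod (\<xi> z))\<^sup>2)) x
          = escape B ?n ((r ^^ ?n) x) * H x" .
    qed
    finally show ?thesis .
  qed
  have escape_int: "(\<lambda>n. \<integral>\<^sup>+x. escape B n x * 1 \<partial>\<rho>) \<longlonglongrightarrow> 0"
  proof (rule nn_integral_vanish)
    show "AE x in \<rho>. (\<lambda>n. escape B n x) \<longlonglongrightarrow> 0"
      using escape_tendsto_0[OF absorb] by simp
    show "(\<integral>\<^sup>+x. 1 \<partial>\<rho>) < (\<infinity>::ennreal)"
      using prob_space.emeasure_space_1[OF rho_prob] by simp
  qed (use escape_measurable[OF B] escape_le_1 in \<open>simp_all add: measurable_cong_sets[OF rho_borel refl]\<close>)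
  \<comment> \<open>\<open>H\<close> is integrable but may be unbounded. Where \<open>H\<close> is
    at most \<open>K\<close> the integral is bounded by \<open>K\<close> times that of
    \<open>escape\<close>, which vanishes as \<open>n\<close> grows; the rest is made small by
    \<open>K\<close> afterwards.\<close>
  have tail: "(\<lambda>K. \<integral>\<^sup>+x. indicator {x. of_nat K < H x} x * H x \<partial>\<rho>) \<longlonglongrightarrow> 0"
  proof (rule nn_integral_vanish[OF H\<rho> _ H_fin])
    show "(\<lambda>x. indicator {x. of_nat K < H x} x :: ennreal) \<in> borel_measurable \<rho>" for K
    proof -
      have "{x \<in> space \<rho>. of_nat K < H x} \<in> sets \<rho>" using H\<rho> by simp
      then show ?thesis by (intro borel_measurable_indicator) simp
    qed
    have "AE x in \<rho>. H x \<noteq> \<infinity>" using H_fin H\<rho> by (intro nn_integral_PInf_AE) auto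
    then show "AE x in \<rho>. (\<lambda>K. indicator {x. of_nat K < H x} x :: ennreal) \<longlonglongrightarrow> 0"
    proof eventually_elim
      case (elim x)
      then obtain K0 :: nat where "H x < of_nat K0"
        using ennreal_Ex_less_of_nat[of "H x"] by (auto simp: less_top)
      have "indicator {x. of_nat K < H x} x = (0::ennreal)" if "K \<ge> K0" for K
      proof -
        have "(of_nat K0 :: ennreal) \<le> of_nat K" using that by simp
        then have "H x \<le> of_nat K" using \<open>H x < of_nat K0\<close> by (meson less_imp_le order.trans)
        then show ?thesis by (simp add: indicator_def not_less)
      qed
      then show ?case
        by (intro tendsto_eventually) (auto simp: eventually_sequentially)
    qed
  qed (simp add: indicator_def)
  have "?I \<le> 4 * (\<integral>\<^sup>+x. indicator {x. of_nat K < H x} x * H x \<partial>\<rho>)" for K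
  proof (rule LIMSEQ_le_const)
    let ?t = "\<integral>\<^sup>+x. indicator {x. of_nat K < H x} x * H x \<partial>\<rho>"
    have "(\<lambda>n. of_nat K * (\<integral>\<^sup>+x. escape B n x * 1 \<partial>\<rho>) + ?t) \<longlonglongrightarrow> of_nat K * 0 + ?t"
      by (intro tendsto_add ennreal_tendsto_cmult escape_int tendsto_const) (simp add: less_top[symmetric])
    then have "(\<lambda>n. of_nat K * (\<integral>\<^sup>+x. escape B (Suc n) x * 1 \<partial>\<rho>) + ?t)
        \<longlonglongrightarrow> of_nat K * 0 + ?t"
      by (rule LIMSEQ_Suc)
    then have "(\<lambda>n. of_nat K * (\<integral>\<^sup>+x. escape B (Suc n) x * 1 \<partial>\<rho>) + ?t) \<longlonglongrightarrow> ?t"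
      by (simp only: mult_zero_right add_0)
    then have "(\<lambda>n. 4 * (of_nat K * (\<integral>\<^sup>+x. escape B (Suc n) x * 1 \<partial>\<rho>) + ?t)) \<longlonglongrightarrow> 4 * ?t"
      by (rule ennreal_tendsto_cmult[rotated]) simp
    then show "(\<lambda>n. 4 * (of_nat K * (\<integral>\<^sup>+x. escape B (Suc n) x * 1 \<partial>\<rho>) + ?t)) \<longlonglongrightarrow> 4 * ?t" .
    show "\<exists>N. \<forall>n\<ge>N. ?I \<le> 4 * (of_nat K * (\<integral>\<^sup>+x. escape B (Suc n) x * 1 \<partial>\<rho>) + ?t)"
    proof (intro exI[of _ 0] allI impI)
      fix n :: nat
      let ?q = "\<lambda>x. escape B (Suc n) ((r ^^ Suc n) x)"
      have q: "?q \<in> borel_measurable \<rho>"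
        unfolding measurable_cong_sets[OF rho_borel refl]
        by (rule measurable_compose[OF r_pow escape_measurable[OF B]])
      have ind: "(\<lambda>x. indicator {x. of_nat K < H x} x * H x) \<in> borel_measurable \<rho>"
      proof -
        have "{x \<in> space \<rho>. of_nat K < H x} \<in> sets \<rho>" using H\<rho> by simp
        then show ?thesis using H\<rho> by (intro borel_measurable_times_ennreal borel_measurable_indicator) simp_all
      qed
      have "(\<integral>\<^sup>+x. ?q x * H x \<partial>\<rho>) \<le> (\<integral>\<^sup>+x. of_nat K * ?q x + indicator {x. of_nat K < H x} x * H x \<partial>\<rho>)"
      proof (rule nn_integral_mono)
        fix x
        show "?q x * H x \<le> of_nat K * ?q x + indicator {x. of_nat K < H x} x * H x"
        proof (cases "of_nat K < H x")
          case True
          then show ?thesis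
            using mult_right_mono[OF escape_le_1, of "H x"] by (simp add: add_increasing)
        next
          case False
          then show ?thesis
            using mult_left_mono[of "H x" "of_nat K" "?q x"] by (simp add: mult.commute)
        qed
      qed
      also have "\<dots> = of_nat K * (\<integral>\<^sup>+x. ?q x \<partial>\<rho>) + ?t"
        using q ind by (simp add: nn_integral_add nn_integral_cmult)
      also have "(\<integral>\<^sup>+x. ?q x \<partial>\<rho>) = (\<integral>\<^sup>+x. escape B (Suc n) x * 1 \<partial>\<rho>)"
        unfolding mult_1_right by (rule nn_integral_compose_r_pow[OF escape_measurable[OF B]])
      finally show "?I \<le> 4 * (of_nat K * (\<integral>\<^sup>+x. escape B (Suc n) x * 1 \<partial>\<rho>) + ?t)"
        by (intro order.trans[OF I_le[of n] mult_left_mono]) simp_all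
    qed
  qed
  moreover have "(\<lambda>K. 4 * (\<integral>\<^sup>+x. indicator {x. of_nat K < H x} x * H x \<partial>\<rho>)) \<longlonglongrightarrow> 4 * 0"
    by (intro ennreal_tendsto_cmult tail) simp
  ultimately have "?I \<le> 4 * 0"
    by (intro LIMSEQ_le_const) auto
  then have "?I = 0" by simp
  then have "AE z in lam. ?k z * ennreal ((cmod (\<xi> z))\<^sup>2) = 0"
    using k \<xi>m by (subst (asm) nn_integral_0_iff_AE) simp_all
  then show ?thesis
    by eventually_elim (auto simp: indicator_def ennreal_eq_0_iff split: if_splits)
qed

end

section \<open>Paths converging to a repelling cycle\<close>

text \<open>Read backwards, expansion by the inverse of \<open>c\<close> is contraction by
  \<open>c\<close> as soon as the orbit stays within \<open>\<delta>\<close>.\<close>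

lemma repelling_orbit_geometric:
  fixes w :: "nat \<Rightarrow> 'a::metric_space"
  assumes rep: "repelling_fixpoint s y" and lim: "w \<longlonglongrightarrow> y" and step: "\<And>n. s (w (Suc n)) = w n"
  obtains A c where "0 < A" "0 < c" "c < 1" "\<forall>\<^sub>F n in sequentially. dist (w n) y \<le> A * c ^ Suc n"
proof -
  obtain c \<delta> where c: "0 < c" "c < 1" "0 < \<delta>"
    and expand: "\<And>x. 0 < dist x y \<and> dist x y < \<delta> \<Longrightarrow> dist (s x) y > inverse c * dist x y"
    using rep unfolding repelling_fixpoint_def by blast
  obtain n0 where n0: "\<And>n. n \<ge> n0 \<Longrightarrow> dist (w n) y < \<delta>"
    using lim \<open>0 < \<delta>\<close> unfolding LIMSEQ_def by blast
  have contract: "dist (w (Suc n)) y \<le> c * dist (w n) y" if "n \<ge> n0" for n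
  proof (cases "dist (w (Suc n)) y = 0")
    case False
    then have "inverse c * dist (w (Suc n)) y < dist (w n) y"
      using expand[of "w (Suc n)"] n0[of "Suc n"] that by (simp add: step)
    then show ?thesis using c by (simp add: field_simps)
  qed (use c in simp)
  have le: "dist (w (n0 + k)) y \<le> c ^ k * dist (w n0) y" for k
  proof (induction k)
    case (Suc k)
    have "dist (w (n0 + Suc k)) y \<le> c * dist (w (n0 + k)) y"
      using contract[of "n0 + k"] by simp
    also have "\<dots> \<le> c * (c ^ k * dist (w n0) y)"
      using Suc c by (intro mult_left_mono) simp_all
    finally show ?case by (simp add: mult.assoc)
  qed simp
  \<comment> \<open>The summand 1 keeps \<open>A\<close> positive if the orbit sits at
    \<open>y\<close>; the denominator absorbs the first \<open>n0\<close> steps and the exponent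
    \<open>Suc n\<close>.\<close>
  define A where "A = (dist (w n0) y + 1) / c ^ Suc n0"
  have "0 < dist (w n0) y + 1" by (simp add: add_nonneg_pos)
  then have "0 < A" unfolding A_def using c by (intro divide_pos_pos) simp_all
  moreover have "dist (w n) y \<le> A * c ^ Suc n" if n: "n \<ge> n0" for n
  proof -
    obtain k where k: "n = n0 + k" using le_Suc_ex[OF n] by blast
    have "dist (w n) y \<le> c ^ k * dist (w n0) y"
      unfolding k by (rule le)
    also have "\<dots> \<le> c ^ k * (dist (w n0) y + 1)"
      using c by (intro mult_left_mono) simp_all
    also have "\<dots> = A * c ^ Suc n"
      using c by (simp add: A_def k power_add)
    finally show ?thesis .
  qed
  then have "\<forall>\<^sub>F n in sequentially. dist (w n) y \<le> A * c ^ Suc n"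
    by (auto simp: eventually_sequentially)
  ultimately show thesis using c that by blast
qed

text \<open>A path in \<open>N\<close> has a single limit, and hence decay estimates, only along
  each residue class modulo \<open>p\<close>; this reassembles the classes.\<close>

lemma summable_residue_classes:
  fixes a :: "nat \<Rightarrow> real"
  assumes p: "0 < p" and nonneg: "\<And>k. 0 \<le> a k"
    and sums: "\<And>j. j < p \<Longrightarrow> summable (\<lambda>n. a (p * n + j))"
  shows "summable a"
proof (rule summableI_nonneg_bounded[OF nonneg])
  fix n
  have "sum a {..<n} \<le> sum a {..<n * p}"
    using p nonneg by (intro sum_mono2) auto
  also have "\<dots> = (\<Sum>m<n. sum a {m * p..<m * p + p})"
    by (rule sum.nat_group[symmetric])
  also have "\<dots> = (\<Sum>m<n. \<Sum>j<p. a (p * m + j))"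
  proof (rule sum.cong[OF refl])
    show "sum a {m * p..<m * p + p} = (\<Sum>j<p. a (p * m + j))" for m
      using sum.shift_bounds_nat_ivl[of a 0 "m * p" p]
      by (simp add: atLeast0LessThan add.commute mult.commute)
  qed
  also have "\<dots> = (\<Sum>j<p. \<Sum>m<n. a (p * m + j))"
    by (rule sum.swap)
  also have "\<dots> \<le> (\<Sum>j<p. \<Sum>m. a (p * m + j))"
    using sums nonneg by (intro sum_mono sum_le_suminf) auto
  finally show "sum a {..<n} \<le> (\<Sum>j<p. \<Sum>m. a (p * m + j))" .
qed

text \<open>The Weierstrass product inequality: since the partial product is at most one, a further
  factor lowers it by at most \<open>a n\<close>.\<close>

lemma prod_one_minus_ge:
  fixes a :: "nat \<Rightarrow> real"
  assumes "\<And>k. 0 \<le> a k" "\<And>k. a k \<le> 1"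
  shows "1 - (\<Sum>k<n. a k) \<le> (\<Prod>k<n. 1 - a k)"
proof (induction n)
  case (Suc n)
  have P: "(\<Prod>k<n. 1 - a k) \<le> 1" "0 \<le> (\<Prod>k<n. 1 - a k)"
    using assms by (auto intro!: prod_le_1 prod_nonneg)
  have "(\<Prod>k<n. 1 - a k) * a n \<le> a n"
    using P assms by (intro mult_left_le_one_le)
  then show ?case using Suc by (simp add: algebra_simps)
qed simp

lemma limit_set_borel:
  fixes y :: "'a::{metric_space, second_countable_topology}" and f :: "nat \<Rightarrow> int"
  shows "{z. (\<lambda>k. z (f k)) \<longlonglongrightarrow> y} \<in> sets borel"
proof -
  have "{z. (\<lambda>k. z (f k)) \<longlonglongrightarrow> y}
      = {z. \<forall>m. \<exists>K. \<forall>k. K \<le> k \<longrightarrow> dist (z (f k)) y < inverse (real (Suc m))}"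
  proof (intro Collect_cong iffI allI)
    fix z m
    assume "(\<lambda>k. z (f k)) \<longlonglongrightarrow> y"
    then show "\<exists>K. \<forall>k. K \<le> k \<longrightarrow> dist (z (f k)) y < inverse (real (Suc m))"
      unfolding LIMSEQ_def by simp
  next
    fix z
    assume *: "\<forall>m. \<exists>K. \<forall>k. K \<le> k \<longrightarrow> dist (z (f k)) y < inverse (real (Suc m))"
    show "(\<lambda>k. z (f k)) \<longlonglongrightarrow> y"
      unfolding LIMSEQ_def
    proof (intro allI impI)
      fix e :: real assume "e > 0"
      then obtain m where m: "inverse (real (Suc m)) < e" using reals_Archimedean by blast
      then show "\<exists>K. \<forall>k\<ge>K. dist (z (f k)) y < e"
        using * by (meson order.strict_trans)
    qed
  qed
  also have "\<dots> = (\<Inter>m. \<Union>K. \<Inter>k. {z. K \<le> k \<longrightarrow> dist (z (f k)) y < inverse (real (Suc m))})"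
    by auto
  also have "\<dots> \<in> sets borel"
  proof -
    have "{z \<in> space borel. dist (z (f k)) y < e} \<in> sets borel" for k and e :: real
    proof -
      have "(\<lambda>z. dist (z (f k)) y) \<in> borel_measurable borel"
        by (intro borel_measurable_dist component_measurable borel_measurable_const)
      then show ?thesis by simp
    qed
    then have "{z. K \<le> k \<longrightarrow> dist (z (f k)) y < e} \<in> sets borel" for K k and e :: real
      by (cases "K \<le> k") simp_all
    then show ?thesis
      by (intro sets.countable_INT' sets.countable_UN) auto
  qed
  finally show ?thesis .
qed

locale cycle_system = invariant_system r \<rho>
  for r :: "'a::{metric_space, second_countable_topology} \<Rightarrow> 'a" and \<rho> +
  fixes p :: nat and xs :: "nat \<Rightarrow> 'a" and \<alpha> :: "nat \<Rightarrow> complex" and m0 :: "'a \<Rightarrow> complex"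
  assumes cycle: "is_cycle r p xs"
    and alpha: "i < p \<Longrightarrow> cmod (\<alpha> i) = 1"
    and repelling: "repelling_cycle r p xs"
    and r_cont: "x \<in> cycle_set p xs \<Longrightarrow> isCont r x"
    and card_cont: "x \<in> cycle_set p xs \<Longrightarrow> isCont (preim_card r) x"
    and m0_Linf: "m0 \<in> Linf \<rho>"
    and m0_Lipschitz: "x \<in> cycle_set p xs \<Longrightarrow> beta_Lipschitz_at m0 x"
    and m0_QMF: "(\<Sum>y \<in> r -` {x}. (cmod (m0 y))\<^sup>2) / preim_card r x = 1"
    and m0_cycle: "i < p \<Longrightarrow> m0 (xs i) = \<alpha> i * of_real (sqrt (preim_card r (r (xs i))))"
begin

lemma p_pos: "0 < p"
  using cycle by (simp add: is_cycle_def)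

sublocale weighted_system r \<rho> "weight r m0"
proof
  have m0: "m0 \<in> borel_measurable borel" by (rule Linf_borel[OF m0_Linf])
  have "(\<lambda>x. preim_card r (r x)) \<in> borel_measurable borel"
    by (rule measurable_compose[OF r_measurable preim_card_measurable])
  then show "weight r m0 \<in> borel_measurable borel"
    unfolding weight_def using m0 by simp
  show "0 \<le> weight r m0 y" for y
    using preim_card_pos[of "r y"] by (simp add: weight_def)
  show "(\<Sum>y\<in>r -` {x}. weight r m0 y) = 1" for x
    using m0_QMF[of x] by (simp add: weight_def sum_divide_distrib)
qed

abbreviation W :: "'a \<Rightarrow> real" where
  "W \<equiv> weight r m0"

text \<open>The periodic extension removes the wrap-around case from the relation between
  consecutive cycle points.\<close>

definition cycle_point :: "nat \<Rightarrow> 'a" where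
  "cycle_point i = xs (i mod p)"

lemma cycle_point_in [simp]: "cycle_point i \<in> cycle_set p xs"
  using p_pos by (simp add: cycle_point_def cycle_set_def)

lemma r_cycle_point: "r (cycle_point (Suc i)) = cycle_point i"
proof (cases "Suc (i mod p) = p")
  case True
  then have "Suc i mod p = 0" "i mod p = p - 1" by (simp_all add: mod_Suc)
  then show ?thesis using cycle by (simp add: cycle_point_def is_cycle_def)
next
  case False
  then have "Suc i mod p = Suc (i mod p)" "Suc (i mod p) < p"
    using mod_less_divisor[OF p_pos, of i] by (auto simp: mod_Suc)
  then show ?thesis using cycle by (simp add: cycle_point_def is_cycle_def)
qed

definition N :: "(int \<Rightarrow> 'a) set" where
  "N = {z \<in> path_space r. \<exists>i<p. (\<lambda>k. z (int (k * p))) \<longlonglongrightarrow> xs i}"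

lemma N_iff: "z \<in> N \<longleftrightarrow> z \<in> cycle_paths r p xs (z 0)"
  by (auto simp: N_def cycle_paths_def cycle_set_def path_space_iff mult.commute)

lemma N_Int_paths: "N \<inter> paths r x = cycle_paths r p xs x"
  unfolding cycle_paths_def cycle_set_def N_def
  by (auto simp: mult.commute intro: paths_subset_path_space)

lemma cycle_index_props:
  assumes "z \<in> N"
  shows "cycle_index p xs z < p" "(\<lambda>k. z (int (k * p))) \<longlonglongrightarrow> xs (cycle_index p xs z)"
proof -
  obtain i where i: "i < p" "(\<lambda>k. z (int (k * p))) \<longlonglongrightarrow> xs i"
    using assms by (auto simp: N_def)
  have unique: "j = i" if j: "j < p \<and> (\<lambda>k. z (int (k * p))) \<longlonglongrightarrow> xs j" for j
  proof -
    have "xs j = xs i" using LIMSEQ_unique[OF conjunct2[OF j] i(2)] .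
    then show ?thesis using cycle j i(1) by (auto simp: is_cycle_def dest: inj_onD)
  qed
  have "cycle_index p xs z = i"
    unfolding cycle_index_def
  proof (rule the_equality)
    show "i < p \<and> (\<lambda>k. z (int (k * p))) \<longlonglongrightarrow> xs i" using i by blast
  qed (rule unique)
  then show "cycle_index p xs z < p" "(\<lambda>k. z (int (k * p))) \<longlonglongrightarrow> xs (cycle_index p xs z)"
    using i by simp_all
qed

lemma cycle_index_eqI:
  assumes z: "z \<in> N" and i: "i < p" "(\<lambda>k. z (int (k * p))) \<longlonglongrightarrow> xs i"
  shows "cycle_index p xs z = i"
proof (rule inj_onD)
  show "inj_on xs {..<p}" using cycle by (simp add: is_cycle_def)
  show "xs (cycle_index p xs z) = xs i"
    by (rule LIMSEQ_unique[OF cycle_index_props(2)[OF z] i(2)])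
  show "cycle_index p xs z \<in> {..<p}" "i \<in> {..<p}"
    using cycle_index_props(1)[OF z] i(1) by simp_all
qed

text \<open>Continuity of \<open>r\<close> carries limits only from offset \<open>Suc l\<close> down
  to \<open>l\<close>. The induction therefore descends to \<open>j\<close> from offset
  \<open>p * j\<close>, where the claim is the hypothesis delayed by \<open>j\<close>
  periods.\<close>

lemma path_limit:
  assumes z: "z \<in> path_space r" and i: "(\<lambda>k. z (int (k * p))) \<longlonglongrightarrow> cycle_point i"
  shows "(\<lambda>k. z (int (k * p + j))) \<longlonglongrightarrow> cycle_point (i + j)"
proof -
  have down: "(\<lambda>k. z (int (k * p + l))) \<longlonglongrightarrow> cycle_point (i + l)"
    if "(\<lambda>k. z (int (k * p + Suc l))) \<longlonglongrightarrow> cycle_point (i + Suc l)" for l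
  proof -
    have "(\<lambda>k. r (z (int (k * p + Suc l)))) \<longlonglongrightarrow> r (cycle_point (i + Suc l))"
      by (rule isCont_tendsto_compose[OF r_cont[OF cycle_point_in] that])
    moreover have "r (z (int (k * p + Suc l))) = z (int (k * p + l))" for k
      using path_recursion_nat[OF path_space_iff[THEN iffD1, OF z], of "k * p + l"] by simp
    moreover have "r (cycle_point (i + Suc l)) = cycle_point (i + l)"
      using r_cycle_point[of "i + l"] by simp
    ultimately show ?thesis by (simp only:)
  qed
  have "j \<le> p * j" using p_pos by simp
  then show ?thesis
  proof (induction rule: inc_induct)
    case base
    have "(\<lambda>k. z (int ((k + j) * p))) \<longlonglongrightarrow> cycle_point i"
      using i by (rule LIMSEQ_ignore_initial_segment)
    then show ?case by (simp add: cycle_point_def algebra_simps)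
  next
    case (step l)
    then show ?case using down by blast
  qed
qed

lemma N_limit:
  "z \<in> N \<Longrightarrow> (\<lambda>k. z (int (k * p + j))) \<longlonglongrightarrow> cycle_point (cycle_index p xs z + j)"
  using cycle_index_props[of z] by (intro path_limit) (auto simp: N_def cycle_point_def)

text \<open>\<open>z\<close> at time \<open>k * p\<close> is \<open>path_shift z\<close> at time
  \<open>k * p + 1\<close>, so its limit is the next cycle point.\<close>

lemma N_shift_index:
  assumes w: "path_shift z \<in> N"
  shows "z \<in> N" "cycle_index p xs z = Suc (cycle_index p xs (path_shift z)) mod p"
proof -
  have "z \<in> path_space r" using w by (simp add: N_def)
  moreover have lim: "(\<lambda>k. z (int (k * p))) \<longlonglongrightarrow> xs (Suc (cycle_index p xs (path_shift z)) mod p)"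
    using N_limit[OF w, of 1] by (simp add: path_shift_def cycle_point_def)
  ultimately show "z \<in> N"
    unfolding N_def using mod_less_divisor[OF p_pos] by blast
  then show "cycle_index p xs z = Suc (cycle_index p xs (path_shift z)) mod p"
    using lim p_pos by (intro cycle_index_eqI) simp_all
qed

lemma N_path_shift: "path_shift z \<in> N \<longleftrightarrow> z \<in> N"
proof
  assume z: "z \<in> N"
  then have zp: "z \<in> path_space r" by (simp add: N_def)
  \<comment> \<open>Adding \<open>p - 1\<close> is subtracting one modulo \<open>p\<close>.\<close>
  let ?i = "cycle_index p xs z + (p - 1)"
  have "(\<lambda>k. r (z (int (k * p)))) \<longlonglongrightarrow> r (xs (cycle_index p xs z))"
  proof (rule isCont_tendsto_compose[OF r_cont cycle_index_props(2)[OF z]])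
    show "xs (cycle_index p xs z) \<in> cycle_set p xs"
      using cycle_index_props(1)[OF z] by (simp add: cycle_set_def)
  qed
  moreover have "r (z (int (k * p))) = path_shift z (int (k * p))" for k
    using path_pow[OF zp, of 1 "int (k * p)"] by (simp add: path_shift_def)
  moreover have "r (xs (cycle_index p xs z)) = xs (?i mod p)"
    using r_cycle_point[of ?i] p_pos cycle_index_props(1)[OF z] by (simp add: cycle_point_def)
  ultimately have "(\<lambda>k. path_shift z (int (k * p))) \<longlonglongrightarrow> xs (?i mod p)"
    by (simp only:)
  moreover have "path_shift z \<in> path_space r" using zp by simp
  ultimately show "path_shift z \<in> N"
    unfolding N_def using mod_less_divisor[OF p_pos] by blast
qed (rule N_shift_index)

definition factor :: "(int \<Rightarrow> 'a) \<Rightarrow> nat \<Rightarrow> complex" where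
  "factor z k = inverse (\<alpha> ((cycle_index p xs z + Suc k) mod p)) * m0 (z (int (Suc k)))
    / of_real (sqrt (preim_card r (r (z (int (Suc k))))))"

lemma cmod_factor: "(cmod (factor z k))\<^sup>2 = W (z (int (Suc k)))"
proof -
  have "cmod (\<alpha> ((cycle_index p xs z + Suc k) mod p)) = 1"
    using p_pos by (intro alpha) simp
  then show ?thesis
    using preim_card_pos[of "r (z (int (Suc k)))"]
    by (simp add: factor_def weight_def norm_mult norm_divide norm_inverse power_divide del: of_nat_Suc)
qed

lemma preim_card_ge_1: "1 \<le> preim_card r x"
  using preim_card_pos[of x] by (simp add: preim_card_def)

text \<open>Along one residue class the path is a backward orbit of \<open>r ^^ p\<close> converging
  to a repelling fixed point, hence geometrically. The beta-Lipschitz condition at that point turns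
  this rate into summability.\<close>

lemma summable_factor_residue:
  assumes z: "z \<in> N"
  shows "summable (\<lambda>n. cmod (factor z (p * n + j) - 1))"
proof -
  define w where "w n = z (int (n * p + Suc j))" for n
  define l where "l = (cycle_index p xs z + Suc j) mod p"
  have l: "l < p" using p_pos by (simp add: l_def)
  then have y_in: "xs l \<in> cycle_set p xs" by (simp add: cycle_set_def)
  have w_lim: "w \<longlonglongrightarrow> xs l"
    using N_limit[OF z, of "Suc j"] by (simp add: w_def[abs_def] l_def cycle_point_def del: of_nat_Suc)
  have "(r ^^ p) (w (Suc n)) = w n" for n
  proof -
    have "z \<in> path_space r" using z by (simp add: N_def)
    then have "(r ^^ p) (z (int (Suc n * p + Suc j))) = z (int (Suc n * p + Suc j) - int p)"
      by (rule path_pow)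
    moreover have "int (Suc n * p + Suc j) - int p = int (n * p + Suc j)" by simp
    ultimately show ?thesis by (simp only: w_def)
  qed
  then obtain A c where Ac: "0 < A" "0 < c" "c < 1"
    and geo: "\<forall>\<^sub>F n in sequentially. dist (w n) (xs l) \<le> A * c ^ Suc n"
    using repelling l w_lim repelling_orbit_geometric[of "r ^^ p" "xs l" w]
    unfolding repelling_cycle_def by blast
  obtain \<beta> where \<beta>: "mono_on {0..} \<beta>" "summable (\<lambda>k. \<beta> (A * c ^ Suc k))"
    "\<forall>\<^sub>F x in nhds (xs l). cmod (m0 x - m0 (xs l)) \<le> \<beta> (dist x (xs l))"
    using m0_Lipschitz[OF y_in] Ac unfolding beta_Lipschitz_at_def by blast
  have m0_near: "\<forall>\<^sub>F n in sequentially. cmod (m0 (w n) - m0 (xs l)) \<le> \<beta> (dist (w n) (xs l))"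
    using \<beta>(3) w_lim by (rule eventually_compose_filterlim)
  have r_in: "r (xs l) \<in> cycle_set p xs"
  proof -
    have "r (cycle_point (Suc (l + (p - 1)))) = cycle_point (l + (p - 1))" by (rule r_cycle_point)
    moreover have "cycle_point (Suc (l + (p - 1))) = xs l" using l by (simp add: cycle_point_def)
    ultimately show ?thesis by (metis cycle_point_in)
  qed
  let ?q = "preim_card r (r (xs l))"
  have "(\<lambda>n. r (w n)) \<longlonglongrightarrow> r (xs l)"
    using r_cont[OF y_in] w_lim by (rule isCont_tendsto_compose)
  then have "(\<lambda>n. preim_card r (r (w n))) \<longlonglongrightarrow> ?q"
    by (rule isCont_tendsto_compose[OF card_cont[OF r_in]])
  then have "\<forall>\<^sub>F n in sequentially. dist (preim_card r (r (w n))) ?q < 1"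
    by (rule tendstoD) simp
  \<comment> \<open>A convergent sequence of integers is eventually constant, so the denominator is
    exactly its value at the cycle point.\<close>
  then have card_eq: "\<forall>\<^sub>F n in sequentially. preim_card r (r (w n)) = ?q"
    by eventually_elim (simp add: preim_card_def dist_real_def)
  have "\<forall>\<^sub>F n in sequentially. norm (cmod (factor z (p * n + j) - 1)) \<le> \<beta> (A * c ^ Suc n)"
    using geo m0_near card_eq
  proof eventually_elim
    case (elim n)
    let ?s = "complex_of_real (sqrt ?q)"
    have \<alpha>: "cmod (\<alpha> l) = 1" by (rule alpha[OF l])
    have q: "1 \<le> ?q" by (rule preim_card_ge_1)
    have s0: "?s \<noteq> 0" using q by simp
    have a0: "\<alpha> l \<noteq> 0" using \<alpha> by auto
    have "(cycle_index p xs z + Suc (p * n + j)) mod p = l"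
      by (simp add: l_def) (metis add.assoc add.commute add_Suc_right mod_mult_self2)
    moreover have "z (int (Suc (p * n + j))) = w n"
      by (simp add: w_def mult.commute)
    ultimately have "factor z (p * n + j) = inverse (\<alpha> l) * m0 (w n) / ?s"
      using elim(3) by (simp add: factor_def del: of_nat_Suc)
    \<comment> \<open>The prescribed value of \<open>m0\<close> at \<open>xs l\<close> makes the
      factor there equal to 1, so only the difference of values of \<open>m0\<close>
      remains.\<close>
    also have "\<dots> - 1 = inverse (\<alpha> l) * (m0 (w n) - m0 (xs l)) / ?s"
      using s0 a0 by (simp add: m0_cycle[OF l] field_simps)
    finally have "cmod (factor z (p * n + j) - 1) = cmod (m0 (w n) - m0 (xs l)) / sqrt ?q"
      using \<alpha> q by (simp add: norm_mult norm_divide norm_inverse)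
    also have "\<dots> \<le> cmod (m0 (w n) - m0 (xs l)) / 1"
      using q by (intro divide_left_mono) simp_all
    also have "\<dots> \<le> \<beta> (dist (w n) (xs l))" using elim(2) by simp
    also have "\<dots> \<le> \<beta> (A * c ^ Suc n)"
      using \<beta>(1) elim(1) Ac by (intro mono_onD[of "{0..}" \<beta>]) simp_all
    finally show ?case by simp
  qed
  then show ?thesis using \<beta>(2) by (rule summable_comparison_test_ev)
qed

lemma summable_factor: "z \<in> N \<Longrightarrow> summable (\<lambda>k. cmod (factor z k - 1))"
  by (rule summable_residue_classes[OF p_pos]) (simp_all add: summable_factor_residue)

text \<open>The weight is the squared modulus of a factor \<open>f\<close>, and
  \<open>1 - |f|^2 = (1 - |f|) * (1 + |f|)\<close> is at most twice \<open>|f - 1|\<close>, because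
  \<open>|f| \<le> 1\<close>.\<close>

lemma summable_weight_defect:
  assumes z: "z \<in> N"
  shows "summable (\<lambda>k. 1 - W (z (int (Suc k))))"
proof (rule summable_comparison_test[OF exI[of _ 0]])
  show "summable (\<lambda>k. 2 * cmod (factor z k - 1))"
    using summable_factor[OF z] by (rule summable_mult)
  show "\<forall>k\<ge>0. norm (1 - W (z (int (Suc k)))) \<le> 2 * cmod (factor z k - 1)"
  proof (intro allI impI)
    fix k :: nat
    let ?f = "factor z k"
    have "(cmod ?f)\<^sup>2 \<le> 1\<^sup>2" unfolding cmod_factor using W_le_1 by simp
    then have f1: "cmod ?f \<le> 1" by (rule power2_le_imp_le) simp
    have "1 - W (z (int (Suc k))) = (1 - cmod ?f) * (1 + cmod ?f)"
      unfolding cmod_factor[symmetric] by (simp add: power2_eq_square algebra_simps)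
    also have "\<dots> \<le> (1 - cmod ?f) * 2"
      using f1 by (intro mult_left_mono) simp_all
    also have "\<dots> \<le> cmod (?f - 1) * 2"
      using norm_triangle_ineq2[of 1 ?f] by (intro mult_right_mono) (simp_all add: norm_minus_commute)
    finally show "norm (1 - W (z (int (Suc k)))) \<le> 2 * cmod (?f - 1)"
      using W_le_1[of "z (int (Suc k))"] by simp
  qed
qed

text \<open>The Weierstrass inequality bounds the tail product below by one minus the tail of a
  convergent series.\<close>

lemma N_path_weight_tail:
  assumes z: "z \<in> N"
  shows "(\<lambda>n. path_weight W ((path_unshift ^^ n) z)) \<longlonglongrightarrow> 1"
proof -
  define a where "a k = 1 - W (z (int (Suc k)))" for k
  have a: "0 \<le> a k" "a k \<le> 1" for k
    using W_le_1 W_nonneg by (simp_all add: a_def)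
  have sum_a: "summable a" unfolding a_def[abs_def] by (rule summable_weight_defect[OF z])
  have lower: "1 - (\<Sum>k. a (k + n)) \<le> path_weight W ((path_unshift ^^ n) z)" for n
  proof (rule LIMSEQ_le_const[OF path_weight_LIMSEQ], intro exI[of _ 0] allI impI)
    fix M :: nat
    have "1 - (\<Sum>k. a (k + n)) \<le> 1 - (\<Sum>k<M. a (k + n))"
      using a(1) sum_a by (intro diff_left_mono sum_le_suminf) (simp_all add: summable_iff_shift)
    also have "\<dots> \<le> (\<Prod>k<M. 1 - a (k + n))"
      by (intro prod_one_minus_ge a)
    also have "\<dots> = (\<Prod>k<M. W ((path_unshift ^^ n) z (int (Suc k))))"
      by (intro prod.cong) (simp_all add: a_def path_unshift_pow algebra_simps)
    finally show "1 - (\<Sum>k. a (k + n)) \<le> (\<Prod>k<M. W ((path_unshift ^^ n) z (int (Suc k))))" .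
  qed
  have "(\<lambda>n. suminf a - (\<Sum>k<n. a k)) \<longlonglongrightarrow> suminf a - suminf a"
    using summable_LIMSEQ[OF sum_a] by (intro tendsto_diff tendsto_const)
  then have "(\<lambda>n. 1 - (\<Sum>k. a (k + n))) \<longlonglongrightarrow> 1 - 0"
    unfolding suminf_minus_initial_segment[OF sum_a] by (intro tendsto_diff tendsto_const) simp
  then have "(\<lambda>n. 1 - (\<Sum>k. a (k + n))) \<longlonglongrightarrow> 1" by simp
  then show ?thesis
  proof (rule tendsto_sandwich[OF _ _ _ tendsto_const, rotated -1])
    show "\<forall>\<^sub>F n in sequentially. 1 - (\<Sum>k. a (k + n)) \<le> path_weight W ((path_unshift ^^ n) z)"
      by (intro always_eventually allI lower)
    show "\<forall>\<^sub>F n in sequentially. path_weight W ((path_unshift ^^ n) z) \<le> 1"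
      by (intro always_eventually allI path_weight_le_1)
  qed
qed

lemma N_borel_sets: "N \<in> sets borel"
proof -
  have "N = path_space r \<inter> (\<Union>i<p. {z. (\<lambda>k. z (int (k * p))) \<longlonglongrightarrow> xs i})"
    by (auto simp: N_def)
  also have "\<dots> \<in> sets borel"
    by (intro sets.Int sets.finite_UN limit_set_borel paths_measurable) simp
  finally show ?thesis .
qed

sublocale path_system r \<rho> W N
proof
  show "N \<subseteq> path_space r" by (auto simp: N_def)
qed (fact N_borel_sets N_path_shift N_path_weight_tail)+

end

section \<open>The scaling function and the operators of the cycle\<close>

context cycle_system
begin

lemma cycle_measure_eq: "cycle_measure r \<rho> p xs = lam"
  unfolding cycle_measure_def path_counting_measure_def by (simp add: N_Int_paths)

abbreviation \<phi> :: "(int \<Rightarrow> 'a) \<Rightarrow> complex" where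
  "\<phi> \<equiv> phi_hat r p xs \<alpha> m0"

text \<open>Summability of \<open>factor z k - 1\<close> in modulus makes the infinite product
  converge absolutely, so \<open>prodinf\<close> really is the limit of the partial
  products.\<close>

lemma phi_hat_LIMSEQ:
  assumes z: "z \<in> N"
  shows "(\<lambda>n. \<Prod>k\<le>n. factor z k) \<longlonglongrightarrow> \<phi> z"
proof -
  have "abs_convergent_prod (factor z)"
    by (rule summable_imp_abs_convergent_prod[OF summable_factor[OF z]])
  then have "convergent_prod (factor z)"
    by (rule abs_convergent_prod_imp_convergent_prod)
  then have "(\<lambda>n. \<Prod>k\<le>n. factor z k) \<longlonglongrightarrow> prodinf (factor z)"
    by (rule convergent_prod_LIMSEQ)
  moreover have "\<phi> z = prodinf (factor z)"
    using z by (simp add: phi_hat_def N_iff[symmetric] factor_def[abs_def])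
  ultimately show ?thesis by simp
qed

lemma phi_hat_norm:
  assumes z: "z \<in> N"
  shows "(cmod (\<phi> z))\<^sup>2 = path_weight W z"
proof (rule LIMSEQ_unique)
  show "(\<lambda>n. (cmod (\<Prod>k\<le>n. factor z k))\<^sup>2) \<longlonglongrightarrow> (cmod (\<phi> z))\<^sup>2"
    by (intro tendsto_power tendsto_norm phi_hat_LIMSEQ z)
  have "(cmod (\<Prod>k\<le>n. factor z k))\<^sup>2 = (\<Prod>k<Suc n. W (z (int (Suc k))))" for n
    by (simp only: prod_norm[symmetric] prod_power_distrib cmod_factor lessThan_Suc_atMost)
  then show "(\<lambda>n. (cmod (\<Prod>k\<le>n. factor z k))\<^sup>2) \<longlonglongrightarrow> path_weight W z"
    using LIMSEQ_Suc[OF path_weight_LIMSEQ[of z]] by (simp only:)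
qed

definition U_factor :: "(int \<Rightarrow> 'a) \<Rightarrow> complex" where
  "U_factor z = \<alpha> (cycle_index p xs z) * of_real (sqrt (preim_card r (r (z 0))))"

lemma U_factor_norm:
  assumes z: "z \<in> N"
  shows "(cmod (U_factor z))\<^sup>2 = preim_card r (r (z 0))"
proof -
  have "cmod (\<alpha> (cycle_index p xs z)) = 1" by (rule alpha[OF cycle_index_props(1)[OF z]])
  then show ?thesis
    using preim_card_pos[of "r (z 0)"] by (simp add: U_factor_def norm_mult)
qed

text \<open>Shifting prepends a single factor: the index of the shifted path is one lower modulo
  \<open>p\<close>, which offsets the delay in \<open>k\<close>, so the phases match.\<close>

lemma factor_path_shift:
  assumes z: "z \<in> N"
  shows "factor (path_shift z) 0
      = inverse (\<alpha> (cycle_index p xs z)) * m0 (z 0) / of_real (sqrt (preim_card r (r (z 0))))"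
    and "factor (path_shift z) (Suc k) = factor z k"
proof -
  have idx: "cycle_index p xs z = Suc (cycle_index p xs (path_shift z)) mod p"
    using z by (intro N_shift_index(2)) (simp add: N_path_shift)
  then show "factor (path_shift z) 0
      = inverse (\<alpha> (cycle_index p xs z)) * m0 (z 0) / of_real (sqrt (preim_card r (r (z 0))))"
    by (simp add: factor_def path_shift_def)
  have "(cycle_index p xs (path_shift z) + Suc (Suc k)) mod p = (cycle_index p xs z + Suc k) mod p"
    unfolding idx mod_add_left_eq by simp
  moreover have "path_shift z (int (Suc (Suc k))) = z (int (Suc k))"
    by (simp add: path_shift_def)
  ultimately show "factor (path_shift z) (Suc k) = factor z k"
    by (simp only: factor_def)
qed

lemma phi_hat_scaling:
  assumes z: "z \<in> N"
  shows "U_factor z * \<phi> (path_shift z) = m0 (z 0) * \<phi> z"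
proof -
  have "path_shift z \<in> N" using z by (simp add: N_path_shift)
  then have "(\<lambda>n. \<Prod>k\<le>Suc n. factor (path_shift z) k) \<longlonglongrightarrow> \<phi> (path_shift z)"
    by (intro LIMSEQ_Suc phi_hat_LIMSEQ)
  moreover have "(\<Prod>k\<le>Suc n. factor (path_shift z) k)
      = factor (path_shift z) 0 * (\<Prod>k\<le>n. factor z k)" for n
    by (subst prod.atMost_Suc_shift) (simp add: factor_path_shift(2)[OF z])
  ultimately have "(\<lambda>n. factor (path_shift z) 0 * (\<Prod>k\<le>n. factor z k)) \<longlonglongrightarrow> \<phi> (path_shift z)"
    by (simp only:)
  moreover have "(\<lambda>n. factor (path_shift z) 0 * (\<Prod>k\<le>n. factor z k))
      \<longlonglongrightarrow> factor (path_shift z) 0 * \<phi> z"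
    by (intro tendsto_mult_left phi_hat_LIMSEQ z)
  ultimately have "\<phi> (path_shift z) = factor (path_shift z) 0 * \<phi> z"
    by (rule LIMSEQ_unique)
  moreover have "U_factor z * factor (path_shift z) 0 = m0 (z 0)"
  proof -
    have "cmod (\<alpha> (cycle_index p xs z)) = 1" by (rule alpha[OF cycle_index_props(1)[OF z]])
    then have "\<alpha> (cycle_index p xs z) \<noteq> 0" by auto
    then show ?thesis
      using preim_card_pos[of "r (z 0)"]
      by (simp add: factor_path_shift(1)[OF z] U_factor_def)
  qed
  ultimately show ?thesis by (simp add: mult.assoc[symmetric])
qed

lemma cycle_index_measurable: "cycle_index p xs \<in> measurable borel (count_space UNIV)"
proof (subst measurable_count_space_eq2_countable, intro conjI ballI)
  fix j :: nat
  define L where "L i = {z :: int \<Rightarrow> 'a. (\<lambda>k. z (int (k * p))) \<longlonglongrightarrow> xs i}" for i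
  have L: "L i \<in> sets borel" for i unfolding L_def by (rule limit_set_borel)
  \<comment> \<open>The value of \<open>cycle_index\<close> on sequences converging to no cycle point.\<close>
  define d where "d = (THE i :: nat. False)"
  have in_L: "cycle_index p xs z = i" if i: "i < p" "z \<in> L i" for z i
    unfolding cycle_index_def
  proof (rule the_equality)
    show "i < p \<and> (\<lambda>k. z (int (k * p))) \<longlonglongrightarrow> xs i" using i by (simp add: L_def)
    fix l assume l: "l < p \<and> (\<lambda>k. z (int (k * p))) \<longlonglongrightarrow> xs l"
    have "xs l = xs i"
      by (rule LIMSEQ_unique[OF conjunct2[OF l]]) (use i in \<open>simp add: L_def\<close>)
    then show "l = i"
      using cycle l i(1) by (auto simp: is_cycle_def dest: inj_onD)
  qed
  have out_L: "cycle_index p xs z = d" if "z \<notin> (\<Union>i<p. L i)" for z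
  proof -
    \<comment> \<open>The description is the same unsatisfiable predicate for all such
      \<open>z\<close>, so its unspecified value does not depend on \<open>z\<close>.\<close>
    have "(\<lambda>i. i < p \<and> (\<lambda>k. z (int (k * p))) \<longlonglongrightarrow> xs i) = (\<lambda>i. False)"
      using that by (auto simp: L_def)
    then show ?thesis by (simp add: cycle_index_def d_def)
  qed
  have "cycle_index p xs -` {j} = (if j < p then L j else {}) \<union> (if j = d then - (\<Union>i<p. L i) else {})"
  proof (rule set_eqI)
    fix z
    show "z \<in> cycle_index p xs -` {j} \<longleftrightarrow>
        z \<in> (if j < p then L j else {}) \<union> (if j = d then - (\<Union>i<p. L i) else {})"
    proof (cases "z \<in> (\<Union>i<p. L i)")
      case True
      then obtain i where i: "i < p" "z \<in> L i" by blast
      then show ?thesis using True in_L[OF i] in_L[of j z] by auto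
    next
      case False
      then show ?thesis using out_L[OF False] by auto
    qed
  qed
  moreover have "- (\<Union>i<p. L i) \<in> sets borel"
    by (intro borel_comp sets.finite_UN L) simp
  ultimately show "cycle_index p xs -` {j} \<inter> space borel \<in> sets borel"
    using L by auto
qed simp

lemma indexed_measurable: "(\<lambda>z. f (cycle_index p xs z)) \<in> measurable borel M" if "range f \<subseteq> space M"
  using that by (intro measurable_compose[OF cycle_index_measurable]) (auto simp: measurable_count_space_eq1)

lemma of_real_sqrt_card_measurable:
  "(\<lambda>x. complex_of_real (sqrt (preim_card r (r x)))) \<in> borel_measurable borel"
proof -
  have "(\<lambda>x. preim_card r (r x)) \<in> borel_measurable borel"
    by (rule measurable_compose[OF r_measurable preim_card_measurable])
  then show ?thesis by simp
qed

lemma factor_measurable: "(\<lambda>z. factor z k) \<in> borel_measurable borel"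
proof -
  have "(\<lambda>z. complex_of_real (sqrt (preim_card r (r (z (int (Suc k))))))) \<in> borel_measurable borel"
    by (rule measurable_compose[OF component_measurable[of "int (Suc k)"] of_real_sqrt_card_measurable])
  moreover have "(\<lambda>z. m0 (z (int (Suc k)))) \<in> borel_measurable borel"
    by (rule measurable_compose[OF component_measurable Linf_borel[OF m0_Linf]])
  moreover have "(\<lambda>z. inverse (\<alpha> ((cycle_index p xs z + Suc k) mod p))) \<in> borel_measurable borel"
    by (rule indexed_measurable[where f = "\<lambda>i. inverse (\<alpha> ((i + Suc k) mod p))"]) simp
  ultimately show ?thesis
    unfolding factor_def
    by (intro borel_measurable_divide borel_measurable_times)
qed

lemma phi_hat_measurable: "\<phi> \<in> borel_measurable lam"
proof -
  have "(\<lambda>z. indicator N z *\<^sub>R lim (\<lambda>n. \<Prod>k\<le>n. factor z k)) \<in> borel_measurable borel"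
    by (intro borel_measurable_scaleR borel_measurable_indicator N_borel_sets
        borel_measurable_lim_metric borel_measurable_prod factor_measurable)
  moreover have "\<phi> = (\<lambda>z. indicator N z *\<^sub>R lim (\<lambda>n. \<Prod>k\<le>n. factor z k))"
  proof (rule ext)
    fix z
    show "\<phi> z = indicator N z *\<^sub>R lim (\<lambda>n. \<Prod>k\<le>n. factor z k)"
    proof (cases "z \<in> N")
      case True
      then show ?thesis using limI[OF phi_hat_LIMSEQ[OF True]] by simp
    next
      case False
      then show ?thesis by (simp add: phi_hat_def N_iff[symmetric])
    qed
  qed
  ultimately have "\<phi> \<in> borel_measurable borel" by (simp only:)
  then show ?thesis by (rule borel_measurable_lam)
qed

lemma U_factor_measurable: "U_factor \<in> borel_measurable lam"
proof (rule borel_measurable_lam)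
  have "(\<lambda>z :: int \<Rightarrow> 'a. complex_of_real (sqrt (preim_card r (r (z 0))))) \<in> borel_measurable borel"
    by (rule measurable_compose[OF component_measurable[of 0] of_real_sqrt_card_measurable])
  then show "U_factor \<in> borel_measurable borel"
    unfolding U_factor_def
    by (intro borel_measurable_times indexed_measurable) simp_all
qed

sublocale scaling_system r \<rho> W N U_factor m0 \<phi>
  by unfold_locales
     (fact U_factor_measurable U_factor_norm m0_Linf phi_hat_measurable phi_hat_norm phi_hat_scaling)+

lemma U_op_eq: "U_op r p xs \<alpha> = U"
  by (simp add: fun_eq_iff U_op_def U_def U_factor_def)

lemma V_eq:
  "inverse_translate lam (U_op r p xs \<alpha>) (L2_closure lam {pi_op f \<phi> | f. f \<in> Linf \<rho>}) = V"
  by (simp add: V_def V0_def U_op_eq)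

lemma weight_cycle:
  assumes "x \<in> cycle_set p xs"
  shows "W x = 1"
proof -
  obtain i where i: "i < p" "x = xs i" using assms by (auto simp: cycle_set_def)
  then show ?thesis
    using preim_card_pos[of "r (xs i)"] alpha[OF i(1)]
    by (simp add: weight_def m0_cycle norm_mult)
qed

lemma harmonic_eq: "harmonic_of_cycle r p xs W x = enn2real (total_weight x)"
  unfolding harmonic_of_cycle_def measure_def total_weight_def emeasure_path_measure_N[symmetric]
  by (simp add: N_Int_paths)

lemma total_weight_measurable: "total_weight \<in> borel_measurable borel"
  unfolding total_weight_def
  by (rule path_sum_measurable) (simp add: path_weight_measurable_lam)

text \<open>Complex sums over paths are avoided. Under projection to the starting point,
  \<open>lam\<close> with density |\<open>\<phi>\<close>|^2 is sent to \<open>\<rho>\<close> with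
  density \<open>h_C\<close>, an identity between nonnegative integrals; the inner product follows
  by change of variables.\<close>

lemma pi_op_inner:
  assumes f: "f \<in> Linf \<rho>"
  shows "has_bochner_integral \<rho> (\<lambda>x. f x * of_real (harmonic_of_cycle r p xs W x))
    (L2_inner lam (pi_op f \<phi>) \<phi>)"
proof -
  let ?h = "\<lambda>x. enn2real (total_weight x)" and ?d = "\<lambda>z. (cmod (\<phi> z))\<^sup>2"
  have fb: "f \<in> borel_measurable borel" by (rule Linf_borel[OF f])
  have h_meas: "?h \<in> borel_measurable borel"
    by (rule borel_measurable_enn2real[OF total_weight_measurable])
  have h: "ennreal (?h x) = total_weight x" for x
    using total_weight_le_1[of x] by (intro ennreal_enn2real) (auto simp: less_top[symmetric] top_unique)
  have "ennreal (?h x) \<le> 1" for x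
    unfolding h by (rule total_weight_le_1)
  then have h1: "?h x \<le> 1" for x
    by (simp only: ennreal_le_1)
  have d_meas: "?d \<in> borel_measurable lam" using phi_measurable by simp
  have base: "(\<lambda>z. z 0) \<in> measurable (density lam ?d) borel" by simp
  have push: "distr (density lam ?d) borel (\<lambda>z. z 0) = density \<rho> ?h"
  proof (rule measure_eqI)
    show "sets (distr (density lam ?d) borel (\<lambda>z. z 0)) = sets (density \<rho> ?h)"
      by (simp add: rho_borel)
    fix A assume "A \<in> sets (distr (density lam ?d) borel (\<lambda>z. z 0))"
    then have A: "A \<in> sets borel" by simp
    have ind: "(indicator A :: 'a \<Rightarrow> ennreal) \<in> borel_measurable borel"
      using A by (rule borel_measurable_indicator)
    have ind0: "(\<lambda>z. indicator A (z 0) :: ennreal) \<in> borel_measurable lam"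
      by (rule base_measurable_lam[OF ind])
    have "emeasure (distr (density lam ?d) borel (\<lambda>z. z 0)) A
        = (\<integral>\<^sup>+z. indicator A z \<partial>distr (density lam ?d) borel (\<lambda>z. z 0))"
      using A by simp
    also have "\<dots> = (\<integral>\<^sup>+z. indicator A (z 0) \<partial>density lam ?d)"
      by (rule nn_integral_distr[OF base]) (use ind in simp)
    also have "\<dots> = (\<integral>\<^sup>+z. ennreal (?d z) * indicator A (z 0) \<partial>lam)"
      using d_meas by (intro nn_integral_density ind0) simp
    also have "\<dots> = (\<integral>\<^sup>+x. path_sum (\<lambda>z. ennreal (?d z) * indicator A (z 0)) x \<partial>\<rho>)"
      using d_meas ind0 by (intro nn_integral_lam) simp
    also have "\<dots> = (\<integral>\<^sup>+x. ennreal (?h x) * indicator A x \<partial>\<rho>)"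
    proof (rule nn_integral_cong)
      fix x
      have "path_sum (\<lambda>z. ennreal (?d z) * indicator A (z 0)) x
          = path_sum (\<lambda>z. indicator A (z 0) * ennreal (path_weight W z)) x"
        by (rule path_sum_cong) (simp add: phi_norm mult.commute)
      also have "\<dots> = ennreal (?h x) * indicator A x"
        by (subst path_sum_base) (simp only: total_weight_def[symmetric] h mult.commute)
      finally show "path_sum (\<lambda>z. ennreal (?d z) * indicator A (z 0)) x = ennreal (?h x) * indicator A x" .
    qed
    also have "\<dots> = emeasure (density \<rho> ?h) A"
      using A h_meas by (subst emeasure_density) (simp_all add: rho_borel measurable_cong_sets[OF rho_borel refl])
    finally show "emeasure (distr (density lam ?d) borel (\<lambda>z. z 0)) A = emeasure (density \<rho> ?h) A" .
  qed
  have "L2_inner lam (pi_op f \<phi>) \<phi> = (\<integral>z. ?d z *\<^sub>R f (z 0) \<partial>lam)"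
    unfolding L2_inner_def pi_op_def
    unfolding scaleR_conv_of_real complex_norm_square
    by (intro Bochner_Integration.integral_cong refl) (simp only: mult_ac)
  also have "\<dots> = (\<integral>z. f (z 0) \<partial>density lam ?d)"
    using d_meas base_measurable_lam[OF fb] by (intro integral_density[symmetric]) simp_all
  also have "\<dots> = (\<integral>x. f x \<partial>distr (density lam ?d) borel (\<lambda>z. z 0))"
    by (rule integral_distr[OF base fb, symmetric])
  also have "\<dots> = (\<integral>x. ?h x *\<^sub>R f x \<partial>\<rho>)"
    unfolding push using h_meas fb
    by (intro integral_density) (simp_all add: measurable_cong_sets[OF rho_borel refl])
  also have "\<dots> = (\<integral>x. f x * of_real (harmonic_of_cycle r p xs W x) \<partial>\<rho>)"
    by (simp add: harmonic_eq scaleR_conv_of_real mult.commute)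
  finally have value_eq: "(\<integral>x. f x * of_real (harmonic_of_cycle r p xs W x) \<partial>\<rho>)
      = L2_inner lam (pi_op f \<phi>) \<phi>" ..
  interpret prob_space \<rho> by (rule rho_prob)
  obtain B where B: "AE x in \<rho>. cmod (f x) \<le> B" using f by (auto simp: Linf_def)
  have "integrable \<rho> (\<lambda>x. f x * of_real (harmonic_of_cycle r p xs W x))"
  proof (rule integrable_const_bound)
    show "AE x in \<rho>. norm (f x * of_real (harmonic_of_cycle r p xs W x)) \<le> B"
      using B
    proof eventually_elim
      case (elim x)
      have "cmod (f x) * ?h x \<le> cmod (f x) * 1" using h1 by (intro mult_left_mono) simp_all
      then show ?case using elim by (simp add: norm_mult harmonic_eq)
    qed
    show "(\<lambda>x. f x * of_real (harmonic_of_cycle r p xs W x)) \<in> borel_measurable \<rho>"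
      using fb h_meas by (simp add: harmonic_eq measurable_cong_sets[OF rho_borel refl])
  qed
  then show ?thesis
    using value_eq by (simp add: has_bochner_integral_iff)
qed

lemma finite_cycle_set: "finite (cycle_set p xs)"
  by (simp add: cycle_set_def)

text \<open>Each of the \<open>p\<close> residue classes converges to a cycle point, and a common
  threshold exists because there are finitely many of them.\<close>

lemma N_absorbed:
  assumes z: "z \<in> N" and e: "0 < e"
  shows "\<forall>\<^sub>F n in sequentially. z (int n) \<in> (\<Union>c\<in>cycle_set p xs. ball c e)"
proof -
  have "\<forall>\<^sub>F k in sequentially. \<forall>j\<in>{..<p}. z (int (k * p + j)) \<in> (\<Union>c\<in>cycle_set p xs. ball c e)"
  proof (rule eventually_ball_finite)
    show "\<forall>j\<in>{..<p}. \<forall>\<^sub>F k in sequentially. z (int (k * p + j)) \<in> (\<Union>c\<in>cycle_set p xs. ball c e)"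
    proof
      fix j
      have "\<forall>\<^sub>F k in sequentially.
          dist (z (int (k * p + j))) (cycle_point (cycle_index p xs z + j)) < e"
        using N_limit[OF z] e by (rule tendstoD)
      then show "\<forall>\<^sub>F k in sequentially. z (int (k * p + j)) \<in> (\<Union>c\<in>cycle_set p xs. ball c e)"
        by eventually_elim (auto simp: dist_commute intro!: bexI[OF _ cycle_point_in])
    qed
  qed simp
  then obtain K where K: "\<And>k j. k \<ge> K \<Longrightarrow> j < p \<Longrightarrow>
      z (int (k * p + j)) \<in> (\<Union>c\<in>cycle_set p xs. ball c e)"
    unfolding eventually_sequentially by blast
  have "z (int n) \<in> (\<Union>c\<in>cycle_set p xs. ball c e)" if "n \<ge> K * p" for n
  proof -
    have "K \<le> n div p" using that p_pos by (simp add: less_eq_div_iff_mult_less_eq)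
    then have "z (int (n div p * p + n mod p)) \<in> (\<Union>c\<in>cycle_set p xs. ball c e)"
      using p_pos by (intro K) simp_all
    then show ?thesis by (simp only: div_mult_mod_eq)
  qed
  then show ?thesis by (auto simp: eventually_sequentially)
qed

lemma V_Inter:
  assumes null: "measure \<rho> (cycle_set p xs) = 0"
  shows "(\<Inter>n. V n) = {\<xi> \<in> L2 lam. AE z in lam. \<xi> z = 0}"
proof
  show "{\<xi> \<in> L2 lam. AE z in lam. \<xi> z = 0} \<subseteq> (\<Inter>n. V n)"
    using null_V by blast
  show "(\<Inter>n. V n) \<subseteq> {\<xi> \<in> L2 lam. AE z in lam. \<xi> z = 0}"
  proof
    fix \<xi> assume \<xi>: "\<xi> \<in> (\<Inter>n. V n)"
    let ?C = "cycle_set p xs" and ?B = "\<lambda>m. \<Union>c\<in>cycle_set p xs. ball c (inverse (real (Suc m)))"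
    have "AE z in lam. z 0 \<in> ?B m \<or> \<xi> z = 0" for m
    proof (rule V_Inter_support[OF \<xi>])
      show "?B m \<in> sets borel" by (intro borel_open open_UN) simp
      show "\<forall>\<^sub>F n in sequentially. z (int n) \<in> ?B m" if "z \<in> N" for z
        by (rule N_absorbed[OF that]) simp
    qed
    then have support: "AE z in lam. \<forall>m. z 0 \<in> ?B m \<or> \<xi> z = 0"
      by (subst AE_all_countable) (rule allI)
    have C_borel: "?C \<in> sets borel"
      using finite_cycle_set by (intro borel_closed finite_imp_closed)
    have "AE x in \<rho>. x \<notin> ?C"
    proof -
      interpret prob_space \<rho> by (rule rho_prob)
      have "?C \<in> null_sets \<rho>"
        using null C_borel by (simp add: null_sets_def emeasure_eq_measure rho_borel)
      then show ?thesis by (rule AE_not_in)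
    qed
    \<comment> \<open>A point may start infinitely many paths, but
      \<open>0 * \<infinity> = 0\<close>: a null set of starting points carries no mass in
      \<open>lam\<close>.\<close>
    then have "(\<integral>\<^sup>+x. indicator ?C x * path_sum (\<lambda>_. 1) x \<partial>\<rho>) = (\<integral>\<^sup>+x. 0 \<partial>\<rho>)"
      by (intro nn_integral_cong_AE) auto
    moreover have ind: "(\<lambda>z. indicator ?C (z 0) :: ennreal) \<in> borel_measurable lam"
      using C_borel by (intro base_measurable_lam borel_measurable_indicator)
    have "(\<integral>\<^sup>+z. indicator ?C (z 0) \<partial>lam) = (\<integral>\<^sup>+x. indicator ?C x * path_sum (\<lambda>_. 1) x \<partial>\<rho>)"
    proof -
      have "path_sum (\<lambda>z. indicator ?C (z 0)) x = indicator ?C x * path_sum (\<lambda>_. 1) x" for x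
        using path_sum_base[of "indicator ?C" "\<lambda>_. 1" x] by simp
      then show ?thesis by (subst nn_integral_lam[OF ind]) (auto intro!: nn_integral_cong)
    qed
    ultimately have "(\<integral>\<^sup>+z. indicator ?C (z 0) \<partial>lam) = (0::ennreal)" by simp
    then have "AE z in lam. indicator ?C (z 0) = (0::ennreal)"
      by (simp add: nn_integral_0_iff_AE[OF ind])
    then have "AE z in lam. \<xi> z = 0"
      using support
    proof eventually_elim
      case (elim z)
      then have "z 0 \<notin> ?C" by (simp add: indicator_def split: if_splits)
      moreover have "closed ?C" by (rule finite_imp_closed[OF finite_cycle_set])
      ultimately have "open (- ?C)" "z 0 \<in> - ?C" by auto
      \<comment> \<open>\<open>C\<close> is closed, being finite, so a starting point off
        \<open>C\<close> lies outside the balls of some small radius, where \<open>support\<close>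
        forces \<open>\<xi> z = 0\<close>.\<close>
      then obtain e where e: "0 < e" "ball (z 0) e \<subseteq> - ?C"
        unfolding open_contains_ball by blast
      obtain m where m: "inverse (real (Suc m)) < e" using reals_Archimedean[OF e(1)] by blast
      have "z 0 \<notin> ?B m"
      proof
        assume "z 0 \<in> ?B m"
        then obtain c where c: "c \<in> ?C" "dist c (z 0) < inverse (real (Suc m))" by auto
        then have "c \<in> ball (z 0) e" using m by (simp add: dist_commute)
        then show False using e(2) c(1) by blast
      qed
      then show ?case using elim by blast
    qed
    moreover have "\<xi> \<in> V 0" using \<xi> by blast
    then have "\<xi> \<in> L2 lam" by (simp add: V_def inverse_translate_def)
    ultimately show "\<xi> \<in> {\<xi> \<in> L2 lam. AE z in lam. \<xi> z = 0}" by blast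
  qed
qed

lemma U_phi: "AE z in lam. U \<phi> z = pi_op m0 \<phi> z"
  using AE_lam_N
proof eventually_elim
  case (elim z)
  show ?case using phi_scaling[OF elim] by (simp add: U_def pi_op_def)
qed

end

text \<open>Elements of \<open>L2\<close> are functions, so equality of vectors is almost everywhere
  equality and the zero subspace consists of the null functions. \<open>has_bochner_integral\<close>
  asserts integrability together with the value.\<close>

theorem theorem2p14:
  fixes r :: "'a::{metric_space, second_countable_topology} \<Rightarrow> 'a"
    and \<rho> :: "'a measure"
    and p :: nat and xs :: "nat \<Rightarrow> 'a" and \<alpha> :: "nat \<Rightarrow> complex"
    and m0 :: "'a \<Rightarrow> complex"
  defines "lam \<equiv> cycle_measure r \<rho> p xs"
    and "U \<equiv> U_op r p xs \<alpha>"
    and "\<phi> \<equiv> phi_hat r p xs \<alpha> m0"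
    and "C \<equiv> cycle_set p xs"
    and "W \<equiv> weight r m0"
  defines "V \<equiv> inverse_translate lam U (L2_closure lam {pi_op f \<phi> | f. f \<in> Linf \<rho>})"
  assumes compact_X: "compact (UNIV :: 'a set)"
    and r_measurable: "r \<in> borel_measurable borel"
    and r_onto: "surj r"
    and r_finite_to_one: "\<And>x. finite (r -` {x})"
    and r_noninvertible: "\<not> inj r"
    and rho_prob: "prob_space \<rho>"
    and rho_borel: "sets \<rho> = sets borel"
    and rho_invariant: "strongly_invariant r \<rho>"
    and cycle: "is_cycle r p xs"
    and alpha: "\<And>i. i < p \<Longrightarrow> cmod (\<alpha> i) = 1"
    and repelling: "repelling_cycle r p xs"
    and r_cont: "\<And>x. x \<in> C \<Longrightarrow> isCont r x"
    and card_cont: "\<And>x. x \<in> C \<Longrightarrow> isCont (preim_card r) x"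
    and m0_Linf: "m0 \<in> Linf \<rho>"
    and m0_Lipschitz: "\<And>x. x \<in> C \<Longrightarrow> beta_Lipschitz_at m0 x"
    and m0_QMF: "\<And>x. (\<Sum>y \<in> r -` {x}. (cmod (m0 y))\<^sup>2) / preim_card r x = 1"
    and m0_cycle: "\<And>i. i < p \<Longrightarrow> m0 (xs i) = \<alpha> i * of_real (sqrt (preim_card r (r (xs i))))"
  shows
    "(\<phi> \<in> L2 lam \<and> (AE z in lam. U \<phi> z = pi_op m0 \<phi> z)) \<and>
     ((\<forall>x\<in>C. W x = 1) \<and>
      (\<forall>f\<in>Linf \<rho>. has_bochner_integral \<rho> (\<lambda>x. f x * of_real (harmonic_of_cycle r p xs W x))
                      (L2_inner lam (pi_op f \<phi>) \<phi>))) \<and>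
     ((\<forall>n. V n \<subseteq> V (n + 1)) \<and>
      L2_closure lam (\<Union>n. V n) = L2 lam \<and>
      (measure \<rho> C = 0 \<longrightarrow> (\<Inter>n. V n) = {\<xi> \<in> L2 lam. AE z in lam. \<xi> z = 0}))"
proof -
  note statement_defs = V_def U_def \<phi>_def lam_def C_def W_def
  interpret cycle_system r \<rho> p xs \<alpha> m0
  proof (intro cycle_system.intro invariant_system.intro cycle_system_axioms.intro)
  qed (fact r_measurable r_onto r_finite_to_one rho_prob rho_borel rho_invariant cycle alpha
      repelling r_cont[unfolded C_def] card_cont[unfolded C_def] m0_Linf
      m0_Lipschitz[unfolded C_def] m0_QMF m0_cycle)+
  show ?thesis
    unfolding statement_defs cycle_measure_eq V_eq
    using phi_L2 U_phi weight_cycle pi_op_inner V_mono V_dense V_Inter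
    by (simp add: U_op_eq)
qed

end
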